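(* Let $R,L>0$, let $f\in\mathscr{S}(\mathbb{R}^2)$ and let $g(x,r)=\frac{1}{2\pi}\int_{S^1}f(x+r\xi,r\eta)\,dS_1(\xi,\eta)$. 1. $G_{range}(a,b)$ is well defined for all $a\in\mathbb{R}$, $b\ge 0$, and for $r>R$ (and $x\in\mathbb{R}$) $$g(x,r)=\int_0^\infty\int_{\mathbb{R}} o_{range}^{a,b}(x,r)\,G_{range}(a,b)\,da\,db .$$ 2. $G_{even}^l(a)$ is well defined for all $a\ge 0$, $l\in\mathbb{N}_0$. Moreover, if $g$ is even in $x$, $0<r<R$, and $x>L$, then $$g(x,r)=\sum_{l=0}^\infty\int_0^\infty o_{even}^{a,l}(x,r)\,G_{even}^l(a)\,da .$$ 3. $G_{odd}^l(a)$ is well defined for all $a\ge 0$, $l\in\mathbb{N}_0$. Moreover, if $g$ is odd in $x$, $0<r<R$, and $x>L$, then $$g(x,r)=\sum_{l=0}^\infty\int_0^\infty o_{odd}^{a,l}(x,r)\,G_{odd}^l(a)\,da .$$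
   Context: $S^1\subset\mathbb{R}^2$ is the unit circle with canonical arc-length measure $S_1$; $\mathscr{S}$ is the Schwartz space; $\mathbb{N}_0=\{0,1,2,\dots\}$; $\mathrm{J}_0$ is the Bessel function of the first kind of order zero; $\delta$ is the Dirac delta, and integrals against $\delta$ are taken in the usual sense $\int_{\mathbb{R}}\delta(x-a)\varphi(a)\,da=\varphi(x)$. Neumann's numbers: $\epsilon_0=1$, $\epsilon_l=2$ for $l\ge1$. For $a\in\mathbb{R}$, $b\ge0$: $o_{range}^{a,b}(x,r)=\delta(x-a)\dfrac{\cos(b\sqrt{r^2-R^2})}{\sqrt{r^2-R^2}}$ for $r>R$, and $0$ otherwise. For $a\ge0$, $l\in\mathbb{N}_0$: $o_{even}^{a,l}(x,r)=\mathrm{J}_0(a\sqrt{x^2-L^2})\dfrac{\cos(l\frac{\pi}{R}\sqrt{R^2-r^2})}{\sqrt{R^2-r^2}}$ for $0\le r<R$ and $|x|>L$, and $0$ otherwise; and $o_{odd}^{a,l}(x,r)=x\,o_{even}^{a,l}(x,r)$. Bilinear pairings: $\langle u,v\rangle_{o_{range}}=\int_R^\infty\int_{\mathbb{R}}u(x,r)v(x,r)\,r\sqrt{r^2-R^2}\,dx\,dr$, $\langle u,v\rangle_{o_{even}}=\int_0^R\int_L^\infty u(x,r)v(x,r)\,r\sqrt{R^2-r^2}\,x\,dx\,dr$, $\langle u,v\rangle_{o_{odd}}=\int_0^R\int_L^\infty u(x,r)v(x,r)\,r\sqrt{R^2-r^2}\,\frac1x\,dx\,dr$. Coefficients: $G_{range}(a,b)=\frac{2}{\pi}\langle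 o_{range}^{a,b}(x,r),\,g(x,r)\rangle_{o_{range}}$ (so $G_{range}(a,b)=\frac2\pi\int_R^\infty r\cos(b\sqrt{r^2-R^2})\,g(a,r)\,dr$), $G_{even}^l(a)=\frac{\epsilon_l}{2R}\,a\,\langle o_{even}^{a,l}(x,r),\,g(x,r)+g(-x,r)\rangle_{o_{even}}$, $G_{odd}^l(a)=\frac{\epsilon_l}{2R}\,a\,\langle o_{odd}^{a,l}(x,r),\,g(x,r)-g(-x,r)\rangle_{o_{odd}}$. "Well defined" means that the defining integrals are finite. *)

theory Defs
  imports "HOL-Analysis.Analysis" "HOL-Probability.Probability"
begin

section \<open>Schwartz functions on the plane\<close>

definition pd :: "real \<times> real \<Rightarrow> (real \<times> real \<Rightarrow> complex) \<Rightarrow> real \<times> real \<Rightarrow> complex" where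
  "pd v f z = frechet_derivative f (at z) v"

abbreviation pd1 :: "(real \<times> real \<Rightarrow> complex) \<Rightarrow> real \<times> real \<Rightarrow> complex" where
  "pd1 \<equiv> pd (1, 0)"

abbreviation pd2 :: "(real \<times> real \<Rightarrow> complex) \<Rightarrow> real \<times> real \<Rightarrow> complex" where
  "pd2 \<equiv> pd (0, 1)"

fun Ck :: "nat \<Rightarrow> (real \<times> real \<Rightarrow> complex) \<Rightarrow> bool" where
  "Ck 0 f \<longleftrightarrow> continuous_on UNIV f"
| "Ck (Suc k) f \<longleftrightarrow> (\<forall>z. f differentiable (at z)) \<and> Ck k (pd1 f) \<and> Ck k (pd2 f)"

definition schwartz :: "(real \<times> real \<Rightarrow> complex) \<Rightarrow> bool" where
  "schwartz f \<longleftrightarrow> (\<forall>k. Ck k f) \<and>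
     (\<forall>m n i j. bounded (range (\<lambda>(x, y). of_real (x ^ m * y ^ n) * (pd1 ^^ i) ((pd2 ^^ j) f) (x, y))))"


section \<open>Circular means\<close>

text \<open>Arc length on the unit circle is the image of Lebesgue measure under the unit-speed
  parametrization.\<close>

definition circle_measure :: "(real \<times> real) measure" where
  "circle_measure = distr (restrict_space lborel {0..<2 * pi}) borel (\<lambda>t. (cos t, sin t))"

definition circular_mean :: "(real \<times> real \<Rightarrow> complex) \<Rightarrow> real \<Rightarrow> real \<Rightarrow> complex" where
  "circular_mean f x r =
     of_real (1 / (2 * pi)) * (LINT p|circle_measure. f (x + r * fst p, r * snd p))"

lemma circular_mean_parametrized:
  assumes "continuous_on UNIV f"
  shows "circular_mean f x r =
    of_real (1 / (2 * pi)) * (LINT t:{0..<2 * pi}|lborel. f (x + r * cos t, r * sin t))"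
proof -
  have "(\<lambda>p. f (x + r * fst p, r * snd p)) \<in> borel_measurable borel"
    using assms
    by (intro borel_measurable_continuous_onI continuous_on_compose2 [OF assms] continuous_intros) auto
  moreover have "(\<lambda>t. (cos t, sin t)) \<in> measurable (restrict_space lborel {0..<2 * pi}) (borel :: (real \<times> real) measure)"
    by (intro measurable_restrict_space1) (simp add: borel_measurable_continuous_onI continuous_intros)
  ultimately show ?thesis
    unfolding circular_mean_def circle_measure_def
    by (simp add: integral_distr integral_restrict_space set_lebesgue_integral_def)
qed


section \<open>Bessel function and Neumann's numbers\<close>

definition bessel_J0 :: "real \<Rightarrow> real" where
  "bessel_J0 z = (\<Sum>k. (-1) ^ k / (fact k)\<^sup>2 * (z / 2) ^ (2 * k))"

definition neumann :: "nat \<Rightarrow> real" where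
  "neumann l = (if l = 0 then 1 else 2)"


section \<open>Iterated integrals and the Dirac delta\<close>

text \<open>\<open>iint M N h\<close> is the iterated integral of \<open>h s t\<close>, with \<open>t\<close> integrated
  first (against \<open>N\<close>) and \<open>s\<close> second (against \<open>M\<close>). Since the
  Lebesgue integral is total (it is 0 for a non-integrable function), finiteness of the
  integrals involved is the separate predicate \<open>iint_finite\<close>.\<close>

definition iint :: "real measure \<Rightarrow> real measure \<Rightarrow> (real \<Rightarrow> real \<Rightarrow> complex) \<Rightarrow> complex" where
  "iint M N h = (LINT s|M. LINT t|N. h s t)"

definition iint_finite :: "real measure \<Rightarrow> real measure \<Rightarrow> (real \<Rightarrow> real \<Rightarrow> complex) \<Rightarrow> bool" where
  "iint_finite M N h \<longleftrightarrow>
     (\<forall>s\<in>space M. integrable N (h s)) \<and> integrable M (\<lambda>s. LINT t|N. h s t)"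

abbreviation leb_on :: "real set \<Rightarrow> real measure" where
  "leb_on A \<equiv> restrict_space lborel A"

text \<open>The delta is the unit point mass: \<open>\<delta>(x - a) da\<close> is the measure
  \<open>dirac x\<close> in the variable \<open>a\<close>, and \<open>\<delta>(x - a) dx\<close> is the measure
  \<open>dirac a\<close> in the variable \<open>x\<close>. All subsets of the line are measurable for it, so
  that it evaluates every function.\<close>

definition dirac :: "real \<Rightarrow> real measure" where
  "dirac a = return (count_space UNIV) a"

lemma integral_dirac: "(LINT t|dirac a. (\<phi> t :: complex)) = \<phi> a"
  unfolding dirac_def by (rule integral_return) auto


section \<open>The functions o\<close>

text \<open>The generalized function \<open>o_range\<close> is \<open>\<delta>(x - a)\<close> times the ordinary function
  \<open>o_range_factor R b r\<close>, which depends on neither \<open>x\<close> nor \<open>a\<close>. The delta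
  enters as the measure of the integral over \<open>x\<close> or \<open>a\<close>.\<close>

definition o_range_factor :: "real \<Rightarrow> real \<Rightarrow> real \<Rightarrow> complex" where
  "o_range_factor R b r =
     (if r > R then of_real (cos (b * sqrt (r\<^sup>2 - R\<^sup>2)) / sqrt (r\<^sup>2 - R\<^sup>2)) else 0)"

definition o_even :: "real \<Rightarrow> real \<Rightarrow> real \<Rightarrow> nat \<Rightarrow> real \<Rightarrow> real \<Rightarrow> complex" where
  "o_even R L a l x r =
     (if 0 \<le> r \<and> r < R \<and> \<bar>x\<bar> > L
      then of_real (bessel_J0 (a * sqrt (x\<^sup>2 - L\<^sup>2)) *
             (cos (real l * (pi / R) * sqrt (R\<^sup>2 - r\<^sup>2)) / sqrt (R\<^sup>2 - r\<^sup>2)))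
      else 0)"

definition o_odd :: "real \<Rightarrow> real \<Rightarrow> real \<Rightarrow> nat \<Rightarrow> real \<Rightarrow> real \<Rightarrow> complex" where
  "o_odd R L a l x r = of_real x * o_even R L a l x r"


section \<open>Pairings\<close>

text \<open>For each pairing \<open>integrand\<close> is the integrand, as a function of \<open>r\<close> and \<open>x\<close>.
  In \<open>pairing_range R N u v\<close> the inner integral runs over \<open>N\<close>:
  \<open>N = lborel\<close> pairs the ordinary functions \<open>u\<close> and \<open>v\<close>, and \<open>N = dirac a\<close>
  pairs the generalized function \<open>\<delta>(x - a) u(x,r)\<close> with \<open>v\<close>.\<close>

definition integrand_range ::
    "real \<Rightarrow> (real \<Rightarrow> real \<Rightarrow> complex) \<Rightarrow> (real \<Rightarrow> real \<Rightarrow> complex) \<Rightarrow> real \<Rightarrow> real \<Rightarrow> complex" where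
  "integrand_range R u v r x = u x r * v x r * of_real (r * sqrt (r\<^sup>2 - R\<^sup>2))"

definition pairing_range ::
    "real \<Rightarrow> real measure \<Rightarrow> (real \<Rightarrow> real \<Rightarrow> complex) \<Rightarrow> (real \<Rightarrow> real \<Rightarrow> complex) \<Rightarrow> complex" where
  "pairing_range R N u v = iint (leb_on {R<..}) N (integrand_range R u v)"

definition pairing_range_finite ::
    "real \<Rightarrow> real measure \<Rightarrow> (real \<Rightarrow> real \<Rightarrow> complex) \<Rightarrow> (real \<Rightarrow> real \<Rightarrow> complex) \<Rightarrow> bool" where
  "pairing_range_finite R N u v \<longleftrightarrow> iint_finite (leb_on {R<..}) N (integrand_range R u v)"

definition integrand_even ::
    "real \<Rightarrow> (real \<Rightarrow> real \<Rightarrow> complex) \<Rightarrow> (real \<Rightarrow> real \<Rightarrow> complex) \<Rightarrow> real \<Rightarrow> real \<Rightarrow> complex" where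
  "integrand_even R u v r x = u x r * v x r * of_real (r * sqrt (R\<^sup>2 - r\<^sup>2) * x)"

definition pairing_even ::
    "real \<Rightarrow> real \<Rightarrow> (real \<Rightarrow> real \<Rightarrow> complex) \<Rightarrow> (real \<Rightarrow> real \<Rightarrow> complex) \<Rightarrow> complex" where
  "pairing_even R L u v = iint (leb_on {0<..<R}) (leb_on {L<..}) (integrand_even R u v)"

definition pairing_even_finite ::
    "real \<Rightarrow> real \<Rightarrow> (real \<Rightarrow> real \<Rightarrow> complex) \<Rightarrow> (real \<Rightarrow> real \<Rightarrow> complex) \<Rightarrow> bool" where
  "pairing_even_finite R L u v \<longleftrightarrow>
     iint_finite (leb_on {0<..<R}) (leb_on {L<..}) (integrand_even R u v)"

definition integrand_odd ::
    "real \<Rightarrow> (real \<Rightarrow> real \<Rightarrow> complex) \<Rightarrow> (real \<Rightarrow> real \<Rightarrow> complex) \<Rightarrow> real \<Rightarrow> real \<Rightarrow> complex" where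
  "integrand_odd R u v r x = u x r * v x r * of_real (r * sqrt (R\<^sup>2 - r\<^sup>2) * (1 / x))"

definition pairing_odd ::
    "real \<Rightarrow> real \<Rightarrow> (real \<Rightarrow> real \<Rightarrow> complex) \<Rightarrow> (real \<Rightarrow> real \<Rightarrow> complex) \<Rightarrow> complex" where
  "pairing_odd R L u v = iint (leb_on {0<..<R}) (leb_on {L<..}) (integrand_odd R u v)"

definition pairing_odd_finite ::
    "real \<Rightarrow> real \<Rightarrow> (real \<Rightarrow> real \<Rightarrow> complex) \<Rightarrow> (real \<Rightarrow> real \<Rightarrow> complex) \<Rightarrow> bool" where
  "pairing_odd_finite R L u v \<longleftrightarrow>
     iint_finite (leb_on {0<..<R}) (leb_on {L<..}) (integrand_odd R u v)"


section \<open>Coefficients\<close>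

definition G_range :: "real \<Rightarrow> (real \<Rightarrow> real \<Rightarrow> complex) \<Rightarrow> real \<Rightarrow> real \<Rightarrow> complex" where
  "G_range R g a b =
     of_real (2 / pi) * pairing_range R (dirac a) (\<lambda>x r. o_range_factor R b r) g"

definition G_range_well_defined ::
    "real \<Rightarrow> (real \<Rightarrow> real \<Rightarrow> complex) \<Rightarrow> real \<Rightarrow> real \<Rightarrow> bool" where
  "G_range_well_defined R g a b \<longleftrightarrow>
     pairing_range_finite R (dirac a) (\<lambda>x r. o_range_factor R b r) g"

definition G_even :: "real \<Rightarrow> real \<Rightarrow> (real \<Rightarrow> real \<Rightarrow> complex) \<Rightarrow> nat \<Rightarrow> real \<Rightarrow> complex" where
  "G_even R L g l a =
     of_real (neumann l / (2 * R) * a) *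
     pairing_even R L (o_even R L a l) (\<lambda>x r. g x r + g (- x) r)"

definition G_even_well_defined ::
    "real \<Rightarrow> real \<Rightarrow> (real \<Rightarrow> real \<Rightarrow> complex) \<Rightarrow> nat \<Rightarrow> real \<Rightarrow> bool" where
  "G_even_well_defined R L g l a \<longleftrightarrow>
     pairing_even_finite R L (o_even R L a l) (\<lambda>x r. g x r + g (- x) r)"

definition G_odd :: "real \<Rightarrow> real \<Rightarrow> (real \<Rightarrow> real \<Rightarrow> complex) \<Rightarrow> nat \<Rightarrow> real \<Rightarrow> complex" where
  "G_odd R L g l a =
     of_real (neumann l / (2 * R) * a) *
     pairing_odd R L (o_odd R L a l) (\<lambda>x r. g x r - g (- x) r)"

definition G_odd_well_defined ::
    "real \<Rightarrow> real \<Rightarrow> (real \<Rightarrow> real \<Rightarrow> complex) \<Rightarrow> nat \<Rightarrow> real \<Rightarrow> bool" where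
  "G_odd_well_defined R L g l a \<longleftrightarrow>
     pairing_odd_finite R L (o_odd R L a l) (\<lambda>x r. g x r - g (- x) r)"

lemma G_range_explicit:
  "G_range R g a b =
     of_real (2 / pi) *
     (LINT r:{R<..}|lborel. of_real (r * cos (b * sqrt (r\<^sup>2 - R\<^sup>2))) * g a r)"
  if "R > 0"
proof -
  have "pairing_range R (dirac a) (\<lambda>x r. o_range_factor R b r) g =
      (LINT r:{R<..}|lborel. o_range_factor R b r * g a r * of_real (r * sqrt (r\<^sup>2 - R\<^sup>2)))"
    unfolding pairing_range_def iint_def integrand_range_def integral_dirac
    by (simp add: integral_restrict_space set_lebesgue_integral_def)
  also have "\<dots> = (LINT r:{R<..}|lborel. of_real (r * cos (b * sqrt (r\<^sup>2 - R\<^sup>2))) * g a r)"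
  proof (rule set_lebesgue_integral_cong)
    show "\<forall>r. r \<in> {R<..} \<longrightarrow>
        o_range_factor R b r * g a r * of_real (r * sqrt (r\<^sup>2 - R\<^sup>2)) =
        of_real (r * cos (b * sqrt (r\<^sup>2 - R\<^sup>2))) * g a r"
    proof (intro allI impI)
      fix r assume r: "r \<in> {R<..}"
      define s where "s = sqrt (r\<^sup>2 - R\<^sup>2)"
      have "R\<^sup>2 < r\<^sup>2"
        using r that by (intro power_strict_mono) auto
      then have "s \<noteq> 0"
        by (simp add: s_def)
      then show "o_range_factor R b r * g a r * of_real (r * sqrt (r\<^sup>2 - R\<^sup>2)) =
          of_real (r * cos (b * sqrt (r\<^sup>2 - R\<^sup>2))) * g a r"
        using r unfolding o_range_factor_def s_def [symmetric] by (simp add: field_simps)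
    qed
  qed simp
  finally show ?thesis
    by (simp add: G_range_def)
qed

end

theory Submission
  imports Defs
begin

text \<open>
  Each of the three expansions is the inversion formula of a classical transform after a change of
  variables. For the range part fix \<open>x\<close> and put \<open>s = sqrt (r\<^sup>2 - R\<^sup>2)\<close>, so that
  \<open>r dr = s ds\<close>. Then \<open>G_range R g x\<close> is \<open>2 / pi\<close> times the half-line cosine transform of
  \<open>s * g x (sqrt (s\<^sup>2 + R\<^sup>2))\<close> (\<open>G_range_eq_cosine_transform\<close>), and integrating against
  \<open>cos (b * s) / s\<close> inverts this transform (\<open>cosine_inversion\<close>) and divides by \<open>s\<close>.

  For the even part put \<open>x = sqrt (y\<^sup>2 + L\<^sup>2)\<close> and \<open>r = sqrt (R\<^sup>2 - s\<^sup>2)\<close>. Then \<open>G_even\<close> is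
  a Hankel transform of order zero in \<open>y\<close> and the \<open>l\<close>-th cosine coefficient in \<open>s\<close> of
  \<open>s * g\<close>; the integral over \<open>a\<close> inverts the former (\<open>radial_coeff_inversion\<close>) and the sum
  over \<open>l\<close> is the cosine series of the result (\<open>fourier_cosine_series\<close>). The odd part is the
  even part for \<open>g x r / x\<close>. The factor \<open>(v + L\<^sup>2) powr - \<alpha>\<close>, with \<open>\<alpha> = 0\<close> for the even and
  \<open>\<alpha> = 1 / 2\<close> for the odd part, treats both at once (\<open>bessel_fourier_expansion\<close>). The Hankel
  transform is written in the squared variables \<open>v = y\<^sup>2\<close> and \<open>c = a\<^sup>2\<close>: the kernel becomes
  \<open>B (c * v)\<close>, where \<open>B v = J\<^sub>0 (sqrt v)\<close> is an entire function, and the weight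
  \<open>y\<close> disappears.

  Both half-line transforms are inverted by the same argument
  (\<open>self_reciprocal_kernel_inversion\<close>). The kernel \<open>\<kappa>\<close> is symmetric and bounded, and applying
  the transform twice multiplies every exponential \<open>exp (- t * w ^ m)\<close> by one and the same constant \<open>\<mu>\<close>
  (\<open>m = 1\<close> for the Bessel kernel, by \<open>bessel_laplace\<close>; \<open>m = 2\<close> for the cosine, by
  \<open>gaussian_cosine\<close>). If the transform of \<open>\<phi>\<close> is integrable, two applications of Fubini's theorem
  show that the double transform of \<open>\<phi>\<close> minus \<open>\<mu> * \<phi>\<close> is orthogonal to all these exponentials,
  hence zero by the Weierstrass theorem (\<open>exp_transform_injective\<close>).

  The integrability of the transforms comes from integration by parts, done not for the circular mean
  but for \<open>f\<close> along lines before averaging: the functions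
  \<open>f (p + sqrt (v + \<rho>\<^sup>2) *\<^sub>R e)\<close> of \<open>v\<close> decrease rapidly together with their derivatives, uniformly
  in the base point \<open>p\<close> from a bounded set and the direction \<open>e\<close> (\<open>rapid_along_lines\<close>), since \<open>\<rho> > 0\<close> keeps
  the square root smooth. The resulting bounds \<open>O(1 / (1 + c\<^sup>2))\<close> are uniform on the circle and
  survive the average (\<open>circle_average_transform_bound\<close>).

  The cosine series converges at every interior point because the function
  \<open>s \<mapsto> s * g x (sqrt (R\<^sup>2 - s\<^sup>2))\<close> satisfies a Lipschitz condition there, even though it need not be
  Lipschitz up to \<open>s = R\<close>.
\<close>


section \<open>Integration over half-lines\<close>

text \<open>Transforms and their inversion live on the closed half-line, where boundedness and
  continuity at the end point are stated, whereas substitution and the fundamental theorem use the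
  open one.\<close>

lemma leb_on_atLeast_eq_greaterThan:
  fixes f :: "real \<Rightarrow> complex"
  assumes "f \<in> borel_measurable (leb_on {a..})"
  shows "integrable (leb_on {a..}) f \<longleftrightarrow> integrable (leb_on {a<..}) f"
    and "(LINT x|leb_on {a..}. f x) = (LINT x|leb_on {a<..}. f x)"
proof -
  have m1 [measurable]: "(\<lambda>x. indicator {a..} x *\<^sub>R f x) \<in> borel_measurable lborel"
    using assms by (subst (asm) borel_measurable_restrict_space_iff) auto
  have "(\<lambda>x. indicator {a<..} x *\<^sub>R (indicator {a..} x *\<^sub>R f x)) \<in> borel_measurable lborel"
    by measurable
  moreover have "(\<lambda>x. indicator {a<..} x *\<^sub>R (indicator {a..} x *\<^sub>R f x)) = (\<lambda>x. indicator {a<..} x *\<^sub>R f x)"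
    by (auto simp: indicator_def fun_eq_iff)
  ultimately have m2: "(\<lambda>x. indicator {a<..} x *\<^sub>R f x) \<in> borel_measurable lborel" by simp
  have *: "AE x in lborel. indicator {a..} x *\<^sub>R f x = indicator {a<..} x *\<^sub>R f x"
    using AE_lborel_singleton[of a] by eventually_elim (auto simp: indicator_def)
  show "integrable (leb_on {a..}) f \<longleftrightarrow> integrable (leb_on {a<..}) f"
    using integrable_cong_AE[OF m1 m2 *] by (simp add: integrable_restrict_space)
  show "(LINT x|leb_on {a..}. f x) = (LINT x|leb_on {a<..}. f x)"
    using integral_cong_AE[OF m1 m2 *] by (simp add: integral_restrict_space)
qed

lemma integrable_leb_on_bound:
  fixes f :: "real \<Rightarrow> 'a::{banach,second_countable_topology}"
  assumes [measurable]: "A \<in> sets borel" "f \<in> borel_measurable (leb_on A)"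
    and le: "\<And>x. x \<in> A \<Longrightarrow> norm (f x) \<le> C / (1 + x\<^sup>2)"
  shows "integrable (leb_on A) f"
proof (rule Bochner_Integration.integrable_bound)
  have "integrable lborel (\<lambda>x::real. inverse (1 + x\<^sup>2))"
    using integrable_inverse_1_plus_square by (simp add: set_integrable_def)
  then have "integrable lborel (\<lambda>x. C * inverse (1 + x\<^sup>2))"
    by simp
  then have "integrable lborel (\<lambda>x. indicator A x *\<^sub>R (C * inverse (1 + x\<^sup>2)))"
    by (rule integrable_mult_indicator[rotated]) auto
  then show "integrable (leb_on A) (\<lambda>x. C * inverse (1 + x\<^sup>2))"
    by (subst integrable_restrict_space) auto
  show "AE x in leb_on A. norm (f x) \<le> norm (C * inverse (1 + x\<^sup>2))"
  proof (rule AE_I2)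
    fix x assume "x \<in> space (leb_on A)"
    then have "norm (f x) \<le> C / (1 + x\<^sup>2)" using le by (simp add: space_restrict_space)
    then show "norm (f x) \<le> norm (C * inverse (1 + x\<^sup>2))"
      by (simp add: divide_inverse)
  qed
qed fact

lemma interval_lebesgue_halfline:
  "(LBINT x=ereal a..\<infinity>. f x) = (LINT x|leb_on {a<..}. (f x :: complex))"
  by (simp add: interval_lebesgue_integral_def set_lebesgue_integral_def integral_restrict_space einterval_eq)

lemma set_integrable_halfline:
  "set_integrable lborel (einterval (ereal a) \<infinity>) f \<longleftrightarrow> integrable (leb_on {a<..}) (f :: real \<Rightarrow> complex)"
  "set_integrable lborel {a<..} f \<longleftrightarrow> integrable (leb_on {a<..}) (f :: real \<Rightarrow> complex)"
  by (simp_all add: set_integrable_def integrable_restrict_space einterval_eq)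

lemma integral_halfline_FTC:
  fixes F f :: "real \<Rightarrow> complex"
  assumes F: "\<And>x. x \<ge> a \<Longrightarrow> (F has_vector_derivative f x) (at x)"
    and f: "\<And>x. x > a \<Longrightarrow> isCont f x"
    and int: "integrable (leb_on {a<..}) f"
    and lim: "(F \<longlongrightarrow> 0) at_top"
  shows "(LINT x|leb_on {a<..}. f x) = - F a"
proof -
  have "(LBINT x=ereal a..\<infinity>. f x) = 0 - F a"
  proof (rule interval_integral_FTC_integrable)
    have "isCont F a"
      using F[of a] has_vector_derivative_continuous by blast
    then have "(F \<longlongrightarrow> F a) (at_right a)"
      by (metis continuous_within filterlim_at_split isCont_def)
    then show "((F \<circ> real_of_ereal) \<longlongrightarrow> F a) (at_right (ereal a))"
      by (simp add: ereal_tendsto_simps)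
    show "((F \<circ> real_of_ereal) \<longlongrightarrow> 0) (at_left \<infinity>)"
      using lim by (simp add: ereal_tendsto_simps)
  qed (use assms in \<open>auto simp: set_integrable_halfline\<close>)
  then show ?thesis by (simp add: interval_lebesgue_halfline)
qed

lemma integral_halfline_substitution:
  fixes f :: "real \<Rightarrow> complex"
  assumes g: "\<And>x. x > a \<Longrightarrow> (g has_real_derivative g' x) (at x)"
    and g': "\<And>x. x > a \<Longrightarrow> isCont g' x" "\<And>x. x \<ge> a \<Longrightarrow> 0 \<le> g' x"
    and ga: "(g \<longlongrightarrow> g a) (at_right a)" and top: "filterlim g at_top at_top"
    and f: "\<And>x. x > a \<Longrightarrow> isCont f (g x)"
    and int: "integrable (leb_on {a<..}) (\<lambda>x. of_real (g' x) * f (g x))"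
      "integrable (leb_on {g a<..}) f"
  shows "(LINT x|leb_on {g a<..}. f x) = (LINT x|leb_on {a<..}. of_real (g' x) * f (g x))"
proof -
  have "(LBINT x=ereal (g a)..\<infinity>. f x) = (LBINT x=ereal a..\<infinity>. g' x *\<^sub>R f (g x))"
  proof (rule interval_integral_substitution_integrable)
    show "((ereal \<circ> g \<circ> real_of_ereal) \<longlongrightarrow> ereal (g a)) (at_right (ereal a))"
      using ga by (simp add: ereal_tendsto_simps)
    show "((ereal \<circ> g \<circ> real_of_ereal) \<longlongrightarrow> \<infinity>) (at_left \<infinity>)"
      using top by (simp add: ereal_tendsto_simps o_def tendsto_PInfty_eq_at_top at_left_PInf filterlim_filtermap)
  qed (use assms in \<open>auto simp: set_integrable_halfline scaleR_conv_of_real\<close>)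
  then show ?thesis by (simp add: interval_lebesgue_halfline scaleR_conv_of_real)
qed


section \<open>The Bessel function as a function of the squared argument\<close>

text \<open>The function \<open>J\<^sub>0 (sqrt v)\<close> as an entire function of \<open>v\<close>.\<close>

definition bessel_sqrt :: "real \<Rightarrow> real" where
  "bessel_sqrt v = (\<Sum>k. (- 1 / 4) ^ k / (fact k)\<^sup>2 * v ^ k)"

definition bessel_coeff :: "nat \<Rightarrow> real" where
  "bessel_coeff k = (- 1 / 4) ^ k / (fact k)\<^sup>2"

lemma bessel_J0_eq: "bessel_J0 z = bessel_sqrt (z\<^sup>2)"
  unfolding bessel_J0_def bessel_sqrt_def
proof (rule suminf_cong)
  fix k
  have "(z / 2) ^ (2 * k) = (1 / 4) ^ k * (z\<^sup>2) ^ k"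
    unfolding power_mult by (simp add: power_divide)
  moreover have "(- 1 / 4 :: real) ^ k = (- 1) ^ k * (1 / 4) ^ k"
    unfolding power_mult_distrib [symmetric] by simp
  ultimately show "(- 1) ^ k / (fact k)\<^sup>2 * (z / 2) ^ (2 * k) = (- 1 / 4) ^ k / (fact k)\<^sup>2 * (z\<^sup>2) ^ k"
    by simp
qed

lemma summable_exp_coeff: "summable (\<lambda>k. x ^ k / fact k :: real)"
  using summable_exp[of x] by (simp add: field_simps)

lemma summable_bessel_poly:
  "summable (\<lambda>k. real k ^ m * bessel_coeff k * v ^ k)"
proof (rule summable_comparison_test)
  show "summable (\<lambda>k. (3 ^ m * \<bar>v\<bar>) ^ k / fact k)" by (rule summable_exp_coeff)
  show "\<exists>N. \<forall>k\<ge>N. norm (real k ^ m * bessel_coeff k * v ^ k) \<le> (3 ^ m * \<bar>v\<bar>) ^ k / fact k"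
  proof (intro exI[of _ 0] allI impI)
    fix k :: nat
    have "1 + real k \<le> 3 ^ k" by (induction k) auto
    then have "real k \<le> 3 ^ k" by simp
    then have "real k ^ m \<le> (3 ^ k) ^ m" by (intro power_mono) auto
    moreover have "\<bar>bessel_coeff k\<bar> \<le> 1 / fact k"
    proof -
      have "\<bar>bessel_coeff k\<bar> = (1/4) ^ k / (fact k)\<^sup>2"
        by (simp add: bessel_coeff_def abs_divide power_abs)
      also have "\<dots> \<le> 1 / (fact k)\<^sup>2" by (intro divide_right_mono power_le_one) auto
      also have "\<dots> \<le> 1 / fact k"
        using fact_ge_1[of k, where 'a=real] by (intro divide_left_mono) (auto simp: power2_eq_square)
      finally show ?thesis .
    qed
    ultimately have "real k ^ m * \<bar>bessel_coeff k\<bar> * \<bar>v\<bar> ^ k \<le> (3 ^ k) ^ m * (1 / fact k) * \<bar>v\<bar> ^ k"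
      by (intro mult_right_mono mult_mono) auto
    also have "\<dots> = (3 ^ m * \<bar>v\<bar>) ^ k / fact k"
      by (simp add: power_mult_distrib power_mult [symmetric] mult.commute)
    finally show "norm (real k ^ m * bessel_coeff k * v ^ k) \<le> (3 ^ m * \<bar>v\<bar>) ^ k / fact k"
      by (simp add: abs_mult power_abs)
  qed
qed

lemma summable_bessel: "summable (\<lambda>k. bessel_coeff k * v ^ k)"
  using summable_bessel_poly[of 0 v] by simp

lemma bessel_sqrt_eq: "bessel_sqrt v = (\<Sum>k. bessel_coeff k * v ^ k)"
  by (simp add: bessel_sqrt_def bessel_coeff_def)

definition bessel_sqrt' :: "real \<Rightarrow> real" where
  "bessel_sqrt' v = (\<Sum>k. diffs bessel_coeff k * v ^ k)"

lemma DERIV_bessel_sqrt: "(bessel_sqrt has_real_derivative bessel_sqrt' v) (at v)"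
  unfolding bessel_sqrt_eq[abs_def] bessel_sqrt'_def
  using termdiffs_strong_converges_everywhere[OF summable_bessel] .

lemma isCont_bessel_sqrt': "isCont bessel_sqrt' v"
proof -
  have "summable (\<lambda>k. diffs bessel_coeff k * v ^ k)" for v
    using termdiff_converges_all[OF summable_bessel] .
  from termdiffs_strong_converges_everywhere[OF this, of v]
  show ?thesis unfolding bessel_sqrt'_def[abs_def] by (rule DERIV_isCont)
qed

lemma times_bessel_sqrt': "v * bessel_sqrt' v = (\<Sum>k. real k * bessel_coeff k * v ^ k)"
proof -
  have "summable (\<lambda>k. diffs bessel_coeff k * v ^ k)"
    using termdiff_converges_all[OF summable_bessel] .
  from diffs_equiv[OF this]
  have "(\<lambda>n. v * (of_nat n * bessel_coeff n * v ^ (n - Suc 0))) sums (v * bessel_sqrt' v)"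
    unfolding bessel_sqrt'_def by (rule sums_mult)
  moreover have "v * (of_nat n * bessel_coeff n * v ^ (n - Suc 0)) = real n * bessel_coeff n * v ^ n" for n
    by (cases n) auto
  ultimately show ?thesis by (simp add: sums_iff)
qed

text \<open>Bessel's equation of order zero in the variable \<open>v = z\<^sup>2\<close>, read off from the coefficients of
  the power series.\<close>

lemma bessel_ode:
  "((\<lambda>v. v * bessel_sqrt' v) has_real_derivative - bessel_sqrt v / 4) (at v)"
proof -
  let ?d = "\<lambda>k. real k * bessel_coeff k"
  have "diffs ?d k = - (1/4) * bessel_coeff k" for k
    by (simp add: diffs_def bessel_coeff_def divide_simps power2_eq_square) 
  then have "(\<Sum>k. diffs ?d k * v ^ k) = - bessel_sqrt v / 4"
    using suminf_mult[OF summable_bessel[of v], of "-(1/4)"] by (simp add: bessel_sqrt_eq mult.assoc)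
  moreover have "((\<lambda>v. \<Sum>k. ?d k * v ^ k) has_real_derivative (\<Sum>k. diffs ?d k * v ^ k)) (at v)"
    by (rule termdiffs_strong_converges_everywhere) (use summable_bessel_poly[of 1] in simp)
  ultimately show ?thesis by (simp add: times_bessel_sqrt')
qed

lemma bessel_sqrt_0 [simp]: "bessel_sqrt 0 = 1"
  unfolding bessel_sqrt_eq by (subst powser_zero) (simp add: bessel_coeff_def)

lemma isCont_bessel_sqrt [simp]: "isCont bessel_sqrt v"
  using DERIV_bessel_sqrt by (rule DERIV_isCont)

lemma continuous_on_bessel_sqrt [continuous_intros]:
  "continuous_on A f \<Longrightarrow> continuous_on A (\<lambda>x. bessel_sqrt (f x))"
  by (rule continuous_on_compose2[of UNIV bessel_sqrt]) (auto intro: continuous_at_imp_continuous_on)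

lemma borel_measurable_bessel_sqrt [measurable]: "bessel_sqrt \<in> borel_measurable borel"
  by (intro borel_measurable_continuous_onI continuous_intros)

text \<open>In the variable \<open>z = sqrt v\<close> the function \<open>E\<close> below is the energy \<open>J\<^sub>0\<^sup>2 + (J\<^sub>0')\<^sup>2\<close>, which
  Bessel's equation makes decrease from its value \<open>1\<close> at the origin.\<close>

lemma abs_bessel_sqrt_le_1:
  assumes "v \<ge> 0" shows "\<bar>bessel_sqrt v\<bar> \<le> 1"
proof (cases "v = 0")
  case False
  with assms have v: "v > 0" by simp
  define E where "E = (\<lambda>v. (bessel_sqrt v)\<^sup>2 + 4 * (v * bessel_sqrt' v)\<^sup>2 / v)"
  have E: "(E has_real_derivative - 4 * (x * bessel_sqrt' x)\<^sup>2 / x\<^sup>2) (at x)" if "x > 0" for x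
  proof -
    define m where "m = (\<lambda>v. v * bessel_sqrt' v)"
    have m: "(m has_real_derivative - bessel_sqrt x / 4) (at x)"
      unfolding m_def by (rule bessel_ode)
    have b: "(bessel_sqrt has_real_derivative m x / x) (at x)"
      using DERIV_bessel_sqrt[of x] that by (simp add: m_def)
    show ?thesis
      unfolding E_def m_def[symmetric, THEN fun_cong] using that
      by (auto intro!: derivative_eq_intros b m simp: field_simps power2_eq_square)
  qed
  have mono: "E v \<le> E x" if "0 < x" "x \<le> v" for x
  proof (rule DERIV_nonpos_imp_nonincreasing[of x v E])
    fix y assume "x \<le> y" "y \<le> v"
    moreover have "- 4 * (y * bessel_sqrt' y)\<^sup>2 / y\<^sup>2 \<le> 0" by simp
    ultimately show "\<exists>d. (E has_real_derivative d) (at y) \<and> d \<le> 0"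
      using E[of y] that by (meson order_less_le_trans)
  qed (use that in auto)
  have "E = (\<lambda>v. (bessel_sqrt v)\<^sup>2 + 4 * (v * (bessel_sqrt' v)\<^sup>2))"
    by (auto simp: E_def power2_eq_square)
  then have "(E \<longlongrightarrow> (bessel_sqrt 0)\<^sup>2 + 4 * (0 * (bessel_sqrt' 0)\<^sup>2)) (at 0)"
    using isCont_bessel_sqrt[of 0] isCont_bessel_sqrt'[of 0]
    unfolding isCont_def by (simp only:) (intro tendsto_intros; assumption)
  then have "(E \<longlongrightarrow> 1) (at_right 0)"
    by (simp add: filterlim_at_split)
  moreover have "eventually (\<lambda>x. E v \<le> E x) (at_right 0)"
    using eventually_at_right_less[of 0] eventually_at_right_real[OF v]
    by eventually_elim (use mono in auto)
  ultimately have "E v \<le> 1"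
    by (rule tendsto_lowerbound) simp
  moreover have "(bessel_sqrt v)\<^sup>2 \<le> E v" using v by (simp add: E_def)
  ultimately have "(bessel_sqrt v)\<^sup>2 \<le> 1" by simp
  then show ?thesis by (simp add: abs_square_le_1)
qed simp

text \<open>Controls the boundary term of the integration by parts against the Bessel kernel; it follows
  from the differential equation and the mean value theorem.\<close>

lemma abs_times_bessel_sqrt'_le:
  assumes "v \<ge> 0" shows "\<bar>v * bessel_sqrt' v\<bar> \<le> v"
proof (cases "v = 0")
  case False
  with assms have v: "v > 0" by simp
  obtain z where z: "0 < z" "z < v" "v * bessel_sqrt' v - 0 * bessel_sqrt' 0 = (v - 0) * (- bessel_sqrt z / 4)"
    using MVT2[OF v, of "\<lambda>v. v * bessel_sqrt' v" "\<lambda>v. - bessel_sqrt v / 4"] bessel_ode by blast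
  then have "\<bar>v * bessel_sqrt' v\<bar> = v * \<bar>bessel_sqrt z\<bar> / 4" using v by (simp add: abs_mult)
  also have "\<dots> \<le> v * 1 / 4"
    using v z abs_bessel_sqrt_le_1[of z] by (intro divide_right_mono mult_left_mono) auto
  finally show ?thesis using v by simp
qed simp

lemma integral_power_exp:
  assumes t: "t > 0"
  shows "integrable (leb_on {0..}) (\<lambda>w. w ^ k * exp (- t * w))"
    and "(LINT w|leb_on {0..}. w ^ k * exp (- t * w)) = fact k / t ^ Suc k"
proof -
  have "has_bochner_integral lborel (\<lambda>x. indicator {0..} x *\<^sub>R (x^k * exp (-x))) (real (fact k))"
  proof (rule has_bochner_integral_nn_integral)
    have "(\<integral>\<^sup>+x. ennreal (indicator {0..} x *\<^sub>R (x^k * exp (-x))) \<partial>lborel)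
      = (\<integral>\<^sup>+x. ennreal (x^k * exp (-x)) * indicator {0 ..} x \<partial>lborel)"
      by (intro nn_integral_cong) (auto simp: indicator_def)
    then show "(\<integral>\<^sup>+x. ennreal (indicator {0..} x *\<^sub>R (x^k * exp (-x))) \<partial>lborel) = ennreal (real (fact k))"
      by (simp only: nn_intergal_power_times_exp_Ici)
  qed (auto simp: indicator_def)
  then have 0: "has_bochner_integral lborel (\<lambda>x. indicator {0..} x *\<^sub>R (x^k * exp (-x))) (fact k :: real)"
    by simp
  have "has_bochner_integral lborel (\<lambda>x. indicator {0..} (0 + t * x) *\<^sub>R ((0 + t * x)^k * exp (-(0 + t * x)))) (fact k /\<^sub>R \<bar>t\<bar>)"
    using t by (intro lborel_has_bochner_integral_real_affine_iff[THEN iffD1] 0) auto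
  then have "has_bochner_integral lborel (\<lambda>x. (1/t^k) * (indicator {0..} (0 + t * x) *\<^sub>R ((0 + t * x)^k * exp (-(0 + t * x))))) ((1/t^k) * (fact k /\<^sub>R \<bar>t\<bar>))"
    by (rule has_bochner_integral_mult_right)
  moreover have "(\<lambda>x. (1/t^k) * (indicator {0..} (0 + t * x) *\<^sub>R ((0 + t * x)^k * exp (-(0 + t * x)))))
    = (\<lambda>w. indicator {0..} w *\<^sub>R (w ^ k * exp (- t * w)))"
    (is "?l = ?r")
  proof
    fix w show "?l w = ?r w"
      using t by (cases "w \<ge> 0") (simp_all add: zero_le_mult_iff power_mult_distrib)
  qed
  moreover have "(1/t^k) * (fact k /\<^sub>R \<bar>t\<bar>) = fact k / t ^ Suc k"
    using t by (simp add: divide_inverse)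
  ultimately have *: "has_bochner_integral lborel (\<lambda>w. indicator {0..} w *\<^sub>R (w ^ k * exp (- t * w))) (fact k / t ^ Suc k)"
    by (simp only:)
  show "integrable (leb_on {0..}) (\<lambda>w. w ^ k * exp (- t * w))"
    using * by (subst integrable_restrict_space) (auto simp: has_bochner_integral_iff)
  show "(LINT w|leb_on {0..}. w ^ k * exp (- t * w)) = fact k / t ^ Suc k"
    using * by (subst integral_restrict_space) (auto simp: has_bochner_integral_iff)
qed

text \<open>Term by term, \<open>c ^ k * w ^ k\<close> integrates to \<open>c ^ k * fact k / t ^ Suc k\<close>; one of the two
  factorials in the coefficient cancels and the exponential series remains.\<close>

lemma bessel_laplace:
  assumes t: "t > 0" and c: "c \<ge> 0"
  shows "integrable (leb_on {0..}) (\<lambda>w. exp (- t * w) * bessel_sqrt (c * w))"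
    and "(LINT w|leb_on {0..}. exp (- t * w) * bessel_sqrt (c * w)) = exp (- c / (4 * t)) / t"
proof -
  let ?f = "\<lambda>k w. bessel_coeff k * c ^ k * (w ^ k * exp (- t * w))"
  have int: "integrable (leb_on {0..}) (?f k)" for k
    using integral_power_exp(1)[OF t] by simp
  have eq: "exp (- t * w) * bessel_sqrt (c * w) = (\<Sum>k. ?f k w)" for w
    using suminf_mult[OF summable_bessel[of "c * w"], of "exp (- t * w)"]
    by (simp add: bessel_sqrt_eq power_mult_distrib mult_ac)
  have ae: "AE w in leb_on {0..}. summable (\<lambda>k. norm (?f k w))"
  proof (rule AE_I2)
    fix w assume "w \<in> space (leb_on {0..})"
    then have "w \<ge> 0" by (simp add: space_restrict_space)
    have "summable (\<lambda>k. norm (bessel_coeff k * (c * w) ^ k))"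
      using powser_insidea[OF summable_bessel[of "\<bar>c * w\<bar> + 1"], of "c * w"] by simp
    from summable_mult[OF this, of "exp (- t * w)"]
    show "summable (\<lambda>k. norm (?f k w))"
      by (simp add: power_mult_distrib abs_mult mult_ac power_abs)
  qed
  have norm_int: "(LINT w|leb_on {0..}. norm (?f k w)) = (1 / t) * ((c / (4 * t)) ^ k / fact k)" for k
  proof -
    have "(LINT w|leb_on {0..}. norm (?f k w)) = (LINT w|leb_on {0..}. \<bar>bessel_coeff k\<bar> * c ^ k * (w ^ k * exp (- t * w)))"
      using c by (intro Bochner_Integration.integral_cong) (auto simp: space_restrict_space abs_mult)
    also have "\<dots> = \<bar>bessel_coeff k\<bar> * c ^ k * (fact k / t ^ Suc k)"
      using integral_power_exp(2)[OF t, of k] by simp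
    also have "\<dots> = (1 / t) * ((c / (4 * t)) ^ k / fact k)"
      using t by (simp add: bessel_coeff_def abs_divide power_abs power_divide power_mult_distrib field_simps power2_eq_square)
    finally show ?thesis .
  qed
  have summ: "summable (\<lambda>k. LINT w|leb_on {0..}. norm (?f k w))"
    unfolding norm_int by (intro summable_mult summable_exp_coeff)
  show "integrable (leb_on {0..}) (\<lambda>w. exp (- t * w) * bessel_sqrt (c * w))"
    unfolding eq by (rule integrable_suminf[OF int ae summ])
  have "(LINT w|leb_on {0..}. exp (- t * w) * bessel_sqrt (c * w)) = (\<Sum>k. LINT w|leb_on {0..}. ?f k w)"
    unfolding eq by (rule integral_suminf[OF int ae summ])
  also have "\<dots> = (\<Sum>k. (1/t) * ((- c / (4 * t)) ^ k / fact k))"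
  proof (rule suminf_cong)
    fix k
    have "(LINT w|leb_on {0..}. ?f k w) = bessel_coeff k * c ^ k * (fact k / t ^ Suc k)"
      using integral_power_exp(2)[OF t, of k] by simp
    also have "\<dots> = (1/t) * ((- c / (4 * t)) ^ k / fact k)"
    proof -
      have "(- c / (4 * t)) ^ k = (- 1 / 4) ^ k * c ^ k / t ^ k"
        unfolding power_mult_distrib [symmetric] power_divide [symmetric] by simp
      then show ?thesis using t by (simp add: bessel_coeff_def field_simps power2_eq_square)
    qed
    finally show "(LINT w|leb_on {0..}. ?f k w) = (1/t) * ((- c / (4 * t)) ^ k / fact k)" .
  qed
  also have "\<dots> = (1/t) * exp (- c / (4 * t))"
    by (subst suminf_mult[OF summable_exp_coeff])
      (simp only: exp_def scaleR_conv_of_real of_real_eq_id id_apply divide_inverse mult.commute)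
  finally show "(LINT w|leb_on {0..}. exp (- t * w) * bessel_sqrt (c * w)) = exp (- c / (4 * t)) / t"
    by simp
qed


section \<open>Inversion of transforms that are self-reciprocal on exponentials\<close>

lemma sigma_finite_leb_on: "A \<in> sets borel \<Longrightarrow> sigma_finite_measure (leb_on A)"
  by (intro sigma_finite_measure_restrict_space) (auto simp: sigma_finite_lborel)

lemma borel_measurable_leb_onI:
  "f \<in> borel_measurable borel \<Longrightarrow> f \<in> borel_measurable (leb_on A)"
  by (intro measurable_restrict_space1) simp

lemma borel_measurable_leb_on_continuous:
  fixes f :: "real \<Rightarrow> 'a::topological_space"
  assumes "continuous_on A f"
  shows "f \<in> borel_measurable (leb_on A)"
  using borel_measurable_continuous_on_restrict[OF assms]
  by (subst measurable_cong_sets[OF sets_restrict_space_cong[of lborel borel] refl]) simp_all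

lemma borel_measurable_pair_leb_on:
  fixes h :: "real \<Rightarrow> real \<Rightarrow> 'a::topological_space"
  assumes "(\<lambda>p. h (fst p) (snd p)) \<in> borel_measurable borel"
  shows "(\<lambda>p. h (fst p) (snd p)) \<in> borel_measurable (leb_on A \<Otimes>\<^sub>M leb_on B)"
proof -
  have id: "(\<lambda>x. x) \<in> measurable (leb_on A) borel" for A
    by (rule borel_measurable_leb_onI) simp
  have "(\<lambda>p. (fst p, snd p)) \<in> measurable (leb_on A \<Otimes>\<^sub>M leb_on B) (borel \<Otimes>\<^sub>M borel)"
    by (rule measurable_Pair; rule measurable_compose[OF _ id]; rule measurable_fst measurable_snd)
  from measurable_compose[OF this, of "\<lambda>p. h (fst p) (snd p)"] assms
  show ?thesis by (simp only: borel_prod fst_conv snd_conv)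
qed

lemma space_leb_on [simp]: "space (leb_on A) = A"
  by (simp add: space_restrict_space)

lemma kernel_transform_self_adjoint:
  fixes \<kappa> :: "real \<Rightarrow> real \<Rightarrow> real" and \<alpha> \<beta> :: "real \<Rightarrow> complex"
  assumes A: "A \<in> sets borel"
    and meas: "(\<lambda>p. \<kappa> (fst p) (snd p)) \<in> borel_measurable borel"
    and kernel_sym: "\<And>c w. \<kappa> c w = \<kappa> w c"
    and le: "\<And>c w. c \<in> A \<Longrightarrow> w \<in> A \<Longrightarrow> \<bar>\<kappa> c w\<bar> \<le> 1"
    and \<alpha>: "integrable (leb_on A) \<alpha>" and \<beta>: "integrable (leb_on A) \<beta>"
  shows "(LINT w|leb_on A. \<alpha> w * (LINT c|leb_on A. \<beta> c * \<kappa> w c)) =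
         (LINT c|leb_on A. \<beta> c * (LINT w|leb_on A. \<alpha> w * \<kappa> c w))"
proof -
  interpret sigma_finite_measure "leb_on A" by (rule sigma_finite_leb_on[OF A])
  interpret pair_sigma_finite "leb_on A" "leb_on A" ..
  have [measurable]: "\<alpha> \<in> borel_measurable (leb_on A)" "\<beta> \<in> borel_measurable (leb_on A)"
    using \<alpha> \<beta> by auto
  note [measurable] = borel_measurable_pair_leb_on[OF meas, of A A]
  have "integrable (leb_on A \<Otimes>\<^sub>M leb_on A) (\<lambda>p. (\<alpha> (fst p) * \<beta> (snd p)) * \<kappa> (fst p) (snd p))"
  proof (rule Bochner_Integration.integrable_bound)
    show "integrable (leb_on A \<Otimes>\<^sub>M leb_on A) (\<lambda>p. \<alpha> (fst p) * \<beta> (snd p))"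
      by (rule Fubini_integrable) (use \<alpha> \<beta> in \<open>auto simp: norm_mult\<close>)
    show "AE p in leb_on A \<Otimes>\<^sub>M leb_on A. norm (\<alpha> (fst p) * \<beta> (snd p) * \<kappa> (fst p) (snd p))
        \<le> norm (\<alpha> (fst p) * \<beta> (snd p))"
    proof (rule AE_I2)
      fix p assume "p \<in> space (leb_on A \<Otimes>\<^sub>M leb_on A)"
      then have "fst p \<in> A" "snd p \<in> A" by (simp_all add: space_pair_measure mem_Times_iff)
      then have "\<bar>\<kappa> (fst p) (snd p)\<bar> \<le> 1" by (rule le)
      then have "norm (\<alpha> (fst p) * \<beta> (snd p)) * norm (complex_of_real (\<kappa> (fst p) (snd p))) \<le> norm (\<alpha> (fst p) * \<beta> (snd p))"
        by (intro mult_right_le_one_le) simp_all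
      then show "norm (\<alpha> (fst p) * \<beta> (snd p) * \<kappa> (fst p) (snd p)) \<le> norm (\<alpha> (fst p) * \<beta> (snd p))"
        by (simp only: norm_mult)
    qed
  qed measurable
  then have "integrable (leb_on A \<Otimes>\<^sub>M leb_on A) (case_prod (\<lambda>w c. \<alpha> w * \<beta> c * \<kappa> w c))"
    by (simp add: case_prod_unfold)
  from Fubini_integral[OF this]
  have *: "(LINT w|leb_on A. LINT c|leb_on A. \<alpha> w * \<beta> c * \<kappa> w c) =
    (LINT c|leb_on A. LINT w|leb_on A. \<alpha> w * \<beta> c * \<kappa> w c)"
    by (rule sym)
  have "(LINT c|leb_on A. \<alpha> w * \<beta> c * \<kappa> w c) = \<alpha> w * (LINT c|leb_on A. \<beta> c * \<kappa> w c)" for w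
    by (subst integral_mult_right_zero [symmetric]) (simp only: mult.assoc)
  moreover have "(LINT w|leb_on A. \<alpha> w * \<beta> c * \<kappa> w c) = \<beta> c * (LINT w|leb_on A. \<alpha> w * \<kappa> c w)" for c
    by (subst integral_mult_right_zero [symmetric]) (simp only: mult_ac kernel_sym [of c])
  ultimately show ?thesis using * by (simp only:)
qed

lemma continuous_on_kernel_slice:
  fixes \<kappa> :: "real \<Rightarrow> real \<Rightarrow> real"
  assumes "continuous_on UNIV (\<lambda>p. \<kappa> (fst p) (snd p))"
  shows "continuous_on UNIV (\<lambda>c. \<kappa> w c)" "continuous_on UNIV (\<lambda>w. \<kappa> w c)"
proof -
  have "continuous_on UNIV (\<lambda>c::real. (w, c))"
    by (intro continuous_on_Pair continuous_on_const continuous_on_id)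
  from continuous_on_compose[OF this continuous_on_subset[OF assms subset_UNIV]]
  show "continuous_on UNIV (\<lambda>c. \<kappa> w c)" by (simp only: o_def fst_conv snd_conv)
  have "continuous_on UNIV (\<lambda>w::real. (w, c))"
    by (intro continuous_on_Pair continuous_on_const continuous_on_id)
  from continuous_on_compose[OF this continuous_on_subset[OF assms subset_UNIV]]
  show "continuous_on UNIV (\<lambda>w. \<kappa> w c)" by (simp only: o_def fst_conv snd_conv)
qed

lemma continuous_on_kernel_transform:
  fixes \<kappa> :: "real \<Rightarrow> real \<Rightarrow> real" and \<beta> :: "real \<Rightarrow> complex"
  assumes A: "A \<in> sets borel"
    and cont: "continuous_on UNIV (\<lambda>p. \<kappa> (fst p) (snd p))"
    and le: "\<And>c w. c \<in> A \<Longrightarrow> w \<in> A \<Longrightarrow> \<bar>\<kappa> c w\<bar> \<le> 1"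
    and \<beta>: "integrable (leb_on A) \<beta>"
  shows "continuous_on A (\<lambda>w. LINT c|leb_on A. \<beta> c * \<kappa> w c)"
  unfolding continuous_on_sequentially comp_def
proof (intro allI ballI impI)
  fix u a assume a: "a \<in> A" and u: "(\<forall>n. u n \<in> A) \<and> u \<longlonglongrightarrow> a"
  note k1 = continuous_on_kernel_slice(1)[OF cont] and k2 = continuous_on_kernel_slice(2)[OF cont]
  have [measurable]: "(\<lambda>c. \<kappa> w c) \<in> borel_measurable (leb_on A)" for w
    by (intro borel_measurable_leb_onI borel_measurable_continuous_onI k1)
  have [measurable]: "\<beta> \<in> borel_measurable (leb_on A)" using \<beta> by auto
  show "(\<lambda>n. LINT c|leb_on A. \<beta> c * \<kappa> (u n) c) \<longlonglongrightarrow> (LINT c|leb_on A. \<beta> c * \<kappa> a c)"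
  proof (rule integral_dominated_convergence)
    show "integrable (leb_on A) (\<lambda>c. norm (\<beta> c))" using \<beta> by auto
    show "AE c in leb_on A. (\<lambda>n. \<beta> c * \<kappa> (u n) c) \<longlonglongrightarrow> \<beta> c * \<kappa> a c"
    proof (rule AE_I2)
      fix c
      have "(\<lambda>n. \<kappa> (u n) c) \<longlonglongrightarrow> \<kappa> a c"
        using k2[of c] u by (auto simp: continuous_on_sequentially comp_def)
      then show "(\<lambda>n. \<beta> c * \<kappa> (u n) c) \<longlonglongrightarrow> \<beta> c * \<kappa> a c"
        by (intro tendsto_intros)
    qed
    show "AE c in leb_on A. norm (\<beta> c * \<kappa> (u n) c) \<le> norm (\<beta> c)" for n
    proof (rule AE_I2)
      fix c assume "c \<in> space (leb_on A)"
      then have "\<bar>\<kappa> (u n) c\<bar> \<le> 1" using u by (intro le) auto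
      then show "norm (\<beta> c * \<kappa> (u n) c) \<le> norm (\<beta> c)"
        by (simp add: norm_mult mult_right_le_one_le)
    qed
    show "(\<lambda>c. \<beta> c * \<kappa> w c) \<in> borel_measurable (leb_on A)" for w by measurable
    show "(\<lambda>c. \<beta> c * \<kappa> (u n) c) \<in> borel_measurable (leb_on A)" for n by measurable
  qed
qed

text \<open>In the variable \<open>x = exp (- (s ^ m))\<close> the hypothesis for \<open>t = 1, 2, \<dots>\<close> says that all moments
  vanish. The function \<open>e s * \<psi> s\<close> is a continuous function \<open>U\<close> of \<open>x\<close> on \<open>{0..1}\<close>; for a polynomial
  \<open>p\<close> close to \<open>U\<close>, the integral of \<open>(e s * \<psi> s)\<^sup>2\<close> equals that of \<open>e s * \<psi> s * (U (e s) - p (e s))\<close>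
  and is therefore arbitrarily small.\<close>

lemma exp_transform_injective:
  fixes \<psi> :: "real \<Rightarrow> real"
  assumes m: "m > 0"
    and cont: "continuous_on {0..} \<psi>" and bd: "\<And>s. s \<ge> 0 \<Longrightarrow> \<bar>\<psi> s\<bar> \<le> C"
    and E: "\<And>t. t > 0 \<Longrightarrow> integrable (leb_on {0..}) (\<lambda>s. exp (- t * s ^ m))"
    and zero: "\<And>t. t > 0 \<Longrightarrow> (LINT s|leb_on {0..}. exp (- t * s ^ m) * \<psi> s) = 0"
    and s: "s \<ge> 0"
  shows "\<psi> s = 0"
proof -
  let ?M = "leb_on {0::real..}"
  define e where "e = (\<lambda>s::real. exp (- (s ^ m)))"
  have C: "C \<ge> 0" using bd[of 0] by simp
  have e_pow: "e s ^ i = exp (- real i * s ^ m)" for s i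
    by (simp add: e_def exp_of_nat_mult [symmetric])
  have e_int: "integrable ?M (\<lambda>s. e s ^ Suc i)" for i
    unfolding e_pow by (rule E) simp
  have \<psi>m [measurable]: "\<psi> \<in> borel_measurable ?M"
    by (rule borel_measurable_leb_on_continuous[OF cont])
  have [measurable]: "e \<in> borel_measurable ?M"
    unfolding e_def by (intro borel_measurable_leb_onI) measurable
  have e01: "0 < e s" "e s \<le> 1" if "s \<ge> 0" for s
    using that by (auto simp: e_def)
  have \<psi>_int: "integrable ?M (\<lambda>s. e s ^ Suc i * \<psi> s)" for i
  proof (rule Bochner_Integration.integrable_bound)
    show "integrable ?M (\<lambda>s. C * e s ^ Suc i)" using e_int by simp
    show "AE s in ?M. norm (e s ^ Suc i * \<psi> s) \<le> norm (C * e s ^ Suc i)"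
      using bd e01 C by (intro AE_I2) (auto simp: abs_mult mult.commute intro!: mult_right_mono)
  qed measurable
  have zero': "(LINT s|?M. e s ^ Suc i * \<psi> s) = 0" for i
    unfolding e_pow by (rule zero) simp

  \<comment> \<open>The factor \<open>x\<close> makes \<open>U\<close> continuous at \<open>x = 0\<close>, which corresponds to \<open>s = \<infinity>\<close>.\<close>
  define U where "U = (\<lambda>x. x * (if x \<le> 0 then 0 else \<psi> (root m (- ln x))))"
  have U_e: "U (e s) = e s * \<psi> s" if "s \<ge> 0" for s
    using that m e01[OF that] by (simp add: U_def e_def real_root_power_cancel)
  have U_cont: "continuous_on {0..1} U"
    unfolding continuous_on_eq_continuous_within
  proof
    fix x :: real assume x: "x \<in> {0..1}"
    show "continuous (at x within {0..1}) U"
    proof (cases "x = 0")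
      case True
      have "((\<lambda>x. C * \<bar>x\<bar>) \<longlongrightarrow> C * \<bar>0\<bar>) (at 0 within {0..1::real})" by (intro tendsto_intros)
      then have "((\<lambda>x. C * \<bar>x\<bar>) \<longlongrightarrow> 0) (at 0 within {0..1::real})" by simp
      moreover have "eventually (\<lambda>x. norm (U x) \<le> C * \<bar>x\<bar>) (at 0 within {0..1})"
        unfolding eventually_at_filter
      proof (rule always_eventually, intro allI impI)
        fix x :: real assume "x \<noteq> 0" "x \<in> {0..1}"
        then have "0 \<le> - ln x" "x > 0" by simp_all
        then have "\<bar>\<psi> (root m (- ln x))\<bar> \<le> C" by (intro bd real_root_ge_zero)
        then show "norm (U x) \<le> C * \<bar>x\<bar>"
          using \<open>x > 0\<close> by (simp add: U_def abs_mult mult.commute)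
      qed
      ultimately have "(U \<longlongrightarrow> 0) (at 0 within {0..1})"
        by (rule Lim_null_comparison[rotated])
      then show ?thesis using True by (simp add: continuous_within U_def)
    next
      case False
      then have "continuous_on {0<..1} (\<lambda>x. x * \<psi> (root m (- ln x)))"
      proof (intro continuous_on_mult continuous_on_id continuous_on_compose2[OF cont])
        show "continuous_on {0<..1} (\<lambda>x. root m (- ln x))"
          by (intro continuous_intros) auto
        show "(\<lambda>x. root m (- ln x)) ` {0<..1} \<subseteq> {0..}"
        proof safe
          fix x :: real assume "x \<in> {0<..1}"
          then have "0 \<le> - ln x" by simp
          then show "0 \<le> root m (- ln x)" by (rule real_root_ge_zero)
        qed
      qed
      then have "continuous_on {0<..1} U"
        by (rule continuous_on_eq) (auto simp: U_def)
      then have "continuous (at x within {0<..1}) U"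
        using x False by (auto simp: continuous_on_eq_continuous_within)
      moreover have "at x within {0<..1} = at x within {0..1}"
        by (rule at_within_nhd[of x "{0<..}"]) (use x False in auto)
      ultimately show ?thesis by simp
    qed
  qed

  define I where "I = (LINT s|?M. (e s * \<psi> s)\<^sup>2)"
  have sq_eq: "(e s * \<psi> s)\<^sup>2 = e s * \<psi> s * U (e s)" if "s \<ge> 0" for s
    using U_e[OF that] by (simp add: power2_eq_square)
  have sq_int: "integrable ?M (\<lambda>s. (e s * \<psi> s)\<^sup>2)"
  proof (rule Bochner_Integration.integrable_bound)
    show "integrable ?M (\<lambda>s. C\<^sup>2 * e s ^ 2)" using e_int[of 1] by (simp add: power2_eq_square)
    show "AE s in ?M. norm ((e s * \<psi> s)\<^sup>2) \<le> norm (C\<^sup>2 * e s ^ 2)"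
    proof (rule AE_I2)
      fix s assume "s \<in> space ?M"
      then have "\<bar>e s * \<psi> s\<bar> \<le> \<bar>C * e s\<bar>"
        using bd[of s] e01[of s] C by (auto simp: abs_mult mult.commute[of C] intro!: mult_left_mono)
      then have "(e s * \<psi> s)\<^sup>2 \<le> (C * e s)\<^sup>2" by (simp add: abs_le_square_iff)
      then show "norm ((e s * \<psi> s)\<^sup>2) \<le> norm (C\<^sup>2 * e s ^ 2)" by (simp add: power_mult_distrib)
    qed
  qed measurable
  have I_le: "I \<le> \<epsilon> * (C * (LINT s|?M. e s))" if "\<epsilon> > 0" for \<epsilon>
  proof -
    obtain p where p: "real_polynomial_function p" "\<And>x. x \<in> {0..1} \<Longrightarrow> \<bar>U x - p x\<bar> < \<epsilon>"
      using Stone_Weierstrass_real_polynomial_function[OF compact_Icc U_cont \<open>\<epsilon> > 0\<close>] by blast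
    from p(1) obtain a n where pa: "p = (\<lambda>x. \<Sum>i\<le>n. a i * x ^ i)"
      unfolding real_polynomial_function_iff_sum by auto
    have eq: "e s * \<psi> s * p (e s) = (\<Sum>i\<le>n. a i * (e s ^ Suc i * \<psi> s))" for s
      by (simp add: pa sum_distrib_left mult_ac)
    have p_int: "integrable ?M (\<lambda>s. e s * \<psi> s * p (e s))"
      unfolding eq using \<psi>_int by (intro Bochner_Integration.integrable_sum) simp
    have p0: "(LINT s|?M. e s * \<psi> s * p (e s)) = 0"
      unfolding eq using \<psi>_int zero' by (subst Bochner_Integration.integral_sum) (simp_all del: power_Suc)
    have "I = (LINT s|?M. (e s * \<psi> s)\<^sup>2 - e s * \<psi> s * p (e s))"
      using sq_int p_int by (simp add: I_def p0)
    also have "\<dots> \<le> (LINT s|?M. \<epsilon> * (C * e s))"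
    proof (rule integral_mono)
      show "integrable ?M (\<lambda>s. (e s * \<psi> s)\<^sup>2 - e s * \<psi> s * p (e s))"
        using sq_int p_int by simp
      show "integrable ?M (\<lambda>s. \<epsilon> * (C * e s))" using e_int[of 0] by simp
      fix s assume "s \<in> space ?M"
      then have s: "s \<ge> 0" by simp
      have "(e s * \<psi> s)\<^sup>2 - e s * \<psi> s * p (e s) = (e s * \<psi> s) * (U (e s) - p (e s))"
        by (simp only: sq_eq[OF s] right_diff_distrib)
      also have "\<dots> \<le> \<bar>e s * \<psi> s\<bar> * \<bar>U (e s) - p (e s)\<bar>"
        by (metis abs_ge_self abs_mult)
      also have "\<dots> \<le> (e s * C) * \<epsilon>"
        using e01[OF s] bd[OF s] p(2)[of "e s"] C by (intro mult_mono) (auto simp: abs_mult)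
      finally show "(e s * \<psi> s)\<^sup>2 - e s * \<psi> s * p (e s) \<le> \<epsilon> * (C * e s)" by (simp add: mult_ac)
    qed
    finally show ?thesis by simp
  qed
  have K: "0 \<le> C * (LINT s|?M. e s)"
    using C e01 by (intro mult_nonneg_nonneg integral_nonneg_AE AE_I2) (auto intro: less_imp_le)
  have "I \<le> 0"
  proof (rule field_le_epsilon)
    fix \<delta> :: real assume "\<delta> > 0"
    define K where "K = C * (LINT s|?M. e s)"
    have "I \<le> \<delta> / (K + 1) * K"
      using I_le[of "\<delta> / (K + 1)"] \<open>\<delta> > 0\<close> K by (simp add: K_def)
    also have "\<dots> \<le> \<delta>" using \<open>\<delta> > 0\<close> K by (simp add: K_def[symmetric] field_simps)
    finally show "I \<le> 0 + \<delta>" by simp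
  qed
  moreover have "0 \<le> I" unfolding I_def by simp
  ultimately have "I = 0" by simp
  have sq_int': "set_integrable lborel {0..} (\<lambda>s. (e s * \<psi> s)\<^sup>2)"
    using sq_int by (simp add: set_integrable_def integrable_restrict_space)
  then have set_int: "set_integrable lborel {0..s + 1} (\<lambda>s. (e s * \<psi> s)\<^sup>2)"
    by (rule set_integrable_subset) auto
  have "(LINT s:{0..s + 1}|lborel. (e s * \<psi> s)\<^sup>2) \<le> (LINT s:{0..}|lborel. (e s * \<psi> s)\<^sup>2)"
    unfolding set_lebesgue_integral_def
  proof (rule integral_mono)
    show "integrable lborel (\<lambda>r. indicator {0..s + 1} r *\<^sub>R (e r * \<psi> r)\<^sup>2)"
      using set_int by (simp add: set_integrable_def)
    show "integrable lborel (\<lambda>r. indicator {0..} r *\<^sub>R (e r * \<psi> r)\<^sup>2)"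
      using sq_int' by (simp add: set_integrable_def)
    show "indicator {0..s + 1} r *\<^sub>R (e r * \<psi> r)\<^sup>2 \<le> indicator {0..} r *\<^sub>R (e r * \<psi> r)\<^sup>2" for r
      by (simp add: indicator_def)
  qed
  also have "\<dots> = 0"
    using \<open>I = 0\<close> by (simp add: I_def integral_restrict_space set_lebesgue_integral_def)
  finally have "(LINT s:{0..s + 1}|lborel. (e s * \<psi> s)\<^sup>2) \<le> 0" .
  moreover have "0 \<le> (LINT s:{0..s + 1}|lborel. (e s * \<psi> s)\<^sup>2)"
    unfolding set_lebesgue_integral_def by (rule integral_nonneg_AE) simp
  ultimately have "(LINT s:{0..s + 1}|lborel. (e s * \<psi> s)\<^sup>2) = 0" by simp
  then have "((\<lambda>s. (e s * \<psi> s)\<^sup>2) has_integral 0) (cbox 0 (s + 1))"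
    using set_borel_integral_eq_integral[OF set_int] by (simp add: has_integral_iff)
  moreover have "continuous_on (cbox 0 (s + 1)) (\<lambda>s. (e s * \<psi> s)\<^sup>2)"
    unfolding e_def by (intro continuous_intros continuous_on_subset[OF cont]) auto
  ultimately have "(e s * \<psi> s)\<^sup>2 = 0"
    using s by (intro has_integral_0_cbox_imp_0[of 0 "s + 1"]) auto
  then show ?thesis using e01(1)[OF s] by simp
qed

text \<open>Write \<open>K\<close> for the transform with kernel \<open>\<kappa>\<close> and \<open>e\<close> for an exponential. Moving \<open>K\<close> twice
  across the pairing gives \<open>\<integral> e (K K \<phi>) = \<integral> (K K e) \<phi> = \<mu> \<integral> e \<phi>\<close>, and the exponentials separate
  bounded continuous functions.\<close>

lemma self_reciprocal_kernel_inversion: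
  fixes \<kappa> :: "real \<Rightarrow> real \<Rightarrow> real" and \<phi> \<Phi> :: "real \<Rightarrow> complex" and \<mu> :: real
  assumes m: "m > 0"
    and cont: "continuous_on UNIV (\<lambda>p. \<kappa> (fst p) (snd p))"
    and sym: "\<And>c w. \<kappa> c w = \<kappa> w c"
    and le: "\<And>c w. c \<ge> 0 \<Longrightarrow> w \<ge> 0 \<Longrightarrow> \<bar>\<kappa> c w\<bar> \<le> 1"
    and E: "\<And>t. t > 0 \<Longrightarrow> integrable (leb_on {0..}) (\<lambda>s. exp (- t * s ^ m))"
    and KE: "\<And>t. t > 0 \<Longrightarrow> integrable (leb_on {0..}) (\<lambda>c. LINT w|leb_on {0..}. exp (- t * w ^ m) * \<kappa> c w)"
    and KKE: "\<And>t w. t > 0 \<Longrightarrow> w \<ge> 0 \<Longrightarrow>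
      (LINT c|leb_on {0..}. (LINT v|leb_on {0..}. exp (- t * v ^ m) * \<kappa> c v) * \<kappa> w c) = \<mu> * exp (- t * w ^ m)"
    and \<phi>: "continuous_on {0..} \<phi>" "\<And>w. w \<ge> 0 \<Longrightarrow> norm (\<phi> w) \<le> C" "integrable (leb_on {0..}) \<phi>"
    and \<Phi>: "\<And>c. c \<ge> 0 \<Longrightarrow> \<Phi> c = (LINT w|leb_on {0..}. \<phi> w * \<kappa> c w)"
    and \<Phi>_int: "integrable (leb_on {0..}) \<Phi>"
    and w: "w \<ge> 0"
  shows "(LINT c|leb_on {0..}. \<Phi> c * \<kappa> w c) = \<mu> * \<phi> w"
proof -
  let ?M = "leb_on {0::real..}"
  define \<psi> where "\<psi> = (\<lambda>w. \<mu> * \<phi> w - (LINT c|?M. \<Phi> c * \<kappa> w c))"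
  have meas: "(\<lambda>p. \<kappa> (fst p) (snd p)) \<in> borel_measurable borel"
    using cont by (rule borel_measurable_continuous_onI)
  have [measurable]: "(\<lambda>c. \<kappa> w c) \<in> borel_measurable ?M" for w
    by (intro borel_measurable_leb_onI borel_measurable_continuous_onI continuous_on_kernel_slice(1)[OF cont])
  have \<psi>_cont: "continuous_on {0..} \<psi>"
    unfolding \<psi>_def
  proof (intro continuous_on_diff continuous_on_mult continuous_on_const \<phi>(1))
    show "continuous_on {0..} (\<lambda>w. LINT c|?M. \<Phi> c * \<kappa> w c)"
      using continuous_on_kernel_transform[of "{0..}" \<kappa> \<Phi>] cont le \<Phi>_int by simp
  qed
  have \<psi>_bd: "norm (\<psi> w) \<le> \<bar>\<mu>\<bar> * C + (LINT c|?M. norm (\<Phi> c))" if "w \<ge> 0" for w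
  proof -
    have [measurable]: "\<Phi> \<in> borel_measurable ?M" using \<Phi>_int by auto
    have le': "norm (\<Phi> c * \<kappa> w c) \<le> norm (\<Phi> c)" if "c \<ge> 0" for c
      using that \<open>w \<ge> 0\<close> by (auto simp: norm_mult intro!: mult_right_le_one_le le)
    then have int: "integrable ?M (\<lambda>c. \<Phi> c * \<kappa> w c)"
      by (intro Bochner_Integration.integrable_bound[OF \<Phi>_int] AE_I2) auto
    have "norm (LINT c|?M. \<Phi> c * \<kappa> w c) \<le> (LINT c|?M. norm (\<Phi> c * \<kappa> w c))"
      by (rule integral_norm_bound)
    also have "\<dots> \<le> (LINT c|?M. norm (\<Phi> c))"
      using le' int \<Phi>_int by (intro integral_mono) auto
    finally have "norm (LINT c|?M. \<Phi> c * \<kappa> w c) \<le> (LINT c|?M. norm (\<Phi> c))" .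
    moreover have "norm (\<mu> * \<phi> w) \<le> \<bar>\<mu>\<bar> * C"
      using \<phi>(2)[OF that] by (simp add: norm_mult mult_left_mono)
    ultimately show ?thesis
      unfolding \<psi>_def by (intro order_trans[OF norm_triangle_ineq4] add_mono)
  qed
  have [measurable]: "\<psi> \<in> borel_measurable ?M"
    by (rule borel_measurable_leb_on_continuous[OF \<psi>_cont])
  have zero: "(LINT w|?M. exp (- t * w ^ m) * \<psi> w) = 0" if t: "t > 0" for t
  proof -
    define e where "e = (\<lambda>w. complex_of_real (exp (- t * w ^ m)))"
    define Ke where "Ke = (\<lambda>c. complex_of_real (LINT w|?M. exp (- t * w ^ m) * \<kappa> c w))"
    have e_int: "integrable ?M e" unfolding e_def using E[OF t] by (rule integrable_of_real)
    have Ke_int: "integrable ?M Ke" unfolding Ke_def using KE[OF t] by (rule integrable_of_real)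
    have Ke_eq: "Ke c = (LINT w|?M. e w * \<kappa> c w)" for c
      unfolding Ke_def e_def by (simp only: of_real_mult [symmetric] integral_complex_of_real)
    have KKe: "(LINT c|?M. Ke c * \<kappa> w c) = \<mu> * e w" if "w \<ge> 0" for w
      using KKE[OF t that]
      unfolding Ke_def e_def by (simp only: of_real_mult [symmetric] integral_complex_of_real)
    have "(LINT w|?M. \<phi> w * (LINT c|?M. Ke c * \<kappa> w c)) = (LINT c|?M. Ke c * (LINT w|?M. \<phi> w * \<kappa> c w))"
      by (rule kernel_transform_self_adjoint) (use meas sym le \<phi> Ke_int in auto)
    also have "\<dots> = (LINT c|?M. \<Phi> c * (LINT w|?M. e w * \<kappa> c w))"
      by (intro Bochner_Integration.integral_cong) (auto simp: \<Phi> Ke_eq)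
    also have "\<dots> = (LINT w|?M. e w * (LINT c|?M. \<Phi> c * \<kappa> w c))"
      by (rule kernel_transform_self_adjoint[symmetric]) (use meas sym le \<Phi>_int e_int in \<open>auto\<close>)
    finally have *: "(LINT w|?M. \<phi> w * (LINT c|?M. Ke c * \<kappa> w c)) = (LINT w|?M. e w * (LINT c|?M. \<Phi> c * \<kappa> w c))" .
    have "(LINT w|?M. \<phi> w * (LINT c|?M. Ke c * \<kappa> w c)) = (LINT w|?M. e w * (\<mu> * \<phi> w))"
      by (intro Bochner_Integration.integral_cong) (auto simp: KKe)
    with * have eq: "(LINT w|?M. e w * (\<mu> * \<phi> w)) = (LINT w|?M. e w * (LINT c|?M. \<Phi> c * \<kappa> w c))" by simp
    have bdd: "integrable ?M (\<lambda>w. e w * h w)" if "h \<in> borel_measurable ?M" "\<And>w. w \<ge> 0 \<Longrightarrow> norm (h w) \<le> D" for h :: "real \<Rightarrow> complex" and D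
    proof (rule Bochner_Integration.integrable_bound)
      show "integrable ?M (\<lambda>w. D * e w)" using e_int by simp
      have "0 \<le> D" using that(2)[of 0] order_trans[OF norm_ge_zero] by auto
      then show "AE w in ?M. norm (e w * h w) \<le> norm (D * e w)"
        using that(2) by (intro AE_I2) (auto simp: norm_mult mult.commute[of D] intro!: mult_left_mono)
      have [measurable]: "e \<in> borel_measurable ?M" using e_int by auto
      show "(\<lambda>w. e w * h w) \<in> borel_measurable ?M" using that(1) by measurable
    qed
    have [measurable]: "\<phi> \<in> borel_measurable ?M" using \<phi> by auto
    have i1: "integrable ?M (\<lambda>w. e w * (\<mu> * \<phi> w))"
      by (rule bdd[of _ "\<bar>\<mu>\<bar> * C"]) (use \<phi>(2) in \<open>auto simp: norm_mult intro!: mult_left_mono\<close>)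
    have i2: "integrable ?M (\<lambda>w. e w * \<psi> w)"
      by (rule bdd) (use \<psi>_bd in auto)
    have "(LINT w|?M. e w * (LINT c|?M. \<Phi> c * \<kappa> w c)) = (LINT w|?M. e w * (\<mu> * \<phi> w) - e w * \<psi> w)"
      by (intro Bochner_Integration.integral_cong) (auto simp: \<psi>_def algebra_simps)
    also have "\<dots> = (LINT w|?M. e w * (\<mu> * \<phi> w)) - (LINT w|?M. e w * \<psi> w)"
      using i1 i2 by simp
    finally show ?thesis using eq by (simp add: e_def)
  qed
  have int: "integrable ?M (\<lambda>w. exp (- t * w ^ m) * \<psi> w)" if t: "t > 0" for t
  proof (rule Bochner_Integration.integrable_bound)
    define D where "D = \<bar>\<mu>\<bar> * C + (LINT c|?M. norm (\<Phi> c))"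
    show "integrable ?M (\<lambda>w. D * exp (- t * w ^ m))" using E[OF t] by simp
    show "AE w in ?M. norm (exp (- t * w ^ m) * \<psi> w) \<le> norm (D * exp (- t * w ^ m))"
    proof (rule AE_I2)
      fix w assume "w \<in> space ?M"
      then have "norm (\<psi> w) \<le> \<bar>D\<bar>" using \<psi>_bd[of w] by (simp add: D_def)
      then show "norm (exp (- t * w ^ m) * \<psi> w) \<le> norm (D * exp (- t * w ^ m))"
        by (simp add: norm_mult abs_mult mult_right_mono)
    qed
    have "(\<lambda>w. exp (- t * w ^ m)) \<in> borel_measurable ?M" by (intro borel_measurable_leb_onI) measurable
    then show "(\<lambda>w. exp (- t * w ^ m) * \<psi> w) \<in> borel_measurable ?M" by measurable
  qed
  have "Re (\<psi> w) = 0"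
  proof (rule exp_transform_injective[OF m _ _ E _ w])
    show "continuous_on {0..} (\<lambda>w. Re (\<psi> w))" using \<psi>_cont by (intro continuous_intros)
    show "\<bar>Re (\<psi> w)\<bar> \<le> \<bar>\<mu>\<bar> * C + (LINT c|?M. norm (\<Phi> c))" if "w \<ge> 0" for w
      using \<psi>_bd[OF that] abs_Re_le_cmod[of "\<psi> w"] by linarith
    show "(LINT w|?M. exp (- t * w ^ m) * Re (\<psi> w)) = 0" if "t > 0" for t
      using zero[OF that] integral_Re[OF int[OF that]] by simp
  qed
  moreover have "Im (\<psi> w) = 0"
  proof (rule exp_transform_injective[OF m _ _ E _ w])
    show "continuous_on {0..} (\<lambda>w. Im (\<psi> w))" using \<psi>_cont by (intro continuous_intros)
    show "\<bar>Im (\<psi> w)\<bar> \<le> \<bar>\<mu>\<bar> * C + (LINT c|?M. norm (\<Phi> c))" if "w \<ge> 0" for w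
      using \<psi>_bd[OF that] abs_Im_le_cmod[of "\<psi> w"] by linarith
    show "(LINT w|?M. exp (- t * w ^ m) * Im (\<psi> w)) = 0" if "t > 0" for t
      using zero[OF that] integral_Im[OF int[OF that]] by simp
  qed
  ultimately have "\<psi> w = 0" by (simp add: complex_eq_iff)
  then show ?thesis by (simp add: \<psi>_def)
qed


section \<open>The Bessel and cosine transforms\<close>

text \<open>The transform maps \<open>exp (- t * w)\<close> to \<open>exp (- c / (4 * t)) / t\<close>, again an exponential; the
  second application gives back the first one times \<open>4\<close>.\<close>

lemma bessel_inversion:
  fixes \<phi> \<Phi> :: "real \<Rightarrow> complex"
  assumes \<phi>: "continuous_on {0..} \<phi>" "\<And>w. w \<ge> 0 \<Longrightarrow> norm (\<phi> w) \<le> C" "integrable (leb_on {0..}) \<phi>"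
    and \<Phi>: "\<And>c. c \<ge> 0 \<Longrightarrow> \<Phi> c = (LINT w|leb_on {0..}. \<phi> w * bessel_sqrt (c * w))"
    and \<Phi>_int: "integrable (leb_on {0..}) \<Phi>"
    and w: "w \<ge> 0"
  shows "(LINT c|leb_on {0..}. \<Phi> c * bessel_sqrt (w * c)) = 4 * \<phi> w"
proof -
  have KE: "(LINT w|leb_on {0..}. exp (- t * w ^ 1) * bessel_sqrt (c * w)) = exp (- (1 / (4 * t)) * c) / t"
    if "t > 0" "c \<ge> 0" for t c :: real
    using bessel_laplace(2)[OF that] by simp
  have exp_int: "integrable (leb_on {0..}) (\<lambda>s. exp (- t * s ^ 1))" if "t > 0" for t :: real
    using integral_power_exp(1)[OF that, of 0] by simp
  have "(LINT c|leb_on {0..}. \<Phi> c * bessel_sqrt (w * c)) = complex_of_real 4 * \<phi> w"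
  proof (rule self_reciprocal_kernel_inversion[where m = 1 and \<kappa> = "\<lambda>c w. bessel_sqrt (c * w)", OF _ _ _ _ exp_int _ _ \<phi> \<Phi> \<Phi>_int w])
    show "continuous_on UNIV (\<lambda>p. bessel_sqrt (fst p * snd p))"
      by (intro continuous_intros)
    show "integrable (leb_on {0..}) (\<lambda>c. LINT w|leb_on {0..}. exp (- t * w ^ 1) * bessel_sqrt (c * w))" if t: "t > 0" for t
    proof -
      have "integrable (leb_on {0..}) (\<lambda>c. exp (- (1 / (4 * t)) * c ^ 1) / t)"
        using exp_int[of "1 / (4 * t)"] t by (intro integrable_divide) auto
      then show ?thesis
        by (rule Bochner_Integration.integrable_cong[THEN iffD1, OF refl, rotated]) (simp add: KE[OF t, simplified])
    qed
    fix t w :: real assume t: "t > 0" and w: "w \<ge> 0"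
    have "(LINT c|leb_on {0..}. (LINT v|leb_on {0..}. exp (- t * v ^ 1) * bessel_sqrt (c * v)) * bessel_sqrt (w * c))
      = (LINT c|leb_on {0..}. (1 / t) * (exp (- (1 / (4 * t)) * c) * bessel_sqrt (w * c)))"
      by (intro Bochner_Integration.integral_cong refl) (subst KE[OF t]; simp)
    also have "\<dots> = (1 / t) * (exp (- w / (4 * (1 / (4 * t)))) / (1 / (4 * t)))"
      by (subst integral_mult_right_zero, subst bessel_laplace(2)) (use t w in auto)
    also have "\<dots> = 4 * exp (- t * w ^ 1)" using t by (simp add: mult.commute)
    finally show "(LINT c|leb_on {0..}. (LINT v|leb_on {0..}. exp (- t * v ^ 1) * bessel_sqrt (c * v)) * bessel_sqrt (w * c))
      = 4 * exp (- t * w ^ 1)" .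
  qed (auto simp: mult.commute abs_bessel_sqrt_le_1)
  then show ?thesis by simp
qed

text \<open>After rescaling this is the characteristic function of the normal distribution.\<close>

lemma gaussian_cosine:
  assumes t: "t > 0"
  shows "integrable (leb_on {0..}) (\<lambda>w. exp (- t * w\<^sup>2) * cos (c * w))"
    and "(LINT w|leb_on {0..}. exp (- t * w\<^sup>2) * cos (c * w)) = sqrt (pi / t) / 2 * exp (- (c\<^sup>2) / (4 * t))"
proof -
  let ?F = "\<lambda>w. exp (- t * w\<^sup>2) * cos (c * w)"
  show int: "integrable (leb_on {0..}) ?F"
  proof (rule integrable_leb_on_bound[where C = "1 + 1 / t"])
    show "?F \<in> borel_measurable (leb_on {0..})" by (rule borel_measurable_leb_onI) measurable
    fix w :: real
    have "norm (?F w) \<le> exp (- t * w\<^sup>2) * 1"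
      by (simp add: abs_mult mult_left_le)
    also have "\<dots> \<le> 1 / (1 + t * w\<^sup>2)"
      using exp_ge_add_one_self[of "t * w\<^sup>2"] t by (simp add: exp_minus divide_inverse le_imp_inverse_le add_pos_nonneg)
    also have "\<dots> \<le> (1 + 1 / t) / (1 + w\<^sup>2)"
    proof -
      have "(1 + 1 / t) * (1 + t * w\<^sup>2) = (1 + w\<^sup>2) + (t * w\<^sup>2 + 1 / t)" using t by (simp add: field_simps)
      moreover have "0 \<le> t * w\<^sup>2 + 1 / t" using t by simp
      ultimately have "1 + w\<^sup>2 \<le> (1 + 1 / t) * (1 + t * w\<^sup>2)" by linarith
      moreover have "0 < 1 + w\<^sup>2" "0 < 1 + t * w\<^sup>2" using t by (auto intro: add_pos_nonneg)
      ultimately show ?thesis by (simp add: divide_le_eq pos_le_divide_eq mult.commute)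
    qed
    finally show "norm (?F w) \<le> (1 + 1 / t) / (1 + w\<^sup>2)" .
  qed simp
  have "has_bochner_integral lborel (\<lambda>w. indicator {0..} w *\<^sub>R ?F w) (LINT w|leb_on {0..}. ?F w)"
    using int by (simp add: has_bochner_integral_iff integrable_restrict_space integral_restrict_space)
  from has_bochner_integral_even_function[OF this]
  have half: "2 * (LINT w|leb_on {0..}. ?F w) = (LINT w|lborel. ?F w)"
    by (simp add: has_bochner_integral_iff)
  define b where "b = sqrt (2 * t)"
  have b: "b > 0" "b\<^sup>2 = 2 * t" using t by (auto simp: b_def)
  have int': "integrable std_normal_distribution (\<lambda>x. iexp (c / b * x))"
  proof -
    interpret real_distribution std_normal_distribution by (rule real_dist_normal_dist)
    show ?thesis by (rule integrable_const_bound[of _ 1]) auto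
  qed
  have "exp (- ((c / b)\<^sup>2) / 2) = Re (char std_normal_distribution (c / b))"
    by (simp add: char_std_normal_distribution)
  also have "\<dots> = (LINT x|std_normal_distribution. Re (iexp (c / b * x)))"
    unfolding char_def by (rule integral_Re[symmetric, OF int'])
  also have "\<dots> = (LINT x|lborel. std_normal_density x * cos (c / b * x))"
    by (subst integral_real_density) (auto simp: Re_exp)
  also have "\<dots> = b * (LINT w|lborel. std_normal_density (0 + b * w) * cos (c / b * (0 + b * w)))"
    using b by (subst lborel_integral_real_affine[of b _ 0]) auto
  also have "\<dots> = b * (LINT w|lborel. (1 / sqrt (2 * pi)) * ?F w)"
    using b by (simp add: std_normal_density_def power_mult_distrib)
  also have "\<dots> = b / sqrt (2 * pi) * (LINT w|lborel. ?F w)" by simp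
  finally have "(LINT w|lborel. ?F w) = sqrt (2 * pi) / b * exp (- ((c / b)\<^sup>2) / 2)"
    using b by (simp add: field_simps)
  also have "sqrt (2 * pi) / b = sqrt (pi / t)"
    using t by (simp add: b_def real_sqrt_divide [symmetric])
  also have "- ((c / b)\<^sup>2) / 2 = - (c\<^sup>2) / (4 * t)" by (simp add: power_divide b)
  finally show "(LINT w|leb_on {0..}. ?F w) = sqrt (pi / t) / 2 * exp (- (c\<^sup>2) / (4 * t))"
    using half by simp
qed

lemma cosine_inversion:
  fixes \<phi> \<Phi> :: "real \<Rightarrow> complex"
  assumes \<phi>: "continuous_on {0..} \<phi>" "\<And>w. w \<ge> 0 \<Longrightarrow> norm (\<phi> w) \<le> C" "integrable (leb_on {0..}) \<phi>"
    and \<Phi>: "\<And>c. c \<ge> 0 \<Longrightarrow> \<Phi> c = (LINT w|leb_on {0..}. \<phi> w * cos (c * w))"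
    and \<Phi>_int: "integrable (leb_on {0..}) \<Phi>"
    and w: "w \<ge> 0"
  shows "(LINT c|leb_on {0..}. \<Phi> c * cos (w * c)) = pi / 2 * \<phi> w"
proof -
  have KE: "(LINT w|leb_on {0..}. exp (- t * w ^ 2) * cos (c * w)) = sqrt (pi / t) / 2 * exp (- (1 / (4 * t)) * c ^ 2)"
    if "t > 0" for t c :: real
    using gaussian_cosine(2)[OF that, of c] by simp
  have exp_int: "integrable (leb_on {0..}) (\<lambda>s. exp (- t * s ^ 2))" if "t > 0" for t :: real
    using gaussian_cosine(1)[OF that, of 0] by simp
  have "(LINT c|leb_on {0..}. \<Phi> c * cos (w * c)) = complex_of_real (pi / 2) * \<phi> w"
  proof (rule self_reciprocal_kernel_inversion[where m = 2 and \<kappa> = "\<lambda>c w. cos (c * w)", OF _ _ _ _ exp_int _ _ \<phi> \<Phi> \<Phi>_int w])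
    show "continuous_on UNIV (\<lambda>p. cos (fst p * snd p :: real))"
      by (intro continuous_intros)
    show "integrable (leb_on {0..}) (\<lambda>c. LINT w|leb_on {0..}. exp (- t * w ^ 2) * cos (c * w))" if t: "t > 0" for t
      unfolding KE[OF t] using exp_int[of "1 / (4 * t)"] t by (intro integrable_mult_right) auto
    fix t w :: real assume t: "t > 0"
    have "(LINT c|leb_on {0..}. (LINT v|leb_on {0..}. exp (- t * v ^ 2) * cos (c * v)) * cos (w * c))
      = (LINT c|leb_on {0..}. (sqrt (pi / t) / 2) * (exp (- (1 / (4 * t)) * c ^ 2) * cos (w * c)))"
      unfolding KE[OF t] by (simp only: mult.assoc)
    also have "\<dots> = (sqrt (pi / t) / 2) * (sqrt (pi / (1 / (4 * t))) / 2 * exp (- (w\<^sup>2) / (4 * (1 / (4 * t)))))"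
      by (subst integral_mult_right_zero, subst gaussian_cosine(2)) (use t in auto)
    also have "\<dots> = (sqrt (pi / t) * sqrt (pi * (4 * t)) / 4) * exp (- t * w ^ 2)"
      using t by (simp add: mult.commute)
    also have "sqrt (pi / t) * sqrt (pi * (4 * t)) = sqrt ((2 * pi)\<^sup>2)"
      unfolding real_sqrt_mult [symmetric] using t by (simp add: power2_eq_square)
    also have "\<dots> = 2 * pi" by (simp only: real_sqrt_abs) simp
    finally show "(LINT c|leb_on {0..}. (LINT v|leb_on {0..}. exp (- t * v ^ 2) * cos (c * v)) * cos (w * c))
      = pi / 2 * exp (- t * w ^ 2)" by simp
  qed (auto simp: mult.commute)
  then show ?thesis by simp
qed


section \<open>Decay of the transforms of rapidly decreasing families\<close>

text \<open>The bounds are uniform in the index because the families will be averaged over the circle.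
  Two-sided derivatives are required also at \<open>v = 0\<close>: the functions of interest extend beyond that
  point, and this avoids one-sided calculus.\<close>

fun rapid :: "nat \<Rightarrow> 'i set \<Rightarrow> ('i \<Rightarrow> real \<Rightarrow> complex) \<Rightarrow> bool" where
  "rapid 0 I \<phi> \<longleftrightarrow> (\<forall>N::nat. \<exists>C. \<forall>i\<in>I. \<forall>v\<ge>0. norm (\<phi> i v) * (1 + v) ^ N \<le> C) \<and>
     (\<forall>i\<in>I. \<forall>v\<ge>0. isCont (\<phi> i) v)"
| "rapid (Suc n) I \<phi> \<longleftrightarrow> rapid 0 I \<phi> \<and>
     (\<exists>\<phi>'. (\<forall>i\<in>I. \<forall>v\<ge>0. (\<phi> i has_vector_derivative \<phi>' i v) (at v)) \<and> rapid n I \<phi>')"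

lemma rapid_imp_0: "rapid n I \<phi> \<Longrightarrow> rapid 0 I \<phi>"
  by (cases n) (simp_all del: rapid.simps(1))

lemma rapid_SucD: "rapid (Suc n) I \<phi> \<Longrightarrow> rapid n I \<phi>"
proof (induction n arbitrary: \<phi>)
  case 0
  then show ?case by (rule rapid_imp_0)
next
  case (Suc n)
  then show ?case by (simp del: rapid.simps(1)) blast
qed

lemma rapid_SucI:
  assumes "rapid 0 I \<phi>"
    and "\<And>i v. i \<in> I \<Longrightarrow> v \<ge> 0 \<Longrightarrow> (\<phi> i has_vector_derivative \<phi>' i v) (at v)"
    and "rapid n I \<phi>'"
  shows "rapid (Suc n) I \<phi>"
  unfolding rapid.simps(2) by (intro conjI exI[of _ \<phi>'] ballI allI impI assms)

lemma rapid_isCont: "rapid n I \<phi> \<Longrightarrow> i \<in> I \<Longrightarrow> v \<ge> 0 \<Longrightarrow> isCont (\<phi> i) v"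
  using rapid_imp_0[of n I \<phi>] by simp

lemma rapid_0D:
  "rapid 0 I \<phi> \<Longrightarrow> \<exists>C. \<forall>i\<in>I. \<forall>v\<ge>0. norm (\<phi> i v) * (1 + v) ^ N \<le> C"
  by simp

lemma rapid_bound:
  fixes N :: nat
  assumes "rapid n I \<phi>"
  obtains C where "C \<ge> 0" "\<And>i v. i \<in> I \<Longrightarrow> v \<ge> 0 \<Longrightarrow> norm (\<phi> i v) \<le> C / (1 + v) ^ N"
proof -
  obtain C where C: "\<And>i v. i \<in> I \<Longrightarrow> v \<ge> 0 \<Longrightarrow> norm (\<phi> i v) * (1 + v) ^ N \<le> C"
    using rapid_0D[OF rapid_imp_0[OF assms], of N] by blast
  show ?thesis
  proof (rule that[of "max C 0"])
    fix i v assume "i \<in> I" "v \<ge> (0::real)"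
    then have "norm (\<phi> i v) * (1 + v) ^ N \<le> max C 0" using C by (meson max.coboundedI1)
    then show "norm (\<phi> i v) \<le> max C 0 / (1 + v) ^ N"
      using \<open>v \<ge> 0\<close> by (simp add: pos_le_divide_eq)
  qed simp
qed

lemma rapid_add:
  "rapid n I \<phi> \<Longrightarrow> rapid n I \<psi> \<Longrightarrow> rapid n I (\<lambda>i v. \<phi> i v + \<psi> i v)"
proof (induction n arbitrary: \<phi> \<psi>)
  case 0
  show ?case
    unfolding rapid.simps
  proof (intro conjI allI)
    fix N :: nat
    obtain C where C: "\<And>i v. i \<in> I \<Longrightarrow> v \<ge> 0 \<Longrightarrow> norm (\<phi> i v) * (1 + v) ^ N \<le> C"
      using rapid_0D[OF 0(1), of N] by blast
    obtain D where D: "\<And>i v. i \<in> I \<Longrightarrow> v \<ge> 0 \<Longrightarrow> norm (\<psi> i v) * (1 + v) ^ N \<le> D"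
      using rapid_0D[OF 0(2), of N] by blast
    have "norm (\<phi> i v + \<psi> i v) * (1 + v) ^ N \<le> C + D" if "i \<in> I" "v \<ge> 0" for i v
    proof -
      have "norm (\<phi> i v + \<psi> i v) * (1 + v) ^ N \<le> (norm (\<phi> i v) + norm (\<psi> i v)) * (1 + v) ^ N"
        using that by (intro mult_right_mono norm_triangle_ineq) auto
      with C[OF that] D[OF that] show ?thesis by (simp add: distrib_right)
    qed
    then show "\<exists>C. \<forall>i\<in>I. \<forall>v\<ge>0. norm (\<phi> i v + \<psi> i v) * (1 + v) ^ N \<le> C" by blast
  qed (use 0 in auto)
next
  case (Suc n)
  obtain \<phi>' \<psi>' where
    "\<forall>i\<in>I. \<forall>v\<ge>0. (\<phi> i has_vector_derivative \<phi>' i v) (at v)" "rapid n I \<phi>'"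
    "\<forall>i\<in>I. \<forall>v\<ge>0. (\<psi> i has_vector_derivative \<psi>' i v) (at v)" "rapid n I \<psi>'"
    using Suc.prems by (simp del: rapid.simps(1)) blast
  moreover have "rapid n I (\<lambda>i v. \<phi>' i v + \<psi>' i v)" using Suc.IH calculation by blast
  moreover have "rapid 0 I (\<lambda>i v. \<phi> i v + \<psi> i v)"
    using Suc by (meson rapid_SucD rapid_imp_0)
  ultimately show ?case
    by (simp del: rapid.simps(1)) (intro exI[of _ "\<lambda>i v. \<phi>' i v + \<psi>' i v"], auto intro!: derivative_intros)
qed

lemma rapid_scale:
  assumes K: "\<And>i. i \<in> I \<Longrightarrow> norm (c i) \<le> K"
  shows "rapid n I \<phi> \<Longrightarrow> rapid n I (\<lambda>i v. c i * \<phi> i v)"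
proof (induction n arbitrary: \<phi>)
  case 0
  show ?case
    unfolding rapid.simps
  proof (intro conjI allI)
    fix N :: nat
    obtain C where C: "\<And>i v. i \<in> I \<Longrightarrow> v \<ge> 0 \<Longrightarrow> norm (\<phi> i v) * (1 + v) ^ N \<le> C"
      using rapid_0D[OF 0, of N] by blast
    have "norm (c i * \<phi> i v) * (1 + v) ^ N \<le> K * C" if "i \<in> I" "v \<ge> 0" for i v
    proof -
      have "norm (c i) * (norm (\<phi> i v) * (1 + v) ^ N) \<le> K * C"
        using that by (intro mult_mono K C order_trans[OF norm_ge_zero K]) auto
      then show ?thesis by (simp add: norm_mult mult.assoc)
    qed
    then show "\<exists>C. \<forall>i\<in>I. \<forall>v\<ge>0. norm (c i * \<phi> i v) * (1 + v) ^ N \<le> C" by blast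
  qed (use 0 in auto)
next
  case (Suc n)
  obtain \<phi>' where "\<forall>i\<in>I. \<forall>v\<ge>0. (\<phi> i has_vector_derivative \<phi>' i v) (at v)" "rapid n I \<phi>'"
    using Suc.prems by (simp del: rapid.simps(1)) blast
  moreover have "rapid n I (\<lambda>i v. c i * \<phi>' i v)" using Suc.IH calculation by blast
  moreover have "rapid 0 I (\<lambda>i v. c i * \<phi> i v)"
    using Suc by (meson rapid_SucD rapid_imp_0)
  ultimately show ?case
    by (simp del: rapid.simps(1)) (intro exI[of _ "\<lambda>i v. c i * \<phi>' i v"], auto intro!: has_vector_derivative_mult_right)
qed

lemma rapid_times_id: "rapid n I \<phi> \<Longrightarrow> rapid n I (\<lambda>i v. of_real v * \<phi> i v)"
proof (induction n arbitrary: \<phi>)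
  case 0
  show ?case
    unfolding rapid.simps
  proof (intro conjI allI)
    fix N :: nat
    obtain C where C: "\<And>i v. i \<in> I \<Longrightarrow> v \<ge> 0 \<Longrightarrow> norm (\<phi> i v) * (1 + v) ^ Suc N \<le> C"
      using rapid_0D[OF 0, of "Suc N"] by blast
    have "norm (of_real v * \<phi> i v) * (1 + v) ^ N \<le> C" if "i \<in> I" "v \<ge> 0" for i v
    proof -
      have "norm (of_real v * \<phi> i v) * (1 + v) ^ N = norm (\<phi> i v) * (v * (1 + v) ^ N)"
        using that by (simp add: norm_mult)
      also have "\<dots> \<le> norm (\<phi> i v) * (1 + v) ^ Suc N"
        using that by (intro mult_left_mono) (auto intro!: mult_right_mono)
      finally show ?thesis using C[OF that] by linarith
    qed
    then show "\<exists>C. \<forall>i\<in>I. \<forall>v\<ge>0. norm (of_real v * \<phi> i v) * (1 + v) ^ N \<le> C" by blast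
  next
    have "isCont (\<lambda>v. of_real v * \<phi> i v) v" if "i \<in> I" "v \<ge> 0" for i v
      using rapid_isCont[OF 0 that] by (intro continuous_mult continuous_of_real continuous_ident)
    then show "\<forall>i\<in>I. \<forall>v\<ge>0. isCont (\<lambda>v. of_real v * \<phi> i v) v" by blast
  qed
next
  case (Suc n)
  obtain \<phi>' where \<phi>': "\<forall>i\<in>I. \<forall>v\<ge>0. (\<phi> i has_vector_derivative \<phi>' i v) (at v)" "rapid n I \<phi>'"
    using Suc.prems by (simp del: rapid.simps(1)) blast
  have "rapid n I (\<lambda>i v. of_real v * \<phi>' i v + \<phi> i v)"
    by (rule rapid_add[OF Suc.IH[OF \<phi>'(2)] rapid_SucD[OF Suc.prems]])
  moreover have "rapid 0 I (\<lambda>i v. of_real v * \<phi> i v)"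
    by (rule rapid_imp_0[OF Suc.IH[OF rapid_SucD[OF Suc.prems]]])
  moreover have "((\<lambda>v. of_real v * \<phi> i v) has_vector_derivative of_real v * \<phi>' i v + \<phi> i v) (at v)"
    if "i \<in> I" "v \<ge> 0" for i v
  proof -
    have "((\<lambda>v. of_real v * \<phi> i v) has_vector_derivative of_real v * \<phi>' i v + of_real 1 * \<phi> i v) (at v)"
      using \<phi>' that by (intro has_vector_derivative_mult has_vector_derivative_of_real DERIV_ident) auto
    then show ?thesis by simp
  qed
  ultimately show ?case
    unfolding rapid.simps(2)
    by (intro conjI exI[of _ "\<lambda>i v. of_real v * \<phi>' i v + \<phi> i v"] ballI allI impI)
qed

lemma one_plus_square_le: "v \<ge> 0 \<Longrightarrow> 1 + v\<^sup>2 \<le> (1 + v)\<^sup>2" for v :: real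
  by (simp add: power2_eq_square algebra_simps)

lemma integral_inverse_one_plus_square:
  fixes f :: "real \<Rightarrow> complex"
  assumes [measurable]: "f \<in> borel_measurable (leb_on {0..})"
    and le: "\<And>v. v \<ge> 0 \<Longrightarrow> norm (f v) \<le> C / (1 + v\<^sup>2)"
  shows "integrable (leb_on {0..}) f"
    and "norm (LINT v|leb_on {0..}. f v) \<le> C * (LINT v|leb_on {0..}. 1 / (1 + v\<^sup>2))"
proof -
  have int: "integrable (leb_on {0::real..}) (\<lambda>v. 1 / (1 + v\<^sup>2))"
    by (rule integrable_leb_on_bound[of _ _ 1]) (auto intro!: borel_measurable_leb_onI)
  show f: "integrable (leb_on {0..}) f"
    by (rule integrable_leb_on_bound[of _ _ C]) (use le in auto)
  have "norm (LINT v|leb_on {0..}. f v) \<le> (LINT v|leb_on {0..}. norm (f v))"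
    by (rule integral_norm_bound)
  also have "\<dots> \<le> (LINT v|leb_on {0..}. C * (1 / (1 + v\<^sup>2)))"
    using f integrable_mult_right[OF int, of C] le by (intro integral_mono) auto
  finally show "norm (LINT v|leb_on {0..}. f v) \<le> C * (LINT v|leb_on {0..}. 1 / (1 + v\<^sup>2))" by (simp only: integral_mult_right_zero)
qed

lemma rapid_continuous_on: "rapid n I \<phi> \<Longrightarrow> i \<in> I \<Longrightarrow> continuous_on {0..} (\<phi> i)"
  by (auto intro!: continuous_at_imp_continuous_on rapid_isCont)

lemma rapid_integral_bound:
  assumes "rapid n I \<phi>"
  obtains K where "K \<ge> 0"
    "\<And>i k. i \<in> I \<Longrightarrow> k \<in> borel_measurable borel \<Longrightarrow> (\<And>v. v \<ge> 0 \<Longrightarrow> \<bar>k v\<bar> \<le> 1) \<Longrightarrow>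
       integrable (leb_on {0..}) (\<lambda>v. \<phi> i v * complex_of_real (k v)) \<and>
       norm (LINT v|leb_on {0..}. \<phi> i v * complex_of_real (k v)) \<le> K"
proof -
  obtain C where C: "C \<ge> 0" "\<And>i v. i \<in> I \<Longrightarrow> v \<ge> 0 \<Longrightarrow> norm (\<phi> i v) \<le> C / (1 + v) ^ 2"
    using rapid_bound[OF assms, of 2] by blast
  show ?thesis
  proof (rule that)
    show "0 \<le> C * (LINT v|leb_on {0..}. 1 / (1 + v\<^sup>2))"
      using C by (intro mult_nonneg_nonneg integral_nonneg_AE AE_I2) auto
    fix i and k :: "real \<Rightarrow> real" assume i: "i \<in> I" and [measurable]: "k \<in> borel_measurable borel"
      and k: "\<And>v. v \<ge> 0 \<Longrightarrow> \<bar>k v\<bar> \<le> (1::real)"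
    have [measurable]: "k \<in> borel_measurable (leb_on {0..})" by (rule borel_measurable_leb_onI) fact
    have [measurable]: "\<phi> i \<in> borel_measurable (leb_on {0..})"
      by (rule borel_measurable_leb_on_continuous[OF rapid_continuous_on[OF assms i]])
    have m: "(\<lambda>v. \<phi> i v * complex_of_real (k v)) \<in> borel_measurable (leb_on {0..})" by measurable
    have "norm (\<phi> i v * complex_of_real (k v)) \<le> C / (1 + v\<^sup>2)" if v: "v \<ge> 0" for v
    proof -
      have "norm (\<phi> i v * complex_of_real (k v)) \<le> norm (\<phi> i v)"
        using k[OF v] by (simp add: norm_mult mult_right_le_one_le)
      also have "\<dots> \<le> C / (1 + v) ^ 2" using C i v by auto
      also have "\<dots> \<le> C / (1 + v\<^sup>2)"
        using C v one_plus_square_le[OF v] by (intro frac_le) (auto intro: add_pos_nonneg)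
      finally show ?thesis .
    qed
    from integral_inverse_one_plus_square[OF m this]
    show "integrable (leb_on {0..}) (\<lambda>v. \<phi> i v * complex_of_real (k v)) \<and>
       norm (LINT v|leb_on {0..}. \<phi> i v * complex_of_real (k v)) \<le> C * (LINT v|leb_on {0..}. 1 / (1 + v\<^sup>2))"
      by blast
  qed
qed

lemma rapid_integrable:
  assumes "rapid n I \<phi>" "i \<in> I" "k \<in> borel_measurable borel" "\<And>v. v \<ge> 0 \<Longrightarrow> \<bar>k v\<bar> \<le> 1"
  shows "integrable (leb_on {0..}) (\<lambda>v. \<phi> i v * complex_of_real (k v))"
  by (rule rapid_integral_bound[OF assms(1)]) (use assms(2-) in blast)

text \<open>Since the kernel satisfies \<open>(v B')' = - B / 4\<close>, integrating by parts twice moves the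
  operator \<open>\<phi> \<mapsto> (v \<phi>')' = \<phi>' + v \<phi>''\<close> onto \<open>\<phi>\<close> and gains a factor \<open>1 / c\<close>. Both boundary terms at
  \<open>0\<close> carry the factor \<open>v\<close>.\<close>

lemma bessel_by_parts:
  assumes \<phi>: "rapid (Suc (Suc n)) I \<phi>"
  obtains \<eta> where "rapid n I \<eta>"
    "\<And>i c. i \<in> I \<Longrightarrow> c > 0 \<Longrightarrow>
      (LINT v|leb_on {0..}. \<phi> i v * complex_of_real (bessel_sqrt (c * v))) =
      - of_real (4 / c) * (LINT v|leb_on {0..}. \<eta> i v * complex_of_real (bessel_sqrt (c * v)))"
proof -
  obtain \<phi>' where \<phi>': "\<And>i v. i \<in> I \<Longrightarrow> v \<ge> 0 \<Longrightarrow> (\<phi> i has_vector_derivative \<phi>' i v) (at v)" "rapid (Suc n) I \<phi>'"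
    using \<phi> by (simp del: rapid.simps(1)) blast
  obtain \<phi>'' where \<phi>'': "\<And>i v. i \<in> I \<Longrightarrow> v \<ge> 0 \<Longrightarrow> (\<phi>' i has_vector_derivative \<phi>'' i v) (at v)" "rapid n I \<phi>''"
    using \<phi>'(2) by (simp del: rapid.simps(1)) blast
  define \<eta> where "\<eta> = (\<lambda>i v. \<phi>' i v + of_real v * \<phi>'' i v)"
  have \<eta>: "rapid n I \<eta>" unfolding \<eta>_def
    by (intro rapid_add rapid_times_id \<phi>'' rapid_SucD[OF \<phi>'(2)])
  show ?thesis
  proof (rule that[OF \<eta>])
    fix i and c :: real assume i: "i \<in> I" and c: "c > 0"
    let ?B = "\<lambda>v. complex_of_real (bessel_sqrt (c * v))"
    define mm where "mm = (\<lambda>v. v * bessel_sqrt' v)"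
    \<comment> \<open>The terms with first derivatives of both functions cancel in the derivative of \<open>F\<close>.\<close>
    define F where "F = (\<lambda>v. \<phi> i v * of_real (mm (c * v)) - (of_real v * \<phi>' i v) * ?B v)"
    define f where "f = (\<lambda>v. - of_real (c / 4) * (\<phi> i v * ?B v) - \<eta> i v * ?B v)"
    have [measurable]: "(\<lambda>v. bessel_sqrt (c * v)) \<in> borel_measurable borel" by measurable
    have le1: "\<bar>bessel_sqrt (c * v)\<bar> \<le> 1" if "v \<ge> 0" for v
      using that c by (intro abs_bessel_sqrt_le_1) auto
    have int1: "integrable (leb_on {0..}) (\<lambda>v. \<phi> i v * ?B v)"
      by (rule rapid_integrable[OF \<phi> i _ le1]) measurable
    have int2: "integrable (leb_on {0..}) (\<lambda>v. \<eta> i v * ?B v)"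
      by (rule rapid_integrable[OF \<eta> i _ le1]) measurable
    have f_int: "integrable (leb_on {0..}) f"
      unfolding f_def using int1 int2 by (intro Bochner_Integration.integrable_diff integrable_mult_right)
    have f_int': "integrable (leb_on {0<..}) f"
      using f_int by (subst leb_on_atLeast_eq_greaterThan(1)[symmetric]) auto
    have deriv: "(F has_vector_derivative f v) (at v)" if v: "v \<ge> 0" for v
    proof -
      have mm: "((\<lambda>v. mm (c * v)) has_real_derivative - (c / 4) * bessel_sqrt (c * v)) (at v)"
      proof -
        have "(mm has_real_derivative - bessel_sqrt (c * v) / 4) (at (c * v))"
          unfolding mm_def by (rule bessel_ode)
        then have "((\<lambda>v. mm (c * v)) has_real_derivative - bessel_sqrt (c * v) / 4 * c) (at v)"
          by (rule DERIV_chain2) (auto intro!: derivative_eq_intros)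
        then show ?thesis by (simp add: mult.commute)
      qed
      have B: "((\<lambda>v. bessel_sqrt (c * v)) has_real_derivative c * bessel_sqrt' (c * v)) (at v)"
      proof -
        have "((\<lambda>v. bessel_sqrt (c * v)) has_real_derivative bessel_sqrt' (c * v) * c) (at v)"
          by (rule DERIV_chain2[OF DERIV_bessel_sqrt]) (auto intro!: derivative_eq_intros)
        then show ?thesis by (simp add: mult.commute)
      qed
      have "(F has_vector_derivative
          (\<phi> i v * of_real (- (c / 4) * bessel_sqrt (c * v)) + \<phi>' i v * of_real (mm (c * v))) -
          ((of_real v * \<phi>' i v) * of_real (c * bessel_sqrt' (c * v)) +
           (of_real v * \<phi>'' i v + of_real 1 * \<phi>' i v) * ?B v)) (at v)"
        unfolding F_def using i v
        by (intro has_vector_derivative_diff has_vector_derivative_mult has_vector_derivative_of_real mm B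
              DERIV_ident \<phi>' \<phi>'')
      also have "(\<phi> i v * of_real (- (c / 4) * bessel_sqrt (c * v)) + \<phi>' i v * of_real (mm (c * v))) -
          ((of_real v * \<phi>' i v) * of_real (c * bessel_sqrt' (c * v)) +
           (of_real v * \<phi>'' i v + of_real 1 * \<phi>' i v) * ?B v) = f v"
        by (simp add: f_def mm_def \<eta>_def algebra_simps)
      finally show ?thesis .
    qed
    have f_cont: "isCont f v" if "v > 0" for v
      unfolding f_def using that i
      by (intro continuous_intros rapid_isCont[OF \<phi>] rapid_isCont[OF \<eta>] isCont_o2[OF _ isCont_bessel_sqrt]) auto
    have lim: "(F \<longlongrightarrow> 0) at_top"
    proof -
      obtain C where C: "C \<ge> 0" "\<And>i v. i \<in> I \<Longrightarrow> v \<ge> 0 \<Longrightarrow> norm (\<phi> i v) \<le> C / (1 + v) ^ 2"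
        using rapid_bound[OF \<phi>, of 2] by blast
      obtain D where D: "D \<ge> 0" "\<And>i v. i \<in> I \<Longrightarrow> v \<ge> 0 \<Longrightarrow> norm (\<phi>' i v) \<le> D / (1 + v) ^ 2"
        using rapid_bound[OF \<phi>'(2), of 2] by blast
      have "norm (F v) \<le> (C * c + D) * (1 / (1 + v))" if v: "v \<ge> 0" for v
      proof -
        have "norm (F v) \<le> norm (\<phi> i v) * \<bar>mm (c * v)\<bar> + (v * norm (\<phi>' i v)) * \<bar>bessel_sqrt (c * v)\<bar>"
          unfolding F_def using v by (intro order_trans[OF norm_triangle_ineq4]) (simp add: norm_mult)
        also have "\<dots> \<le> C / (1 + v) ^ 2 * (c * v) + (v * (D / (1 + v) ^ 2)) * 1"
          using C(1) D(1) C(2)[OF i v] D(2)[OF i v] v le1[OF v] abs_times_bessel_sqrt'_le[of "c * v"] c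
          by (intro add_mono mult_mono) (auto simp: mm_def)
        also have "\<dots> = (C * c + D) * (v / (1 + v) ^ 2)" by (simp add: algebra_simps add_divide_distrib)
        also have "\<dots> \<le> (C * c + D) * (1 / (1 + v))"
          using C D c v by (intro mult_left_mono) (auto simp: divide_simps power2_eq_square)
        finally show ?thesis .
      qed
      then have "eventually (\<lambda>v. norm (F v) \<le> (C * c + D) * (1 / (1 + v))) at_top"
        by (rule eventually_mono[OF eventually_ge_at_top[of "0::real"]])
      moreover have "((\<lambda>v::real. (C * c + D) * (1 / (1 + v))) \<longlongrightarrow> (C * c + D) * 0) at_top"
        by (intro tendsto_intros tendsto_divide_0[OF tendsto_const] filterlim_at_top_imp_at_infinity
              filterlim_tendsto_add_at_top[OF tendsto_const] filterlim_ident)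
      ultimately show ?thesis
        by (intro Lim_null_comparison[of F]) auto
    qed
    have "(LINT v|leb_on {0<..}. f v) = - F 0"
      by (rule integral_halfline_FTC[OF deriv f_cont f_int' lim])
    also have "F 0 = 0" by (simp add: F_def mm_def)
    finally have "(LINT v|leb_on {0<..}. f v) = 0" by simp
    moreover have "(LINT v|leb_on {0..}. f v) = (LINT v|leb_on {0<..}. f v)"
      using f_int by (intro leb_on_atLeast_eq_greaterThan(2)) auto
    moreover have "(LINT v|leb_on {0..}. f v) =
      - of_real (c / 4) * (LINT v|leb_on {0..}. \<phi> i v * ?B v) - (LINT v|leb_on {0..}. \<eta> i v * ?B v)"
      unfolding f_def using int1 int2 by simp
    ultimately have "(LINT v|leb_on {0..}. \<eta> i v * ?B v) = - (of_real (c / 4) * (LINT v|leb_on {0..}. \<phi> i v * ?B v))"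
      by (simp add: eq_neg_iff_add_eq_0 add.commute)
    moreover have "of_real (4 / c) * (of_real (c / 4) * z) = z" for z :: complex
      using c by (simp add: field_simps)
    ultimately show "(LINT v|leb_on {0..}. \<phi> i v * ?B v) = - of_real (4 / c) * (LINT v|leb_on {0..}. \<eta> i v * ?B v)"
      by (simp only: mult_minus_left mult_minus_right minus_minus)
  qed
qed

text \<open>Each integration by parts costs two derivatives and gains \<open>1 / c\<close>; two of them give \<open>1 /
  c\<^sup>2\<close>, and for small \<open>c\<close> the transform is bounded.\<close>

lemma bessel_transform_decay:
  assumes \<phi>: "rapid 4 I \<phi>"
  obtains C where "C \<ge> 0" "\<And>i c. i \<in> I \<Longrightarrow> c \<ge> 0 \<Longrightarrow>
      norm (LINT v|leb_on {0..}. \<phi> i v * complex_of_real (bessel_sqrt (c * v))) \<le> C / (1 + c\<^sup>2)"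
proof -
  have "rapid (Suc (Suc (Suc (Suc 0)))) I \<phi>" using \<phi> by (simp only: eval_nat_numeral One_nat_def BitM.simps)
  then obtain \<eta>1 where \<eta>1: "rapid (Suc (Suc 0)) I \<eta>1" "\<And>i c. i \<in> I \<Longrightarrow> c > 0 \<Longrightarrow>
      (LINT v|leb_on {0..}. \<phi> i v * complex_of_real (bessel_sqrt (c * v))) =
      - of_real (4 / c) * (LINT v|leb_on {0..}. \<eta>1 i v * complex_of_real (bessel_sqrt (c * v)))"
    using bessel_by_parts by blast
  obtain \<eta>2 where \<eta>2: "rapid 0 I \<eta>2" "\<And>i c. i \<in> I \<Longrightarrow> c > 0 \<Longrightarrow>
      (LINT v|leb_on {0..}. \<eta>1 i v * complex_of_real (bessel_sqrt (c * v))) =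
      - of_real (4 / c) * (LINT v|leb_on {0..}. \<eta>2 i v * complex_of_real (bessel_sqrt (c * v)))"
    using bessel_by_parts[OF \<eta>1(1)] by blast
  have B: "(\<lambda>v. bessel_sqrt (c * v)) \<in> borel_measurable borel" for c by measurable
  have le1: "\<bar>bessel_sqrt (c * v)\<bar> \<le> 1" if "c \<ge> 0" "v \<ge> 0" for c v
    using that by (intro abs_bessel_sqrt_le_1) auto
  obtain K0 where K0: "K0 \<ge> 0" "\<And>i c. i \<in> I \<Longrightarrow> c \<ge> 0 \<Longrightarrow>
      norm (LINT v|leb_on {0..}. \<phi> i v * complex_of_real (bessel_sqrt (c * v))) \<le> K0"
    by (rule rapid_integral_bound[OF \<phi>]) (use B le1 in blast)
  obtain K2 where K2: "K2 \<ge> 0" "\<And>i c. i \<in> I \<Longrightarrow> c \<ge> 0 \<Longrightarrow>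
      norm (LINT v|leb_on {0..}. \<eta>2 i v * complex_of_real (bessel_sqrt (c * v))) \<le> K2"
    by (rule rapid_integral_bound[OF \<eta>2(1)]) (use B le1 in blast)
  show ?thesis
  proof (rule that[of "2 * K0 + 32 * K2"])
    fix i and c :: real assume i: "i \<in> I" and c: "c \<ge> 0"
    let ?N = "norm (LINT v|leb_on {0..}. \<phi> i v * complex_of_real (bessel_sqrt (c * v)))"
    have pos: "0 < 1 + c\<^sup>2" by (simp add: add_pos_nonneg)
    show "?N \<le> (2 * K0 + 32 * K2) / (1 + c\<^sup>2)"
    proof (cases "c \<le> 1")
      case True
      then have "c\<^sup>2 \<le> 1" using c by (simp add: power_le_one)
      then have "K0 * (1 + c\<^sup>2) \<le> K0 * 2" using K0 by (intro mult_left_mono) auto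
      then have "?N * (1 + c\<^sup>2) \<le> 2 * K0"
        using mult_right_mono[OF K0(2)[OF i c] less_imp_le[OF pos]] by linarith
      then have "?N * (1 + c\<^sup>2) \<le> 2 * K0 + 32 * K2" using K2 by linarith
      then show ?thesis using pos by (simp add: pos_le_divide_eq)
    next
      case False
      then have c1: "c > 1" by simp
      then have c2: "1 \<le> c\<^sup>2" by (simp add: one_le_power)
      have "?N = 16 / c\<^sup>2 * norm (LINT v|leb_on {0..}. \<eta>2 i v * complex_of_real (bessel_sqrt (c * v)))"
        using c1 \<eta>1(2)[OF i, of c] \<eta>2(2)[OF i, of c] by (simp add: norm_mult norm_divide power2_eq_square)
      also have "\<dots> \<le> 16 / c\<^sup>2 * K2" using K2(2)[OF i c] by (intro mult_left_mono) auto
      finally have "?N * (1 + c\<^sup>2) \<le> 16 / c\<^sup>2 * K2 * (1 + c\<^sup>2)" using pos by (intro mult_right_mono) auto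
      also have "\<dots> \<le> 16 / c\<^sup>2 * K2 * (2 * c\<^sup>2)" using c2 K2 by (intro mult_left_mono) auto
      also have "\<dots> = 32 * K2" using c1 by simp
      finally have "?N * (1 + c\<^sup>2) \<le> 2 * K0 + 32 * K2" using K0 by linarith
      then show ?thesis using pos by (simp add: pos_le_divide_eq)
    qed
  qed (use K0 K2 in auto)
qed

text \<open>The function \<open>h s = s * \<gamma> (s\<^sup>2)\<close> vanishes at \<open>0\<close>, so integrating by parts twice leaves only
  the boundary term with the first derivative, which is of order \<open>1 / b\<^sup>2\<close>.\<close>

lemma cosine_transform_decay:
  assumes \<gamma>: "rapid 2 I \<gamma>"
  obtains C where "C \<ge> 0" "\<And>i b. i \<in> I \<Longrightarrow> b \<ge> 0 \<Longrightarrow>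
      norm (LINT s|leb_on {0..}. (of_real s * \<gamma> i (s\<^sup>2)) * complex_of_real (cos (b * s))) \<le> C / (1 + b\<^sup>2)"
proof -
  have \<gamma>2: "rapid (Suc (Suc 0)) I \<gamma>" using \<gamma> by (simp only: numeral_2_eq_2)
  then obtain \<gamma>' where \<gamma>': "\<And>i v. i \<in> I \<Longrightarrow> v \<ge> 0 \<Longrightarrow> (\<gamma> i has_vector_derivative \<gamma>' i v) (at v)" "rapid (Suc 0) I \<gamma>'"
    by (simp del: rapid.simps(1)) blast
  obtain \<gamma>'' where \<gamma>'': "\<And>i v. i \<in> I \<Longrightarrow> v \<ge> 0 \<Longrightarrow> (\<gamma>' i has_vector_derivative \<gamma>'' i v) (at v)" "rapid 0 I \<gamma>''"
    using \<gamma>'(2) by (simp del: rapid.simps(1)) blast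
  obtain C0 where C0: "C0 \<ge> 0" "\<And>i v. i \<in> I \<Longrightarrow> v \<ge> 0 \<Longrightarrow> norm (\<gamma> i v) \<le> C0 / (1 + v) ^ 2"
    using rapid_bound[OF \<gamma>, of 2] by blast
  obtain C1 where C1: "C1 \<ge> 0" "\<And>i v. i \<in> I \<Longrightarrow> v \<ge> 0 \<Longrightarrow> norm (\<gamma>' i v) \<le> C1 / (1 + v) ^ 2"
    using rapid_bound[OF \<gamma>'(2), of 2] by blast
  obtain C2 where C2: "C2 \<ge> 0" "\<And>i v. i \<in> I \<Longrightarrow> v \<ge> 0 \<Longrightarrow> norm (\<gamma>'' i v) \<le> C2 / (1 + v) ^ 3"
    using rapid_bound[OF \<gamma>''(2), of 3] by blast
  define J where "J = (LINT v|leb_on {0::real..}. 1 / (1 + v\<^sup>2))"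
  have J: "0 \<le> J" unfolding J_def by (intro integral_nonneg_AE AE_I2) auto
  define h where "h = (\<lambda>i s. of_real s * \<gamma> i (s\<^sup>2))"
  define h' where "h' = (\<lambda>i s. \<gamma> i (s\<^sup>2) + of_real (2 * s\<^sup>2) * \<gamma>' i (s\<^sup>2))"
  define h'' where "h'' = (\<lambda>i s. of_real (6 * s) * \<gamma>' i (s\<^sup>2) + of_real (4 * s ^ 3) * \<gamma>'' i (s\<^sup>2))"
  have sq: "((\<lambda>s. s\<^sup>2) has_real_derivative 2 * s) (at s)" for s :: real
    by (auto intro!: derivative_eq_intros)
  have chain: "((\<lambda>s. k i (s\<^sup>2)) has_vector_derivative of_real (2 * s) * k' i (s\<^sup>2)) (at s)"
    if "\<And>i v. i \<in> I \<Longrightarrow> v \<ge> 0 \<Longrightarrow> (k i has_vector_derivative k' i v) (at v)" "i \<in> I" for k k' :: "_ \<Rightarrow> real \<Rightarrow> complex" and i s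
    using vector_diff_chain_at[OF sq[of s, unfolded has_real_derivative_iff_has_vector_derivative] that(1)[OF that(2), of "s\<^sup>2"]]
    by (simp add: o_def scaleR_conv_of_real)
  have h: "(h i has_vector_derivative h' i s) (at s)" if "i \<in> I" for i s
  proof -
    have "(h i has_vector_derivative of_real s * (of_real (2 * s) * \<gamma>' i (s\<^sup>2)) + of_real 1 * \<gamma> i (s\<^sup>2)) (at s)"
      unfolding h_def by (intro has_vector_derivative_mult has_vector_derivative_of_real DERIV_ident chain \<gamma>' that)
    then show ?thesis by (simp add: h'_def power2_eq_square algebra_simps)
  qed
  have h': "(h' i has_vector_derivative h'' i s) (at s)" if "i \<in> I" for i s
  proof -
    have "((\<lambda>s::real. 2 * s\<^sup>2) has_real_derivative 4 * s) (at s)"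
      by (auto intro!: derivative_eq_intros)
    then have "(h' i has_vector_derivative of_real (2 * s) * \<gamma>' i (s\<^sup>2) +
       (of_real (2 * s\<^sup>2) * (of_real (2 * s) * \<gamma>'' i (s\<^sup>2)) + of_real (4 * s) * \<gamma>' i (s\<^sup>2))) (at s)"
      unfolding h'_def by (intro has_vector_derivative_add has_vector_derivative_mult has_vector_derivative_of_real chain \<gamma>' \<gamma>'' that)
    then show ?thesis by (simp add: h''_def power2_eq_square power3_eq_cube algebra_simps)
  qed
  have h_le: "norm (h i s) \<le> C0 / (1 + s\<^sup>2)" if "i \<in> I" "s \<ge> 0" for i s
  proof -
    have "norm (h i s) = s * norm (\<gamma> i (s\<^sup>2))" using that by (simp add: h_def norm_mult)
    also have "\<dots> \<le> (1 + s\<^sup>2) * (C0 / (1 + s\<^sup>2) ^ 2)"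
      using that C0(2)[of i "s\<^sup>2"] sum_squares_ge_zero[of "s - 1" 0] zero_le_power2[of "s - 1"]
      by (intro mult_mono) (auto simp: power2_eq_square algebra_simps)
    also have "\<dots> = C0 / (1 + s\<^sup>2)" using add_pos_nonneg[of 1 "s\<^sup>2"] by (simp add: power2_eq_square)
    finally show ?thesis .
  qed
  have h'_le: "norm (h' i s) \<le> (C0 + 2 * C1) / (1 + s\<^sup>2)" if "i \<in> I" for i s
  proof -
    have pos: "0 < 1 + s\<^sup>2" by (simp add: add_pos_nonneg)
    have "norm (h' i s) \<le> norm (\<gamma> i (s\<^sup>2)) + 2 * s\<^sup>2 * norm (\<gamma>' i (s\<^sup>2))"
      unfolding h'_def by (intro order_trans[OF norm_triangle_ineq]) (simp add: norm_mult norm_power)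
    also have "\<dots> \<le> C0 / (1 + s\<^sup>2) ^ 2 + 2 * (1 + s\<^sup>2) * (C1 / (1 + s\<^sup>2) ^ 2)"
      using that C0(2)[of i "s\<^sup>2"] C1(2)[of i "s\<^sup>2"] by (intro add_mono mult_mono) auto
    also have "\<dots> \<le> C0 / (1 + s\<^sup>2) + 2 * (1 + s\<^sup>2) * (C1 / (1 + s\<^sup>2) ^ 2)"
      using C0(1) by (intro add_right_mono frac_le) (auto simp: self_le_power pos)
    also have "\<dots> = (C0 + 2 * C1) / (1 + s\<^sup>2)"
    proof -
      have "C0 / q + 2 * q * (C1 / q ^ 2) = (C0 + 2 * C1) / q" if "q > 0" for q :: real
        using that by (simp add: field_simps power2_eq_square)
      then show ?thesis using pos by blast
    qed
    finally show ?thesis .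
  qed
  have h''_le: "norm (h'' i s) \<le> (6 * C1 + 4 * C2) / (1 + s\<^sup>2)" if "i \<in> I" "s \<ge> 0" for i s
  proof -
    have pos: "0 < 1 + s\<^sup>2" by (simp add: add_pos_nonneg)
    have s1: "s \<le> 1 + s\<^sup>2"
      using zero_le_power2[of "s - 1"] that by (simp add: power2_eq_square algebra_simps)
    have s3: "s ^ 3 \<le> (1 + s\<^sup>2) ^ 2"
    proof -
      have "s * s\<^sup>2 \<le> (1 + s\<^sup>2) * (1 + s\<^sup>2)" using s1 that by (intro mult_mono) auto
      then show ?thesis by (simp add: power2_eq_square power3_eq_cube)
    qed
    have "norm (h'' i s) \<le> 6 * s * norm (\<gamma>' i (s\<^sup>2)) + 4 * s ^ 3 * norm (\<gamma>'' i (s\<^sup>2))"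
      unfolding h''_def using that by (intro order_trans[OF norm_triangle_ineq]) (simp add: norm_mult norm_power)
    also have "\<dots> \<le> 6 * (1 + s\<^sup>2) * (C1 / (1 + s\<^sup>2) ^ 2) + 4 * (1 + s\<^sup>2) ^ 2 * (C2 / (1 + s\<^sup>2) ^ 3)"
      using that s1 s3 C1(2)[of i "s\<^sup>2"] C2(2)[of i "s\<^sup>2"] by (intro add_mono mult_mono) auto
    also have "\<dots> = (6 * C1 + 4 * C2) / (1 + s\<^sup>2)"
    proof -
      have "6 * q * (C1 / q ^ 2) + 4 * q ^ 2 * (C2 / q ^ 3) = (6 * C1 + 4 * C2) / q" if "q > 0" for q :: real
        using that by (simp add: field_simps power2_eq_square power3_eq_cube)
      then show ?thesis using pos by blast
    qed
    finally show ?thesis .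
  qed
  have h_cont: "continuous_on UNIV (h i)" if "i \<in> I" for i
    using h[OF that] by (intro continuous_at_imp_continuous_on ballI has_vector_derivative_continuous)
  have \<gamma>''_cont: "isCont (h'' i) s" if "i \<in> I" for i s
    unfolding h''_def using that
    by (intro continuous_intros isCont_o2[OF _ rapid_isCont[OF \<gamma>'(2)]] isCont_o2[OF _ rapid_isCont[OF \<gamma>''(2)]]) auto
  have h''_cont: "continuous_on UNIV (h'' i)" if "i \<in> I" for i
    using \<gamma>''_cont[OF that] by (intro continuous_at_imp_continuous_on) auto
  have meas: "(\<lambda>s. k s * complex_of_real (cos (b * s))) \<in> borel_measurable (leb_on {0..})"
    if "continuous_on UNIV k" for k and b :: real
    using that by (intro borel_measurable_leb_onI borel_measurable_continuous_onI continuous_intros)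
  have cos_le: "norm (z * complex_of_real (cos x)) \<le> norm z" for z x
    by (simp add: norm_mult mult_right_le_one_le)
  have h_int: "integrable (leb_on {0..}) (\<lambda>s. h i s * complex_of_real (cos (b * s)))"
      "norm (LINT s|leb_on {0..}. h i s * complex_of_real (cos (b * s))) \<le> C0 * J" if "i \<in> I" for i b
    unfolding J_def using integral_inverse_one_plus_square[OF meas[OF h_cont[OF that]] order_trans[OF cos_le h_le[OF that]]] by blast+
  have h''_int: "integrable (leb_on {0..}) (\<lambda>s. h'' i s * complex_of_real (cos (b * s)))"
      "norm (LINT s|leb_on {0..}. h'' i s * complex_of_real (cos (b * s))) \<le> (6 * C1 + 4 * C2) * J" if "i \<in> I" for i b
    unfolding J_def using integral_inverse_one_plus_square[OF meas[OF h''_cont[OF that]] order_trans[OF cos_le h''_le[OF that]]] by blast+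
  have parts: "of_real (b\<^sup>2) * (LINT s|leb_on {0..}. h i s * complex_of_real (cos (b * s))) =
      - h' i 0 - (LINT s|leb_on {0..}. h'' i s * complex_of_real (cos (b * s)))"
    if i: "i \<in> I" and b: "b > 0" for i b
  proof -
    define F where "F = (\<lambda>s. of_real b * (h i s * complex_of_real (sin (b * s))) + h' i s * complex_of_real (cos (b * s)))"
    define f where "f = (\<lambda>s. of_real (b\<^sup>2) * (h i s * complex_of_real (cos (b * s))) + h'' i s * complex_of_real (cos (b * s)))"
    have "(LINT s|leb_on {0<..}. f s) = - F 0"
    proof (rule integral_halfline_FTC)
      fix s :: real
      have "((\<lambda>s. sin (b * s)) has_real_derivative b * cos (b * s)) (at s)"
        "((\<lambda>s. cos (b * s)) has_real_derivative - b * sin (b * s)) (at s)"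
        by (auto intro!: derivative_eq_intros)
      then have "(F has_vector_derivative
         of_real b * (h i s * of_real (b * cos (b * s)) + h' i s * of_real (sin (b * s))) +
         (h' i s * of_real (- b * sin (b * s)) + h'' i s * of_real (cos (b * s)))) (at s)"
        unfolding F_def
        by (intro has_vector_derivative_add has_vector_derivative_mult_right has_vector_derivative_mult has_vector_derivative_of_real h h' i)
      also have "of_real b * (h i s * of_real (b * cos (b * s)) + h' i s * of_real (sin (b * s))) +
         (h' i s * of_real (- b * sin (b * s)) + h'' i s * of_real (cos (b * s))) = f s"
        by (simp add: f_def power2_eq_square algebra_simps)
      finally show "(F has_vector_derivative f s) (at s)" .
      show "isCont f s"
        unfolding f_def using h_cont[OF i] h''_cont[OF i]
        by (intro continuous_intros) (auto simp: continuous_on_eq_continuous_at)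
    next
      have int: "integrable (leb_on {0..}) f"
        unfolding f_def using h_int(1)[OF i] h''_int(1)[OF i] by (intro Bochner_Integration.integrable_add integrable_mult_right)
      show "integrable (leb_on {0<..}) f"
        using int by (subst leb_on_atLeast_eq_greaterThan(1)[symmetric]) auto
      have le: "norm (F s) \<le> (b * C0 + (C0 + 2 * C1)) * (1 / (1 + s\<^sup>2))" if s: "s \<ge> 0" for s
      proof -
        have "norm (F s) \<le> b * (norm (h i s) * \<bar>sin (b * s)\<bar>) + norm (h' i s) * \<bar>cos (b * s)\<bar>"
          unfolding F_def using b by (intro order_trans[OF norm_triangle_ineq]) (simp add: norm_mult)
        also have "\<dots> \<le> b * (C0 / (1 + s\<^sup>2) * 1) + (C0 + 2 * C1) / (1 + s\<^sup>2) * 1"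
          using h_le[OF i s] h'_le[OF i, of s] b C0(1) C1(1)
          by (intro add_mono mult_left_mono mult_mono) auto
        also have "\<dots> = (b * C0 + (C0 + 2 * C1)) * (1 / (1 + s\<^sup>2))" by (simp add: add_divide_distrib)
        finally show ?thesis .
      qed
      have "((\<lambda>s::real. (b * C0 + (C0 + 2 * C1)) * (1 / (1 + s\<^sup>2))) \<longlongrightarrow> (b * C0 + (C0 + 2 * C1)) * 0) at_top"
        by (intro tendsto_intros tendsto_divide_0[OF tendsto_const] filterlim_at_top_imp_at_infinity
              filterlim_tendsto_add_at_top[OF tendsto_const] filterlim_pow_at_top filterlim_ident) auto
      moreover have "eventually (\<lambda>s. norm (F s) \<le> (b * C0 + (C0 + 2 * C1)) * (1 / (1 + s\<^sup>2))) at_top"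
        by (rule eventually_mono[OF eventually_ge_at_top[of "0::real"] le])
      ultimately show "(F \<longlongrightarrow> 0) at_top"
        by (intro Lim_null_comparison[of F]) auto
    qed
    moreover have "(LINT s|leb_on {0..}. f s) = (LINT s|leb_on {0<..}. f s)"
      by (intro leb_on_atLeast_eq_greaterThan(2) borel_measurable_leb_onI borel_measurable_continuous_onI)
        (unfold f_def, intro continuous_intros h_cont[OF i] h''_cont[OF i])
    moreover have "(LINT s|leb_on {0..}. f s) =
       of_real (b\<^sup>2) * (LINT s|leb_on {0..}. h i s * complex_of_real (cos (b * s))) +
       (LINT s|leb_on {0..}. h'' i s * complex_of_real (cos (b * s)))"
      unfolding f_def using h_int(1)[OF i] h''_int(1)[OF i] by simp
    moreover have "F 0 = h' i 0" by (simp add: F_def)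
    ultimately show ?thesis by (simp add: eq_diff_eq)
  qed
  define D where "D = C0 * J + ((C0 + 2 * C1) + (6 * C1 + 4 * C2) * J)"
  show ?thesis
  proof (rule that[of D])
    show "0 \<le> D" using C0 C1 C2 J by (simp add: D_def)
    fix i and b :: real assume i: "i \<in> I" and b: "b \<ge> 0"
    let ?I = "LINT s|leb_on {0..}. h i s * complex_of_real (cos (b * s))"
    have "norm (of_real (b\<^sup>2) * ?I) \<le> (C0 + 2 * C1) + (6 * C1 + 4 * C2) * J"
    proof (cases "b = 0")
      case False
      then have "of_real (b\<^sup>2) * ?I = - h' i 0 - (LINT s|leb_on {0..}. h'' i s * complex_of_real (cos (b * s)))"
        using parts[OF i] b by simp
      then have "norm (of_real (b\<^sup>2) * ?I) \<le> norm (h' i 0) + norm (LINT s|leb_on {0..}. h'' i s * complex_of_real (cos (b * s)))"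
        by (metis norm_minus_cancel norm_triangle_ineq4)
      also have "\<dots> \<le> (C0 + 2 * C1) + (6 * C1 + 4 * C2) * J"
        using h'_le[OF i, of 0] h''_int(2)[OF i] by (intro add_mono) auto
      finally show ?thesis .
    qed (use C0 C1 C2 J in simp)
    then have "b\<^sup>2 * norm ?I \<le> (C0 + 2 * C1) + (6 * C1 + 4 * C2) * J" by (simp add: norm_mult norm_power)
    then have "norm ?I * (1 + b\<^sup>2) \<le> D"
      using h_int(2)[OF i, of b] by (simp add: D_def algebra_simps)
    then show "norm (LINT s|leb_on {0..}. (of_real s * \<gamma> i (s\<^sup>2)) * complex_of_real (cos (b * s))) \<le> D / (1 + b\<^sup>2)"
      using add_pos_nonneg[of 1 "b\<^sup>2"] by (simp add: pos_le_divide_eq h_def)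
  qed
qed


section \<open>Schwartz functions along lines\<close>

lemma pd_has_derivative:
  assumes "f differentiable (at z)"
  shows "(f has_derivative (\<lambda>v. of_real (fst v) * pd1 f z + of_real (snd v) * pd2 f z)) (at z)"
proof -
  have D: "(f has_derivative frechet_derivative f (at z)) (at z)"
    using assms by (simp add: frechet_derivative_works)
  then interpret bounded_linear "frechet_derivative f (at z)" by (rule has_derivative_bounded_linear)
  have "frechet_derivative f (at z) v = of_real (fst v) * pd1 f z + of_real (snd v) * pd2 f z" for v
  proof -
    have "v = fst v *\<^sub>R (1, 0) + snd v *\<^sub>R (0, 1)" by (simp add: prod_eq_iff)
    then have "frechet_derivative f (at z) v = frechet_derivative f (at z) (fst v *\<^sub>R (1, 0) + snd v *\<^sub>R (0, 1))"
      by (rule arg_cong)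
    then show ?thesis by (simp only: add scaleR scaleR_conv_of_real pd_def)
  qed
  then have "frechet_derivative f (at z) = (\<lambda>v. of_real (fst v) * pd1 f z + of_real (snd v) * pd2 f z)"
    by (rule ext)
  with D show ?thesis by simp
qed

lemma has_vector_derivative_along_line:
  assumes f: "\<And>z. f differentiable (at z)" and t: "(t has_real_derivative t') (at v)"
  shows "((\<lambda>v. f (p + t v *\<^sub>R e)) has_vector_derivative
    of_real t' * (of_real (fst e) * pd1 f (p + t v *\<^sub>R e) + of_real (snd e) * pd2 f (p + t v *\<^sub>R e))) (at v)"
proof -
  have "((\<lambda>v. p + t v *\<^sub>R e) has_derivative (\<lambda>h. (h * t') *\<^sub>R e)) (at v)"
    using t unfolding has_field_derivative_def
    by (auto intro!: derivative_eq_intros simp: mult.commute)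
  from has_derivative_compose[OF this pd_has_derivative[OF f]]
  show ?thesis
    unfolding has_vector_derivative_def
    by (simp add: scaleR_conv_of_real algebra_simps)
qed

lemma has_vector_derivative_pd2:
  assumes "\<And>z. f differentiable (at z)"
  shows "((\<lambda>y. f (x, y)) has_vector_derivative pd2 f (x, y)) (at y)"
  using has_vector_derivative_along_line[where f = f and t = "\<lambda>y. y" and t' = 1 and v = y and p = "(x, 0)" and e = "(0, 1)", OF assms]
  by simp

lemma has_vector_derivative_pd1:
  assumes "\<And>z. f differentiable (at z)"
  shows "((\<lambda>x. f (x, y)) has_vector_derivative pd1 f (x, y)) (at x)"
  using has_vector_derivative_along_line[where f = f and t = "\<lambda>x. x" and t' = 1 and v = x and p = "(0, y)" and e = "(1, 0)", OF assms]
  by simp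

lemma differentiable_continuous_on: "(\<And>z. f differentiable (at z)) \<Longrightarrow> continuous_on UNIV f"
  by (auto intro!: continuous_at_imp_continuous_on differentiable_imp_continuous_within)

text \<open>Differentiate \<open>f (x, Y) - f (x, y0) = \<integral> pd2 f (x, t) dt\<close> first in \<open>x\<close> under the integral
  sign and then in \<open>Y\<close>.\<close>

lemma mixed_partials_commute:
  assumes f: "\<And>z. f differentiable (at z)" and f1: "\<And>z. pd1 f differentiable (at z)"
    and f2: "\<And>z. pd2 f differentiable (at z)" and cont: "continuous_on UNIV (pd1 (pd2 f))"
  shows "pd2 (pd1 f) = pd1 (pd2 f)"
proof
  fix z :: "real \<times> real"
  obtain x y where z: "z = (x, y)" by (cases z)
  \<comment> \<open>Any base point below \<open>y\<close> serves.\<close>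
  define y0 where "y0 = y - 1"
  have line: "continuous_on A (\<lambda>t. h (x', t))" if "continuous_on UNIV h" for h :: "real \<times> real \<Rightarrow> complex" and x' and A :: "real set"
    by (rule continuous_on_compose2[OF that]) (auto intro!: continuous_intros)
  have FTC: "integral (cbox y0 Y) (\<lambda>t. pd2 f (x', t)) = f (x', Y) - f (x', y0)" if "y0 \<le> Y" for x' Y
    using fundamental_theorem_of_calculus[OF that, of "\<lambda>t. f (x', t)" "\<lambda>t. pd2 f (x', t)"]
      has_vector_derivative_pd2[OF f] by (auto intro: has_vector_derivative_at_within integral_unique)
  have key: "pd1 f (x, Y) - pd1 f (x, y0) = integral {y0..Y} (\<lambda>t. pd1 (pd2 f) (x, t))" if Y: "y0 \<le> Y" for Y
  proof -
    have "((\<lambda>x. integral (cbox y0 Y) (\<lambda>t. pd2 f (x, t))) has_vector_derivative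
        integral (cbox y0 Y) (\<lambda>t. pd1 (pd2 f) (x, t))) (at x within UNIV)"
    proof (rule leibniz_rule_vector_derivative)
      show "((\<lambda>x. pd2 f (x, t)) has_vector_derivative pd1 (pd2 f) (x', t)) (at x' within UNIV)" for x' t
        using has_vector_derivative_pd1[OF f2] by simp
      show "(\<lambda>t. pd2 f (x', t)) integrable_on cbox y0 Y" for x'
        by (intro integrable_continuous line differentiable_continuous_on f2)
      show "continuous_on (UNIV \<times> cbox y0 Y) (\<lambda>(x, t). pd1 (pd2 f) (x, t))"
        using continuous_on_subset[OF cont] by (simp add: case_prod_eta)
    qed auto
    moreover have "((\<lambda>x. integral (cbox y0 Y) (\<lambda>t. pd2 f (x, t))) has_vector_derivative
        pd1 f (x, Y) - pd1 f (x, y0)) (at x)"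
      unfolding FTC[OF Y] by (intro has_vector_derivative_diff has_vector_derivative_pd1 f)
    ultimately show ?thesis
      using vector_derivative_unique_at by fastforce
  qed
  have cont': "continuous_on {y0..y + 1} (\<lambda>t. pd1 (pd2 f) (x, t))" by (rule line[OF cont])
  have "((\<lambda>u. integral {y0..u} (\<lambda>t. pd1 (pd2 f) (x, t))) has_vector_derivative pd1 (pd2 f) (x, y)) (at y within {y0..y + 1})"
    by (rule integral_has_vector_derivative[OF cont']) (auto simp: y0_def)
  then have "((\<lambda>u. pd1 f (x, u) - pd1 f (x, y0)) has_vector_derivative pd1 (pd2 f) (x, y)) (at y within {y0..y + 1})"
  proof (rule has_vector_derivative_transform[rotated 2])
    show "y \<in> {y0..y + 1}" by (simp add: y0_def)
    show "pd1 f (x, u) - pd1 f (x, y0) = integral {y0..u} (\<lambda>t. pd1 (pd2 f) (x, t))" if "u \<in> {y0..y + 1}" for u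
      using key[of u] that by simp
  qed
  then have "((\<lambda>u. pd1 f (x, u) - pd1 f (x, y0)) has_vector_derivative pd1 (pd2 f) (x, y)) (at y)"
    by (subst (asm) at_within_Icc_at) (auto simp: y0_def)
  moreover have "((\<lambda>u. pd1 f (x, u) - pd1 f (x, y0)) has_vector_derivative pd2 (pd1 f) (x, y) - 0) (at y)"
    by (intro has_vector_derivative_diff has_vector_derivative_pd2 f1 has_vector_derivative_const)
  ultimately show "pd2 (pd1 f) z = pd1 (pd2 f) z"
    unfolding z using vector_derivative_unique_at by fastforce
qed

lemma Ck_pd:
  assumes "\<forall>k. Ck k f"
  shows "\<And>z. f differentiable (at z)" "\<forall>k. Ck k (pd1 f)" "\<forall>k. Ck k (pd2 f)" "continuous_on UNIV f"
  using assms Ck.simps(2)[of _ f] Ck.simps(1)[of f] by metis+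

lemma smooth_mixed_partials_commute:
  assumes "\<forall>k. Ck k f" shows "pd2 (pd1 f) = pd1 (pd2 f)"
  by (intro mixed_partials_commute Ck_pd assms)

lemma smooth_pd2_funpow: "\<forall>k. Ck k f \<Longrightarrow> \<forall>k. Ck k ((pd2 ^^ j) f)"
proof (induction j)
  case (Suc j)
  from Ck_pd(3)[OF Suc.IH[OF Suc.prems]] show ?case by simp
qed simp

lemma pd2_funpow_pd1: "\<forall>k. Ck k f \<Longrightarrow> (pd2 ^^ j) (pd1 f) = pd1 ((pd2 ^^ j) f)"
proof (induction j)
  case (Suc j)
  then show ?case
    using smooth_mixed_partials_commute[OF smooth_pd2_funpow[OF Suc.prems]] by simp
qed simp

text \<open>The seminorms apply the partial derivatives in one fixed order, so that stability under
  \<open>pd1\<close> rests on the symmetry of the mixed derivatives.\<close>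

lemma schwartz_pd1:
  assumes "schwartz f" shows "schwartz (pd1 f)"
proof -
  have f: "\<forall>k. Ck k f" using assms by (simp add: schwartz_def)
  have "(pd1 ^^ i) ((pd2 ^^ j) (pd1 f)) = (pd1 ^^ Suc i) ((pd2 ^^ j) f)" for i j
    unfolding pd2_funpow_pd1[OF f] by (simp add: funpow_swap1)
  then show ?thesis
    using assms Ck_pd(2)[OF f] unfolding schwartz_def by metis
qed

lemma schwartz_pd2:
  assumes "schwartz f" shows "schwartz (pd2 f)"
proof -
  have f: "\<forall>k. Ck k f" using assms by (simp add: schwartz_def)
  have "(pd1 ^^ i) ((pd2 ^^ j) (pd2 f)) = (pd1 ^^ i) ((pd2 ^^ Suc j) f)" for i j
    by (simp add: funpow_swap1)
  then show ?thesis
    using assms Ck_pd(3)[OF f] unfolding schwartz_def by metis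
qed

lemma schwartz_differentiable: "schwartz f \<Longrightarrow> f differentiable (at z)"
  by (simp add: schwartz_def Ck_pd)

lemma schwartz_continuous: "schwartz f \<Longrightarrow> continuous_on UNIV f"
  by (simp add: schwartz_def Ck_pd)

lemma schwartz_decay:
  assumes "schwartz f"
  obtains C where "C \<ge> 0" "\<And>z. norm (f z) * (1 + (norm z)\<^sup>2) ^ N \<le> C"
proof -
  have "\<exists>C. \<forall>x y. norm (f (x, y)) * (1 + x\<^sup>2 + y\<^sup>2) ^ N * \<bar>x ^ m * y ^ n\<bar> \<le> C" for m n
  proof (induction N arbitrary: m n)
    case 0
    have "bounded (range (\<lambda>(x, y). of_real (x ^ m * y ^ n) * (pd1 ^^ 0) ((pd2 ^^ 0) f) (x, y)))"
      using assms unfolding schwartz_def by blast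
    then obtain C where "\<And>x y. norm (of_real (x ^ m * y ^ n) * f (x, y)) \<le> C"
      unfolding bounded_iff by auto
    then show ?case by (intro exI[of _ C]) (simp add: norm_mult norm_power mult.commute abs_mult power_abs)
  next
    case (Suc N)
    obtain A where A: "\<And>x y. norm (f (x, y)) * (1 + x\<^sup>2 + y\<^sup>2) ^ N * \<bar>x ^ m * y ^ n\<bar> \<le> A"
      using Suc[of m n] by blast
    obtain B where B: "\<And>x y. norm (f (x, y)) * (1 + x\<^sup>2 + y\<^sup>2) ^ N * \<bar>x ^ (m + 2) * y ^ n\<bar> \<le> B"
      using Suc[of "m + 2" n] by blast
    obtain D where D: "\<And>x y. norm (f (x, y)) * (1 + x\<^sup>2 + y\<^sup>2) ^ N * \<bar>x ^ m * y ^ (n + 2)\<bar> \<le> D"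
      using Suc[of m "n + 2"] by blast
    show ?case
    proof (intro exI allI)
      fix x y :: real
      define q where "q = norm (f (x, y)) * (1 + x\<^sup>2 + y\<^sup>2) ^ N"
      have "\<bar>x ^ (m + 2) * y ^ n\<bar> = x\<^sup>2 * \<bar>x ^ m * y ^ n\<bar>" "\<bar>x ^ m * y ^ (n + 2)\<bar> = y\<^sup>2 * \<bar>x ^ m * y ^ n\<bar>"
        by (simp_all add: abs_mult power_add power2_eq_square)
      then have "norm (f (x, y)) * (1 + x\<^sup>2 + y\<^sup>2) ^ Suc N * \<bar>x ^ m * y ^ n\<bar> =
          q * \<bar>x ^ m * y ^ n\<bar> + q * \<bar>x ^ (m + 2) * y ^ n\<bar> + q * \<bar>x ^ m * y ^ (n + 2)\<bar>"
        unfolding q_def by (simp only: power_Suc) (simp add: algebra_simps)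
      also have "\<dots> \<le> A + B + D"
        using A[of x y] B[of x y] D[of x y] unfolding q_def by linarith
      finally show "norm (f (x, y)) * (1 + x\<^sup>2 + y\<^sup>2) ^ Suc N * \<bar>x ^ m * y ^ n\<bar> \<le> A + B + D" .
    qed
  qed
  from this[of 0 0] obtain C where C: "\<And>x y. norm (f (x, y)) * (1 + x\<^sup>2 + y\<^sup>2) ^ N \<le> C" by auto
  have le: "norm (f z) * (1 + (norm z)\<^sup>2) ^ N \<le> C" for z
    using C[of "fst z" "snd z"] by (simp add: norm_prod_def add.assoc)
  have "0 \<le> norm (f 0) * (1 + (norm (0 :: real \<times> real))\<^sup>2) ^ N" by simp
  also have "\<dots> \<le> C" by (rule le)
  finally show ?thesis using that le by blast
qed

lemma schwartz_bounded:
  assumes "schwartz f" obtains C where "C \<ge> 0" "\<And>z. norm (f z) \<le> C"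
  using schwartz_decay[OF assms, of 0] by auto

lemma schwartz_lipschitz:
  assumes "schwartz f"
  obtains K where "K \<ge> 0" "\<And>z z'. norm (f z - f z') \<le> K * norm (z - z')"
proof -
  obtain A where A: "A \<ge> 0" "\<And>z. norm (pd1 f z) \<le> A" using schwartz_bounded[OF schwartz_pd1[OF assms]] by blast
  obtain B where B: "B \<ge> 0" "\<And>z. norm (pd2 f z) \<le> B" using schwartz_bounded[OF schwartz_pd2[OF assms]] by blast
  show ?thesis
  proof (rule that)
    show "A + B \<ge> 0" using A B by simp
    fix z z'
    show "norm (f z - f z') \<le> (A + B) * norm (z - z')"
    proof (rule differentiable_bound)
      show "convex (UNIV :: (real \<times> real) set)" by simp
      show "(f has_derivative (\<lambda>v. of_real (fst v) * pd1 f w + of_real (snd v) * pd2 f w)) (at w within UNIV)" for w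
        using pd_has_derivative[OF schwartz_differentiable[OF assms]] by simp
      show "onorm (\<lambda>v. of_real (fst v) * pd1 f w + of_real (snd v) * pd2 f w) \<le> A + B" for w
      proof (rule onorm_bound)
        show "norm (of_real (fst v) * pd1 f w + of_real (snd v) * pd2 f w) \<le> (A + B) * norm v" for v :: "real \<times> real"
        proof -
          have "norm (of_real (fst v) * pd1 f w + of_real (snd v) * pd2 f w) \<le> \<bar>fst v\<bar> * norm (pd1 f w) + \<bar>snd v\<bar> * norm (pd2 f w)"
            by (intro order_trans[OF norm_triangle_ineq]) (simp add: norm_mult)
          also have "\<dots> \<le> norm v * A + norm v * B"
            using A B norm_fst_le[of "fst v" "snd v"] norm_snd_le[of "snd v" "fst v"] by (intro add_mono mult_mono) auto
          finally show ?thesis by (simp add: algebra_simps)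
        qed
      qed (use A B in simp)
    qed auto
  qed
qed

text \<open>The derivative is a combination of functions of the same shape with larger exponents \<open>\<alpha>\<close>;
  this closure under differentiation is the reason for carrying the power of \<open>v + \<rho>\<^sup>2\<close> along.\<close>

lemma has_vector_derivative_along_sqrt:
  assumes f: "schwartz f" and \<rho>: "\<rho> > 0" and v: "v \<ge> 0"
  shows "((\<lambda>v. of_real ((v + \<rho>\<^sup>2) powr - \<alpha>) * f (p + sqrt (v + \<rho>\<^sup>2) *\<^sub>R e)) has_vector_derivative
     (of_real (fst e / 2) * (of_real ((v + \<rho>\<^sup>2) powr - (\<alpha> + 1/2)) * pd1 f (p + sqrt (v + \<rho>\<^sup>2) *\<^sub>R e)) +
      of_real (snd e / 2) * (of_real ((v + \<rho>\<^sup>2) powr - (\<alpha> + 1/2)) * pd2 f (p + sqrt (v + \<rho>\<^sup>2) *\<^sub>R e))) +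
      of_real (- \<alpha>) * (of_real ((v + \<rho>\<^sup>2) powr - (\<alpha> + 1)) * f (p + sqrt (v + \<rho>\<^sup>2) *\<^sub>R e))) (at v)"
proof -
  define u where "u = v + \<rho>\<^sup>2"
  have u: "u > 0" using \<rho> v by (simp add: u_def add_nonneg_pos)
  have 1: "((\<lambda>v. (v + \<rho>\<^sup>2) powr - \<alpha>) has_real_derivative - \<alpha> * u powr - (\<alpha> + 1)) (at v)"
  proof -
    have "((\<lambda>v. (v + \<rho>\<^sup>2) powr - \<alpha>) has_real_derivative (- \<alpha> * u powr (- \<alpha> - 1)) * 1) (at v)"
      using has_real_derivative_powr[OF u, of "- \<alpha>"] unfolding u_def
      by (rule DERIV_chain2) (auto intro!: derivative_eq_intros)
    then show ?thesis by simp
  qed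
  have 2: "((\<lambda>v. sqrt (v + \<rho>\<^sup>2)) has_real_derivative u powr - (1/2) / 2) (at v)"
  proof -
    have "((\<lambda>v. sqrt (v + \<rho>\<^sup>2)) has_real_derivative inverse (sqrt u) / 2 * 1) (at v)"
      using DERIV_real_sqrt[OF u] unfolding u_def
      by (rule DERIV_chain2) (auto intro!: derivative_eq_intros)
    moreover have "inverse (sqrt u) = u powr - (1/2)"
      using u by (simp add: powr_minus powr_half_sqrt)
    ultimately show ?thesis by simp
  qed
  have split: "u powr - (\<alpha> + 1/2) = u powr - \<alpha> * u powr - (1/2)"
    by (simp add: powr_add [symmetric])
  show ?thesis
    using has_vector_derivative_mult[OF has_vector_derivative_of_real[OF 1]
        has_vector_derivative_along_line[where f = f and p = p and e = e, OF schwartz_differentiable[OF f] 2]]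
    unfolding u_def[symmetric] split by (rule has_vector_derivative_eq_rhs) (simp add: algebra_simps)
qed

text \<open>For base points in a bounded set, \<open>1 + v\<close> is at most a constant times \<open>1 + (norm z)\<^sup>2\<close>,
  where \<open>z\<close> is the point \<open>p + sqrt (v + \<rho>\<^sup>2) *\<^sub>R e\<close>.\<close>

lemma schwartz_along_sqrt_bound:
  fixes N :: nat
  assumes f: "schwartz f" and \<rho>: "\<rho> > 0" and \<alpha>: "\<alpha> \<ge> 0"
    and I: "\<And>i. i \<in> I \<Longrightarrow> norm (p i) \<le> P" "\<And>i. i \<in> I \<Longrightarrow> norm (e i) = 1"
  shows "\<exists>C. \<forall>i\<in>I. \<forall>v\<ge>0. norm (of_real ((v + \<rho>\<^sup>2) powr - \<alpha>) * f (p i + sqrt (v + \<rho>\<^sup>2) *\<^sub>R e i)) * (1 + v) ^ N \<le> C"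
proof -
  obtain C where C: "C \<ge> 0" "\<And>z. norm (f z) * (1 + (norm z)\<^sup>2) ^ N \<le> C" using schwartz_decay[OF f, of N] by blast
  define K where "K = (2 + 2 * P\<^sup>2) ^ N"
  have "norm (of_real ((v + \<rho>\<^sup>2) powr - \<alpha>) * f (p i + sqrt (v + \<rho>\<^sup>2) *\<^sub>R e i)) * (1 + v) ^ N \<le> (\<rho>\<^sup>2) powr - \<alpha> * (C * K)"
    if i: "i \<in> I" and v: "v \<ge> 0" for i v
  proof -
    define t where "t = sqrt (v + \<rho>\<^sup>2)"
    define z where "z = p i + t *\<^sub>R e i"
    have t: "t \<ge> 0" "t\<^sup>2 = v + \<rho>\<^sup>2" using v by (simp_all add: t_def)
    have "norm (t *\<^sub>R e i) \<le> norm z + norm (p i)"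
      unfolding z_def by (metis add_diff_cancel_left' norm_triangle_ineq4)
    then have "t \<le> norm z + P" using I[OF i] t by simp
    then have "t\<^sup>2 \<le> (norm z + P)\<^sup>2" using t by (intro power_mono) auto
    also have "\<dots> \<le> 2 * (norm z)\<^sup>2 + 2 * P\<^sup>2"
      using zero_le_power2[of "norm z - P"] by (simp add: power2_eq_square algebra_simps)
    finally have "1 + v \<le> 1 + 2 * (norm z)\<^sup>2 + 2 * P\<^sup>2"
      using t \<rho> zero_le_power2[of \<rho>] by linarith
    also have "\<dots> \<le> (2 + 2 * P\<^sup>2) * (1 + (norm z)\<^sup>2)"
      by (simp add: algebra_simps)
    finally have "(1 + v) ^ N \<le> ((2 + 2 * P\<^sup>2) * (1 + (norm z)\<^sup>2)) ^ N"
      using v by (intro power_mono) auto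
    then have v_le: "(1 + v) ^ N \<le> K * (1 + (norm z)\<^sup>2) ^ N" by (simp add: K_def power_mult_distrib)
    have pw: "(v + \<rho>\<^sup>2) powr - \<alpha> \<le> (\<rho>\<^sup>2) powr - \<alpha>"
      using v \<rho> \<alpha> by (intro powr_mono2') auto
    have "norm (f z) * (1 + v) ^ N \<le> norm (f z) * (K * (1 + (norm z)\<^sup>2) ^ N)"
      by (intro mult_left_mono v_le) auto
    also have "\<dots> = K * (norm (f z) * (1 + (norm z)\<^sup>2) ^ N)" by simp
    also have "\<dots> \<le> K * C" by (intro mult_left_mono C) (simp add: K_def)
    finally have le: "norm (f z) * (1 + v) ^ N \<le> K * C" .
    have "(v + \<rho>\<^sup>2) powr - \<alpha> * (norm (f z) * (1 + v) ^ N) \<le> (\<rho>\<^sup>2) powr - \<alpha> * (K * C)"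
      by (rule mult_mono[OF pw le]) (use v in auto)
    then show ?thesis by (simp add: norm_mult z_def t_def mult_ac)
  qed
  then show ?thesis by blast
qed

lemma rapid_along_lines:
  assumes \<rho>: "\<rho> > 0" and I: "\<And>i. i \<in> I \<Longrightarrow> norm (p i) \<le> P" "\<And>i. i \<in> I \<Longrightarrow> norm (e i) = 1"
  shows "schwartz f \<Longrightarrow> \<alpha> \<ge> 0 \<Longrightarrow> rapid n I (\<lambda>i v. of_real ((v + \<rho>\<^sup>2) powr - \<alpha>) * f (p i + sqrt (v + \<rho>\<^sup>2) *\<^sub>R e i))"
proof (induction n arbitrary: f \<alpha>)
  case 0
  show ?case
    unfolding rapid.simps
  proof (intro conjI allI ballI impI)
    show "\<exists>C. \<forall>i\<in>I. \<forall>v\<ge>0. norm (of_real ((v + \<rho>\<^sup>2) powr - \<alpha>) * f (p i + sqrt (v + \<rho>\<^sup>2) *\<^sub>R e i)) * (1 + v) ^ N \<le> C" for N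
      by (rule schwartz_along_sqrt_bound[OF 0(1) \<rho> 0(2) I])
    show "isCont (\<lambda>v. of_real ((v + \<rho>\<^sup>2) powr - \<alpha>) * f (p i + sqrt (v + \<rho>\<^sup>2) *\<^sub>R e i)) v" if "v \<ge> 0" for i v
      by (rule has_vector_derivative_continuous[OF has_vector_derivative_along_sqrt[OF 0(1) \<rho> that]])
  qed
next
  case (Suc n)
  have r0: "rapid 0 I (\<lambda>i v. of_real ((v + \<rho>\<^sup>2) powr - \<alpha>) * f (p i + sqrt (v + \<rho>\<^sup>2) *\<^sub>R e i))"
    by (rule rapid_imp_0[OF Suc.IH[OF Suc.prems]])
  have e: "norm (complex_of_real (fst (e i) / 2)) \<le> 1" "norm (complex_of_real (snd (e i) / 2)) \<le> 1" if "i \<in> I" for i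
    using norm_fst_le[of "fst (e i)" "snd (e i)"] norm_snd_le[of "snd (e i)" "fst (e i)"] I(2)[OF that] by (auto simp: norm_divide)
  have \<alpha>': "\<alpha> + 1/2 \<ge> 0" "\<alpha> + 1 \<ge> 0" using Suc.prems by auto
  have rn: "rapid n I (\<lambda>i v.
     (of_real (fst (e i) / 2) * (of_real ((v + \<rho>\<^sup>2) powr - (\<alpha> + 1/2)) * pd1 f (p i + sqrt (v + \<rho>\<^sup>2) *\<^sub>R e i)) +
      of_real (snd (e i) / 2) * (of_real ((v + \<rho>\<^sup>2) powr - (\<alpha> + 1/2)) * pd2 f (p i + sqrt (v + \<rho>\<^sup>2) *\<^sub>R e i))) +
      of_real (- \<alpha>) * (of_real ((v + \<rho>\<^sup>2) powr - (\<alpha> + 1)) * f (p i + sqrt (v + \<rho>\<^sup>2) *\<^sub>R e i)))"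
    by (rule rapid_add[OF rapid_add[OF
          rapid_scale[OF e(1) Suc.IH[OF schwartz_pd1[OF Suc.prems(1)] \<alpha>'(1)]]
          rapid_scale[OF e(2) Suc.IH[OF schwartz_pd2[OF Suc.prems(1)] \<alpha>'(1)]]]
          rapid_scale[where K = "norm (complex_of_real (- \<alpha>))", OF order_refl Suc.IH[OF Suc.prems(1) \<alpha>'(2)]]])
  show ?case
  proof (rule rapid_SucI[OF r0 _ rn])
    fix i and v :: real assume "v \<ge> 0"
    then show "((\<lambda>v. of_real ((v + \<rho>\<^sup>2) powr - \<alpha>) * f (p i + sqrt (v + \<rho>\<^sup>2) *\<^sub>R e i)) has_vector_derivative
     (of_real (fst (e i) / 2) * (of_real ((v + \<rho>\<^sup>2) powr - (\<alpha> + 1/2)) * pd1 f (p i + sqrt (v + \<rho>\<^sup>2) *\<^sub>R e i)) +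
      of_real (snd (e i) / 2) * (of_real ((v + \<rho>\<^sup>2) powr - (\<alpha> + 1/2)) * pd2 f (p i + sqrt (v + \<rho>\<^sup>2) *\<^sub>R e i))) +
      of_real (- \<alpha>) * (of_real ((v + \<rho>\<^sup>2) powr - (\<alpha> + 1)) * f (p i + sqrt (v + \<rho>\<^sup>2) *\<^sub>R e i))) (at v)"
      by (rule has_vector_derivative_along_sqrt[OF Suc.prems(1) \<rho>])
  qed
qed


section \<open>Pointwise convergence of cosine series\<close>

text \<open>Translation by \<open>\<delta> n\<close>, half a period, changes the sign of the sine. Twice the integral is
  thus the integral of \<open>q t - q (\<delta> n + t)\<close> against the sine, and tends to zero by dominated
  convergence.\<close>

lemma riemann_lebesgue:
  fixes q :: "real \<Rightarrow> complex"
  assumes [measurable]: "q \<in> borel_measurable borel" and bd: "\<And>t. norm (q t) \<le> C"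
    and supp: "\<And>t. \<bar>t\<bar> > A \<Longrightarrow> q t = 0" and cont: "AE t in lborel. isCont q t"
    and \<delta>: "\<And>n. \<delta> n > 0" "\<delta> \<longlonglongrightarrow> 0"
  shows "(\<lambda>n. LINT t|lborel. q t * complex_of_real (sin (pi * (t - c) / \<delta> n))) \<longlonglongrightarrow> 0"
proof -
  obtain B where B: "\<And>n. \<bar>\<delta> n\<bar> \<le> B"
    using convergent_imp_Bseq[of \<delta>] \<delta>(2) by (auto simp: convergent_def Bseq_def)
  have B0: "B \<ge> 0" using B[of 0] by simp
  have C: "C \<ge> 0" using bd[of 0] order_trans[OF norm_ge_zero] by blast
  have ind: "integrable lborel (\<lambda>t. D * indicator {a..b} t)" for D a b :: real
    by (intro integrable_mult_right integrable_real_indicator) (auto simp: emeasure_lborel_Icc_eq)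
  have q_int: "integrable lborel q"
  proof (rule Bochner_Integration.integrable_bound[OF ind[of C "-A" A]])
    show "AE t in lborel. norm (q t) \<le> norm (C * indicator {- A..A} t :: real)"
      using bd supp C by (intro AE_I2) (auto simp: indicator_def abs_le_iff not_le)
  qed simp
  have q_int': "integrable lborel (\<lambda>t. q (d + t))" for d
    using lborel_integrable_real_affine[OF q_int, of 1 d] by simp
  have mul_int: "integrable lborel (\<lambda>t. p t * complex_of_real (sin (r t)))"
    if "integrable lborel p" "r \<in> borel_measurable borel" for p :: "real \<Rightarrow> complex" and r
  proof (rule Bochner_Integration.integrable_bound[OF that(1)])
    show "AE t in lborel. norm (p t * complex_of_real (sin (r t))) \<le> norm (p t)"
      by (intro AE_I2) (simp add: norm_mult mult_right_le_one_le)
    show "(\<lambda>t. p t * complex_of_real (sin (r t))) \<in> borel_measurable lborel"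
      using that by measurable
  qed
  define I where "I = (\<lambda>n. LINT t|lborel. q t * complex_of_real (sin (pi * (t - c) / \<delta> n)))"
  define J where "J = (\<lambda>n. LINT t|lborel. norm (q t - q (\<delta> n + t)))"
  have le: "norm (I n) \<le> J n" for n
  proof -
    let ?s = "\<lambda>t. complex_of_real (sin (pi * (t - c) / \<delta> n))"
    have "I n = (LINT t|lborel. q (\<delta> n + 1 * t) * complex_of_real (sin (pi * (\<delta> n + 1 * t - c) / \<delta> n)))"
      unfolding I_def by (subst lborel_integral_real_affine[of 1 _ "\<delta> n"]) simp_all
    also have "\<dots> = (LINT t|lborel. - (q (\<delta> n + t) * ?s t))"
    proof (intro Bochner_Integration.integral_cong refl)
      fix t
      have "pi * (\<delta> n + 1 * t - c) / \<delta> n = pi * (t - c) / \<delta> n + pi"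
        using \<delta>(1)[of n] by (simp add: field_simps)
      then have "sin (pi * (\<delta> n + 1 * t - c) / \<delta> n) = - sin (pi * (t - c) / \<delta> n)"
        by (simp only: sin_periodic_pi)
      then show "q (\<delta> n + 1 * t) * complex_of_real (sin (pi * (\<delta> n + 1 * t - c) / \<delta> n)) = - (q (\<delta> n + t) * ?s t)"
        by (simp only: of_real_minus mult_1 mult_minus_right)
    qed
    also have "\<dots> = - (LINT t|lborel. q (\<delta> n + t) * ?s t)" by simp
    finally have *: "I n = - (LINT t|lborel. q (\<delta> n + t) * ?s t)" .
    have i1: "integrable lborel (\<lambda>t. q t * ?s t)" and i2: "integrable lborel (\<lambda>t. q (\<delta> n + t) * ?s t)"
      by (rule mul_int; (intro q_int q_int' | measurable))+
    have "2 * I n = (LINT t|lborel. q t * ?s t) - (LINT t|lborel. q (\<delta> n + t) * ?s t)"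
      using * by (simp add: I_def)
    also have "\<dots> = (LINT t|lborel. q t * ?s t - q (\<delta> n + t) * ?s t)"
      using i1 i2 by simp
    finally have "norm (2 * I n) \<le> (LINT t|lborel. norm (q t * ?s t - q (\<delta> n + t) * ?s t))"
      by (simp only: integral_norm_bound)
    also have "\<dots> \<le> J n"
      unfolding J_def
    proof (rule integral_mono)
      show "integrable lborel (\<lambda>t. norm (q t * ?s t - q (\<delta> n + t) * ?s t))" using i1 i2 by auto
      show "integrable lborel (\<lambda>t. norm (q t - q (\<delta> n + t)))" using q_int q_int' by auto
      show "norm (q t * ?s t - q (\<delta> n + t) * ?s t) \<le> norm (q t - q (\<delta> n + t))" for t
        by (simp only: left_diff_distrib[symmetric] norm_mult) (simp add: mult_right_le_one_le)
    qed
    finally have "2 * norm (I n) \<le> J n" by (simp add: norm_mult)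
    then show ?thesis using norm_ge_zero[of "I n"] by linarith
  qed
  have "J \<longlonglongrightarrow> (LINT t|(lborel :: real measure). (0::real))"
    unfolding J_def
  proof (rule integral_dominated_convergence[where w = "\<lambda>t. 2 * C * indicator {- A - B..A} t"])
    show "integrable lborel (\<lambda>t. 2 * C * indicator {- A - B..A} t)" by (rule ind)
    show "AE t in lborel. (\<lambda>n. norm (q t - q (\<delta> n + t))) \<longlonglongrightarrow> 0"
      using cont
    proof eventually_elim
      fix t assume "isCont q t"
      moreover have "(\<lambda>n. \<delta> n + t) \<longlonglongrightarrow> 0 + t" by (intro tendsto_intros \<delta>)
      ultimately have "(\<lambda>n. q (\<delta> n + t)) \<longlonglongrightarrow> q t" using isCont_tendsto_compose by fastforce
      then have "(\<lambda>n. norm (q t - q (\<delta> n + t))) \<longlonglongrightarrow> norm (q t - q t)" by (intro tendsto_intros)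
      then show "(\<lambda>n. norm (q t - q (\<delta> n + t))) \<longlonglongrightarrow> 0" by simp
    qed
    show "AE t in lborel. norm (norm (q t - q (\<delta> n + t))) \<le> 2 * C * indicator {- A - B..A} t" for n
    proof (rule AE_I2)
      fix t
      show "norm (norm (q t - q (\<delta> n + t))) \<le> 2 * C * indicator {- A - B..A} t"
      proof (cases "t \<in> {- A - B..A}")
        case True
        have "norm (q t - q (\<delta> n + t)) \<le> C + C"
          by (intro order_trans[OF norm_triangle_ineq4] add_mono bd)
        then show ?thesis using True by simp
      next
        case False
        then have "\<bar>t\<bar> > A" "\<bar>\<delta> n + t\<bar> > A" using B[of n] B0 \<delta>(1)[of n] by auto
        then show ?thesis using False supp by simp
      qed
    qed
  qed measurable
  then have "J \<longlonglongrightarrow> 0" by simp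
  then show ?thesis
    using le unfolding I_def[symmetric] by (intro Lim_null_comparison[of I J]) auto
qed

text \<open>The sum telescopes after multiplication by \<open>sin (\<theta> / 2)\<close>.\<close>

lemma dirichlet_kernel:
  "sin (\<theta> / 2) * (\<Sum>l\<le>N. neumann l * cos (real l * \<theta>)) = sin ((real N + 1/2) * \<theta>)"
proof (induction N)
  case 0
  then show ?case by (simp add: neumann_def)
next
  case (Suc N)
  have "sin (\<theta> / 2) * (2 * cos (real (Suc N) * \<theta>)) = sin ((real (Suc N) + 1/2) * \<theta>) - sin ((real N + 1/2) * \<theta>)"
  proof -
    define x where "x = real (Suc N) * \<theta>"
    have "(real (Suc N) + 1/2) * \<theta> = x + \<theta> / 2" "(real N + 1/2) * \<theta> = x - \<theta> / 2"
      by (simp_all add: x_def algebra_simps)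
    then show ?thesis unfolding x_def[symmetric] by (simp add: sin_add sin_diff)
  qed
  with Suc show ?case by (simp add: neumann_def distrib_left)
qed

text \<open>The function \<open>sinc\<close> has no zero on \<open>{- a..a}\<close>, and by compactness its modulus has a positive
  minimum there.\<close>

lemma abs_sin_ge_linear:
  assumes "a < pi" obtains m where "m > 0" "\<And>x. \<bar>x\<bar> \<le> a \<Longrightarrow> m * \<bar>x\<bar> \<le> \<bar>sin x\<bar>"
proof (cases "a \<ge> 0")
  case True
  have "\<exists>x\<in>{-a..a}. \<forall>y\<in>{-a..a}. \<bar>sinc x\<bar> \<le> \<bar>sinc y\<bar>"
    by (rule continuous_attains_inf) (use True in \<open>auto intro!: continuous_intros\<close>)
  then obtain x where x: "x \<in> {-a..a}" "\<And>y. y \<in> {-a..a} \<Longrightarrow> \<bar>sinc x\<bar> \<le> \<bar>sinc y\<bar>" by blast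
  have "sinc x \<noteq> 0"
  proof (cases "x = 0")
    case False
    then have "sin \<bar>x\<bar> > 0" using x assms by (intro sin_gt_zero) auto
    then show ?thesis using False by (auto simp: abs_if split: if_splits)
  qed simp
  moreover have "\<bar>sinc x\<bar> * \<bar>y\<bar> \<le> \<bar>sin y\<bar>" if "\<bar>y\<bar> \<le> a" for y
    using x(2)[of y] that by (cases "y = 0") (auto simp: abs_le_iff abs_divide pos_le_divide_eq)
  ultimately show ?thesis using that[of "\<bar>sinc x\<bar>"] by simp
qed (auto intro!: that[of 1])

text \<open>For the even extension of \<open>h\<close>, the partial sum minus \<open>h s0\<close> is an integral of the difference
  \<open>h \<bar>t\<bar> - h s0\<close> against the Dirichlet kernel. The Lipschitz condition at \<open>s0\<close> makes the quotient
  \<open>q\<close> of this difference by \<open>sin (\<theta> t / 2)\<close> bounded, and the lemma of Riemann and Lebesgue applies.\<close>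

lemma fourier_cosine_series:
  fixes h :: "real \<Rightarrow> complex"
  assumes R: "R > 0" and s0: "0 < s0" "s0 < R" and cont: "continuous_on {0..R} h"
    and lip: "\<And>s. s \<in> {0..R} \<Longrightarrow> norm (h s - h s0) \<le> K * \<bar>s - s0\<bar>"
  shows "(\<lambda>l. of_real (neumann l / R * cos (real l * (pi / R) * s0)) *
      (LINT s|leb_on {0<..<R}. of_real (cos (real l * (pi / R) * s)) * h s)) sums h s0"
proof -
  define ind where "ind = (indicator {-R..R} :: real \<Rightarrow> real)"
  \<comment> \<open>The even extension of \<open>h\<close> to \<open>{- R..R}\<close>.\<close>
  define E where "E = (\<lambda>t. ind t *\<^sub>R h \<bar>t\<bar>)"
  have h_cont: "continuous_on {-R..R} (\<lambda>t. h \<bar>t\<bar>)"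
    by (rule continuous_on_compose2[OF cont]) (auto intro!: continuous_intros)
  have E_meas [measurable]: "E \<in> borel_measurable borel"
    unfolding E_def ind_def by (rule borel_measurable_continuous_on_indicator[OF _ h_cont]) simp
  have [measurable]: "ind \<in> borel_measurable borel" unfolding ind_def by simp
  obtain D where D: "\<And>s. s \<in> {0..R} \<Longrightarrow> norm (h s) \<le> D"
    using compact_imp_bounded[OF compact_continuous_image[OF cont compact_Icc]] unfolding bounded_iff by blast
  have D0: "D \<ge> 0" using order_trans[OF norm_ge_zero D[of 0]] R by simp
  have ind_int: "integrable lborel ind"
    unfolding ind_def by (rule integrable_real_indicator) (auto simp: emeasure_lborel_Icc_eq)
  have E_le: "norm (E t) \<le> D * ind t" for t
    using D[of "\<bar>t\<bar>"] by (auto simp: E_def ind_def indicator_def)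
  have int: "integrable lborel (\<lambda>t. complex_of_real (k t) * E t)" if "k \<in> borel_measurable borel" "\<And>t. \<bar>k t\<bar> \<le> B" for k B
  proof (rule Bochner_Integration.integrable_bound)
    show "integrable lborel (\<lambda>t. B * (D * ind t))" using ind_int by simp
    have B: "0 \<le> B" using that(2)[of 0] by simp
    have "norm (complex_of_real (k t) * E t) \<le> B * (D * ind t)" for t
      unfolding norm_mult norm_of_real by (rule mult_mono[OF that(2) E_le B]) simp
    then show "AE t in lborel. norm (complex_of_real (k t) * E t) \<le> norm (B * (D * ind t))"
      by (intro AE_I2) (simp add: order_trans[OF _ abs_ge_self])
  qed (use that(1) in measurable)
  have half: "has_bochner_integral lborel (\<lambda>t. indicator {0..} t *\<^sub>R (complex_of_real (k t) * E t))
      (LINT s|leb_on {0<..<R}. of_real (k s) * h s)" if k: "k \<in> borel_measurable borel" "\<And>t. \<bar>k t\<bar> \<le> 1" for k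
  proof -
    have i: "integrable lborel (\<lambda>t. indicator {0..} t *\<^sub>R (complex_of_real (k t) * E t))"
      using int[OF k] by (rule integrable_mult_indicator[rotated]) simp
    have [measurable]: "k \<in> borel_measurable borel" by (rule k)
    have eq: "indicator {0<..<R} t *\<^sub>R (complex_of_real (k t) * h t) = indicator {0<..<R} t *\<^sub>R (complex_of_real (k t) * E t)" for t
      by (auto simp: E_def ind_def indicator_def)
    have "(LINT t|lborel. indicator {0..} t *\<^sub>R (complex_of_real (k t) * E t)) =
        (LINT t|lborel. indicator {0<..<R} t *\<^sub>R (complex_of_real (k t) * E t))"
    proof (rule integral_cong_AE)
      show "AE t in lborel. indicator {0..} t *\<^sub>R (complex_of_real (k t) * E t) =
          indicator {0<..<R} t *\<^sub>R (complex_of_real (k t) * E t)"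
        using AE_lborel_singleton[of 0] AE_lborel_singleton[of R]
        by eventually_elim (auto simp: E_def ind_def indicator_def)
    qed measurable
    also have "\<dots> = (LINT s|leb_on {0<..<R}. of_real (k s) * h s)"
      unfolding eq[symmetric] by (simp add: integral_restrict_space)
    finally show ?thesis using i by (simp add: has_bochner_integral_iff)
  qed
  define \<mu> where "\<mu> = (\<lambda>l. real l * (pi / R))"
  define Cf where "Cf = (\<lambda>l. LINT s|leb_on {0<..<R}. of_real (cos (\<mu> l * s)) * h s)"
  have E_minus: "E (- t) = E t" for t
    by (auto simp: E_def ind_def indicator_def)
  have even: "(LINT t|lborel. complex_of_real (cos (\<mu> l * t)) * E t) = 2 * Cf l" for l
  proof -
    have "has_bochner_integral lborel (\<lambda>t. complex_of_real (cos (\<mu> l * t)) * E t) (2 *\<^sub>R Cf l)"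
      unfolding Cf_def by (rule has_bochner_integral_even_function[OF half]) (auto simp: E_minus)
    then show ?thesis by (simp add: has_bochner_integral_iff scaleR_conv_of_real)
  qed
  have odd: "(LINT t|lborel. complex_of_real (sin (\<mu> l * t)) * E t) = 0" for l
  proof -
    have "has_bochner_integral lborel (\<lambda>t. complex_of_real (sin (\<mu> l * t)) * E t) 0"
      by (rule has_bochner_integral_odd_function[OF half]) (auto simp: E_minus)
    then show ?thesis by (simp add: has_bochner_integral_iff)
  qed
  define \<theta> where "\<theta> = (\<lambda>t. pi / R * (t - s0))"
  have shift: "cos (real l * \<theta> t) = cos (\<mu> l * s0) * cos (\<mu> l * t) + sin (\<mu> l * s0) * sin (\<mu> l * t)" for l t
  proof -
    have "real l * \<theta> t = \<mu> l * t - \<mu> l * s0" by (simp add: \<theta>_def \<mu>_def right_diff_distrib diff_divide_distrib mult_ac)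
    then show ?thesis by (simp add: cos_diff)
  qed
  have term_eq: "of_real (cos (\<mu> l * s0)) * (2 * Cf l) = (LINT t|lborel. complex_of_real (cos (real l * \<theta> t)) * E t)" for l
  proof -
    have i: "integrable lborel (\<lambda>t. complex_of_real (cos (\<mu> l * t)) * E t)" "integrable lborel (\<lambda>t. complex_of_real (sin (\<mu> l * t)) * E t)"
      by (rule int[of _ 1]; simp)+
    have "(LINT t|lborel. complex_of_real (cos (real l * \<theta> t)) * E t) =
      (LINT t|lborel. of_real (cos (\<mu> l * s0)) * (complex_of_real (cos (\<mu> l * t)) * E t) +
         of_real (sin (\<mu> l * s0)) * (complex_of_real (sin (\<mu> l * t)) * E t))"
      by (simp add: shift algebra_simps)
    also have "\<dots> = of_real (cos (\<mu> l * s0)) * (2 * Cf l)"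
      using i by (simp add: even odd)
    finally show ?thesis by simp
  qed
  define Dir where "Dir = (\<lambda>N t. \<Sum>l\<le>N. neumann l * cos (real l * \<theta> t))"
  have neu: "\<bar>neumann l\<bar> \<le> 2" for l by (simp add: neumann_def)
  have \<theta>_meas [measurable]: "\<theta> \<in> borel_measurable borel" unfolding \<theta>_def by measurable
  have partial: "(\<Sum>l\<le>N. of_real (neumann l / R * cos (\<mu> l * s0)) * Cf l) = of_real (1 / (2 * R)) * (LINT t|lborel. of_real (Dir N t) * E t)" for N
  proof -
    have "integrable lborel (\<lambda>t. complex_of_real (neumann l) * (of_real (cos (real l * \<theta> t)) * E t))" for l
      by (intro integrable_mult_right int[of _ 1]) auto
    then have "(LINT t|lborel. of_real (Dir N t) * E t) = (\<Sum>l\<le>N. LINT t|lborel. complex_of_real (neumann l) * (of_real (cos (real l * \<theta> t)) * E t))"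
      unfolding Dir_def of_real_sum sum_distrib_right
      by (subst Bochner_Integration.integral_sum[symmetric]) (simp_all add: mult.assoc)
    also have "\<dots> = (\<Sum>l\<le>N. of_real (neumann l) * (of_real (cos (\<mu> l * s0)) * (2 * Cf l)))"
      by (simp add: term_eq)
    finally show ?thesis using R by (simp add: sum_distrib_left mult_ac)
  qed
  have Dir_int: "(LINT t|lborel. Dir N t * ind t) = 2 * R" "integrable lborel (\<lambda>t. Dir N t * ind t)" for N
  proof -
    have one: "(LINT t|lborel. cos (real l * \<theta> t) * ind t) = (if l = 0 then 2 * R else 0)" for l
    proof (cases "l = 0")
      case True
      then show ?thesis using R by (simp add: ind_def)
    next
      case False
      define F where "F = (\<lambda>t. sin (real l * \<theta> t) / (real l * (pi / R)))"
      have "(LINT t|lborel. cos (real l * \<theta> t) * ind t) = F R - F (-R)"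
        unfolding ind_def
      proof (rule integral_FTC_Icc_real)
        show "(F has_real_derivative cos (real l * \<theta> t)) (at t)" for t
          using False R unfolding F_def \<theta>_def by (auto intro!: derivative_eq_intros)
        show "isCont (\<lambda>t. cos (real l * \<theta> t)) t" for t
          unfolding \<theta>_def by (intro continuous_intros)
      qed (use R in simp)
      also have "F R - F (-R) = 0"
      proof -
        have "real l * \<theta> R = real l * pi - \<mu> l * s0" "real l * \<theta> (-R) = - (real l * pi) - \<mu> l * s0"
          using R by (simp_all add: \<theta>_def \<mu>_def field_simps)
        then show ?thesis by (simp add: F_def sin_diff sin_npi)
      qed
      finally show ?thesis using False by simp
    qed
    have i: "integrable lborel (\<lambda>t. neumann l * (cos (real l * \<theta> t) * ind t))" for l
    proof (rule integrable_mult_right, rule Bochner_Integration.integrable_bound[OF ind_int])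
      show "AE t in lborel. norm (cos (real l * \<theta> t) * ind t) \<le> norm (ind t)"
        by (intro AE_I2) (simp add: abs_mult mult_left_le_one_le)
    qed measurable
    have eq: "Dir N t * ind t = (\<Sum>l\<le>N. neumann l * (cos (real l * \<theta> t) * ind t))" for t
      by (simp add: Dir_def sum_distrib_right mult.assoc)
    show "integrable lborel (\<lambda>t. Dir N t * ind t)"
      unfolding eq by (intro Bochner_Integration.integrable_sum i)
    have "(LINT t|lborel. Dir N t * ind t) = (\<Sum>l\<le>N. neumann l * (if l = 0 then 2 * R else 0))"
      unfolding eq using i by (subst Bochner_Integration.integral_sum) (simp_all add: one)
    also have "\<dots> = (\<Sum>l\<le>N. if l = 0 then 2 * R else 0)"
      by (intro sum.cong refl) (simp add: neumann_def)
    also have "\<dots> = 2 * R" by simp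
    finally show "(LINT t|lborel. Dir N t * ind t) = 2 * R" .
  qed
  \<comment> \<open>The left-hand side is the largest value of \<open>\<bar>\<theta> t / 2\<bar>\<close> on \<open>{- R..R}\<close>. It stays below \<open>pi\<close>, the next zero
    of the sine, because \<open>s0\<close> is an interior point.\<close>
  have "pi / 2 + pi * s0 / (2 * R) < pi" using R s0 by (simp add: field_simps)
  then obtain m where m: "m > 0" "\<And>x. \<bar>x\<bar> \<le> pi / 2 + pi * s0 / (2 * R) \<Longrightarrow> m * \<bar>x\<bar> \<le> \<bar>sin x\<bar>"
    using abs_sin_ge_linear by blast
  have sin_ge: "m * (pi / (2 * R)) * \<bar>t - s0\<bar> \<le> \<bar>sin (\<theta> t / 2)\<bar>" if "t \<in> {-R..R}" for t
  proof -
    have "\<bar>\<theta> t / 2\<bar> = pi / (2 * R) * \<bar>t - s0\<bar>" using R by (simp add: \<theta>_def abs_mult)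
    moreover have "pi / (2 * R) * \<bar>t - s0\<bar> \<le> pi / (2 * R) * (R + s0)"
      using that s0 R by (intro mult_left_mono) auto
    moreover have "pi / (2 * R) * (R + s0) = pi / 2 + pi * s0 / (2 * R)" using R by (simp add: field_simps)
    ultimately show ?thesis using m(2)[of "\<theta> t / 2"] by simp
  qed
  define q where "q = (\<lambda>t. of_real (1 / sin (\<theta> t / 2)) * (E t - of_real (ind t) * h s0))"
  have [measurable]: "q \<in> borel_measurable borel" unfolding q_def by measurable
  have K0: "K \<ge> 0"
    using order_trans[OF norm_ge_zero lip[of 0]] R s0 by (simp add: zero_le_mult_iff)
  have q_eq: "of_real (Dir N t) * (E t - of_real (ind t) * h s0) = q t * of_real (sin (pi * (t - s0) / (R / (real N + 1/2))))" for N t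
  proof (cases "t \<in> {-R..R} \<and> t \<noteq> s0")
    case True
    then have "0 < m * (pi / (2 * R)) * \<bar>t - s0\<bar>" using m R by simp
    then have nz: "sin (\<theta> t / 2) \<noteq> 0" using sin_ge[of t] True by auto
    have eq: "(real N + 1/2) * \<theta> t = pi * (t - s0) / (R / (real N + 1/2))" by (simp add: \<theta>_def)
    have "sin (\<theta> t / 2) * Dir N t = sin (pi * (t - s0) / (R / (real N + 1/2)))"
      unfolding eq[symmetric] Dir_def by (rule dirichlet_kernel)
    then have "Dir N t = sin (pi * (t - s0) / (R / (real N + 1/2))) / sin (\<theta> t / 2)"
      using nz by (metis nonzero_mult_div_cancel_left)
    then show ?thesis by (simp add: q_def)
  next
    case False
    then have "E t - of_real (ind t) * h s0 = 0"
      using s0 by (auto simp: E_def ind_def)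
    then show ?thesis by (simp add: q_def)
  qed
  have "(\<lambda>N. LINT t|lborel. q t * complex_of_real (sin (pi * (t - s0) / (R / (real N + 1/2))))) \<longlonglongrightarrow> 0"
  proof (rule riemann_lebesgue[where A = R and C = "K * (2 * R / (m * pi))"])
    show "norm (q t) \<le> K * (2 * R / (m * pi))" for t
    proof (cases "t \<in> {-R..R} \<and> t \<noteq> s0")
      case True
      then have p: "0 < m * (pi / (2 * R)) * \<bar>t - s0\<bar>" using m R by simp
      have "norm (h \<bar>t\<bar> - h s0) \<le> K * \<bar>\<bar>t\<bar> - s0\<bar>" using True by (intro lip) auto
      also have "\<dots> \<le> K * \<bar>t - s0\<bar>" using K0 s0 by (intro mult_left_mono) auto
      finally have le: "norm (h \<bar>t\<bar> - h s0) \<le> K * \<bar>t - s0\<bar>" .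
      have "norm (q t) = norm (h \<bar>t\<bar> - h s0) / \<bar>sin (\<theta> t / 2)\<bar>"
        using True by (simp add: q_def E_def ind_def norm_divide)
      also have "\<dots> \<le> (K * \<bar>t - s0\<bar>) / (m * (pi / (2 * R)) * \<bar>t - s0\<bar>)"
        using True K0 by (intro frac_le le p sin_ge) auto
      also have "\<dots> = K * (2 * R / (m * pi))" using True m R by (simp add: field_simps)
      finally show ?thesis .
    next
      case False
      then have "q t = 0" using s0 by (auto simp: q_def E_def ind_def)
      then show ?thesis using K0 m R by simp
    qed
    show "q t = 0" if "\<bar>t\<bar> > R" for t
      using that by (auto simp: q_def E_def ind_def indicator_def)
    show "AE t in lborel. isCont q t"
      using AE_lborel_singleton[of R] AE_lborel_singleton[of "-R"] AE_lborel_singleton[of s0]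
    proof eventually_elim
      fix t assume t: "t \<noteq> R" "t \<noteq> -R" "t \<noteq> s0"
      show "isCont q t"
      proof (cases "t \<in> {-R..R}")
        case True
        define U where "U = {-R<..<R} - {s0}"
        have "open U" "t \<in> U" using t True by (auto simp: U_def)
        have "continuous_on U (\<lambda>t. h \<bar>t\<bar>)"
          by (rule continuous_on_subset[OF h_cont]) (auto simp: U_def)
        moreover have "continuous_on U \<theta>" unfolding \<theta>_def by (intro continuous_intros)
        moreover have "sin (\<theta> x / 2) \<noteq> 0" if x: "x \<in> U" for x
        proof -
          have "0 < m * (pi / (2 * R)) * \<bar>x - s0\<bar>" using m R x by (simp add: U_def)
          then show ?thesis using sin_ge[of x] x by (auto simp: U_def)
        qed
        ultimately have "continuous_on U (\<lambda>t. of_real (1 / sin (\<theta> t / 2)) * (h \<bar>t\<bar> - h s0))"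
          by (intro continuous_on_mult continuous_on_of_real continuous_on_divide continuous_on_const
              continuous_on_sin continuous_on_diff ballI) simp_all
        then have "continuous_on U q"
          by (rule continuous_on_eq) (simp add: q_def E_def ind_def U_def)
        then show ?thesis
          using \<open>open U\<close> \<open>t \<in> U\<close> by (simp add: continuous_on_eq_continuous_at)
      next
        case False
        have "continuous_on (- {-R..R}) q"
          by (rule continuous_on_eq[OF continuous_on_const[of _ 0]]) (simp add: q_def E_def ind_def)
        moreover have "open (- {-R..R})" by (simp add: open_Compl)
        ultimately show ?thesis using False by (simp add: continuous_on_eq_continuous_at)
      qed
    qed
    show "R / (real N + 1/2) > 0" for N using R by (simp add: add_nonneg_pos)
    have "(\<lambda>N. R * inverse (real N + 1/2)) \<longlonglongrightarrow> R * 0"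
      by (intro tendsto_intros tendsto_inverse_0_at_top filterlim_at_top_mono[OF filterlim_real_sequentially]) auto
    then show "(\<lambda>N. R / (real N + 1/2)) \<longlonglongrightarrow> 0" by (simp only: divide_inverse mult_zero_right)
  qed fact
  from tendsto_add[OF tendsto_mult[OF tendsto_const[of "complex_of_real (1 / (2 * R))"] this] tendsto_const[of "h s0"]]
  have lim0: "(\<lambda>N. of_real (1 / (2 * R)) * (LINT t|lborel. q t * complex_of_real (sin (pi * (t - s0) / (R / (real N + 1/2))))) + h s0) \<longlonglongrightarrow> of_real (1 / (2 * R)) * 0 + h s0"
    .
  have partial_eq: "(\<Sum>l\<le>N. of_real (neumann l / R * cos (\<mu> l * s0)) * Cf l) =
     of_real (1 / (2 * R)) * (LINT t|lborel. q t * complex_of_real (sin (pi * (t - s0) / (R / (real N + 1/2))))) + h s0" for N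
  proof -
    have bound: "\<bar>Dir N t\<bar> \<le> (\<Sum>l\<le>N. 2)" for t
      unfolding Dir_def
    proof (rule order_trans[OF sum_abs sum_mono])
      show "\<bar>neumann l * cos (real l * \<theta> t)\<bar> \<le> 2" for l
        using mult_mono[OF neu[of l] abs_cos_le_one[of "real l * \<theta> t"]] by (simp add: abs_mult)
    qed
    have "Dir N \<in> borel_measurable borel" unfolding Dir_def by measurable
    then have i1: "integrable lborel (\<lambda>t. complex_of_real (Dir N t) * E t)"
      by (rule int[OF _ bound])
    have i2: "integrable lborel (\<lambda>t. complex_of_real (Dir N t * ind t) * h s0)"
      using Dir_int(2)[of N] by (intro integrable_mult_left integrable_of_real)
    have "(LINT t|lborel. q t * complex_of_real (sin (pi * (t - s0) / (R / (real N + 1/2))))) =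
        (LINT t|lborel. of_real (Dir N t) * E t - complex_of_real (Dir N t * ind t) * h s0)"
      unfolding q_eq[symmetric] by (simp add: algebra_simps)
    also have "\<dots> = (LINT t|lborel. of_real (Dir N t) * E t) - of_real (2 * R) * h s0"
      using i1 i2 Dir_int(1)[of N] by (simp only: Bochner_Integration.integral_diff integral_mult_left_zero integral_complex_of_real)
    finally have "(LINT t|lborel. of_real (Dir N t) * E t) =
        (LINT t|lborel. q t * complex_of_real (sin (pi * (t - s0) / (R / (real N + 1/2))))) + of_real (2 * R) * h s0"
      by (simp only: diff_add_cancel)
    moreover have "of_real (1 / (2 * R)) * (x + of_real (2 * R) * y) = of_real (1 / (2 * R)) * x + y" for x y :: complex
      using R by (simp add: distrib_left)
    ultimately show ?thesis
      unfolding partial by (simp only:)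
  qed
  have "(\<lambda>N. \<Sum>l\<le>N. of_real (neumann l / R * cos (\<mu> l * s0)) * Cf l) \<longlonglongrightarrow> h s0"
    unfolding partial_eq using lim0 by (simp only: mult_zero_right add_0_left)
  then show ?thesis
    unfolding sums_def_le Cf_def \<mu>_def .
qed


section \<open>Regularity and transforms of circular means\<close>

abbreviation circle :: "real measure" where
  "circle \<equiv> leb_on {0..<2 * pi}"

lemma finite_measure_circle: "finite_measure circle"
  by (intro finite_measureI) (simp add: emeasure_restrict_space)

lemma measure_circle: "measure circle {0..<2 * pi} = 2 * pi"
  by (simp add: measure_restrict_space)

lemma borel_measurable_Pair_continuous:
  fixes f :: "real \<times> real \<Rightarrow> complex"
  assumes "continuous_on UNIV f" "a \<in> borel_measurable N" "b \<in> borel_measurable N"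
  shows "(\<lambda>p. f (a p, b p)) \<in> borel_measurable N"
  using borel_measurable_continuous_Pair[OF assms(2,3), of "\<lambda>x y. f (x, y)"] assms(1) by simp

lemma circular_mean_eq:
  assumes "continuous_on UNIV f"
  shows "circular_mean f x r = of_real (1 / (2 * pi)) * (LINT t|circle. f (x + r * cos t, r * sin t))"
  unfolding circular_mean_parametrized[OF assms]
  by (simp add: set_lebesgue_integral_def integral_restrict_space)

lemma integrable_circle_bounded:
  fixes h :: "real \<Rightarrow> complex"
  assumes "h \<in> borel_measurable borel" "\<And>t. norm (h t) \<le> B"
  shows "integrable circle h" "norm (LINT t|circle. h t) \<le> 2 * pi * B"
proof -
  interpret finite_measure circle by (rule finite_measure_circle)
  show int: "integrable circle h"
    by (rule integrable_const_bound[of _ B]) (use assms in \<open>auto intro: borel_measurable_leb_onI\<close>)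
  have "norm (LINT t|circle. h t) \<le> (LINT t|circle. norm (h t))" by (rule integral_norm_bound)
  also have "\<dots> \<le> (LINT t|circle. B)"
    using int assms(2) by (intro integral_mono) auto
  also have "\<dots> = 2 * pi * B" using measure_circle by simp
  finally show "norm (LINT t|circle. h t) \<le> 2 * pi * B" .
qed

lemma norm_cos_sin [simp]: "norm (cos t :: real, sin t :: real) = 1"
  by (simp add: norm_prod_def)

lemma circular_mean_lipschitz:
  assumes f: "schwartz f"
  obtains K where "K \<ge> 0"
    "\<And>x r x' r'. norm (circular_mean f x r - circular_mean f x' r') \<le> K * (\<bar>x - x'\<bar> + \<bar>r - r'\<bar>)"
proof -
  obtain K where K: "K \<ge> 0" "\<And>z z'. norm (f z - f z') \<le> K * norm (z - z')" using schwartz_lipschitz[OF f] by blast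
  obtain B where B: "\<And>z. norm (f z) \<le> B" using schwartz_bounded[OF f] by blast
  note cont = schwartz_continuous[OF f]
  show ?thesis
  proof (rule that[OF K(1)])
    fix x r x' r'
    let ?p = "\<lambda>x r t. f (x + r * cos t, r * sin t)"
    have m: "(\<lambda>t. ?p x r t) \<in> borel_measurable borel" for x r
      by (rule borel_measurable_Pair_continuous[OF cont]) measurable
    have le: "norm (?p x r t - ?p x' r' t) \<le> K * (\<bar>x - x'\<bar> + \<bar>r - r'\<bar>)" for t
    proof -
      have "(x + r * cos t, r * sin t) - (x' + r' * cos t, r' * sin t) = (x - x') *\<^sub>R (1, 0) + (r - r') *\<^sub>R (cos t, sin t)"
        by (simp add: algebra_simps)
      then have "norm ((x + r * cos t, r * sin t) - (x' + r' * cos t, r' * sin t)) \<le> \<bar>x - x'\<bar> + \<bar>r - r'\<bar>"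
        using norm_triangle_ineq[of "(x - x') *\<^sub>R (1, 0)" "(r - r') *\<^sub>R (cos t, sin t)"]
        by (simp only: norm_scaleR norm_cos_sin) (simp add: norm_prod_def)
      then show ?thesis using K(1) by (intro order_trans[OF K(2)] mult_left_mono)
    qed
    have "circular_mean f x r - circular_mean f x' r' = of_real (1 / (2 * pi)) * (LINT t|circle. ?p x r t - ?p x' r' t)"
      unfolding circular_mean_eq[OF cont]
      using integrable_circle_bounded(1)[OF m B] by (simp add: right_diff_distrib)
    moreover have "norm (LINT t|circle. ?p x r t - ?p x' r' t) \<le> 2 * pi * (K * (\<bar>x - x'\<bar> + \<bar>r - r'\<bar>))"
      by (rule integrable_circle_bounded(2)[OF borel_measurable_diff[OF m m] le])
    ultimately show "norm (circular_mean f x r - circular_mean f x' r') \<le> K * (\<bar>x - x'\<bar> + \<bar>r - r'\<bar>)"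
      by (simp add: norm_mult norm_divide divide_le_eq mult.commute)
  qed
qed

lemma continuous_on_circular_mean:
  assumes f: "schwartz f"
  shows "continuous_on UNIV (\<lambda>p. circular_mean f (fst p) (snd p))"
proof -
  obtain K where K: "K \<ge> 0"
    "\<And>x r x' r'. norm (circular_mean f x r - circular_mean f x' r') \<le> K * (\<bar>x - x'\<bar> + \<bar>r - r'\<bar>)"
    using circular_mean_lipschitz[OF f] by blast
  show ?thesis
    unfolding continuous_on_eq_continuous_within continuous_within
  proof
    fix p :: "real \<times> real"
    have "((\<lambda>q. K * (\<bar>fst q - fst p\<bar> + \<bar>snd q - snd p\<bar>)) \<longlongrightarrow> K * (\<bar>fst p - fst p\<bar> + \<bar>snd p - snd p\<bar>)) (at p)"
      by (intro tendsto_intros)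
    then have "((\<lambda>q. K * (\<bar>fst q - fst p\<bar> + \<bar>snd q - snd p\<bar>)) \<longlongrightarrow> 0) (at p)" by simp
    moreover have "eventually (\<lambda>q. norm (circular_mean f (fst q) (snd q) - circular_mean f (fst p) (snd p))
        \<le> K * (\<bar>fst q - fst p\<bar> + \<bar>snd q - snd p\<bar>)) (at p)"
      by (intro always_eventually allI K)
    ultimately have "((\<lambda>q. circular_mean f (fst q) (snd q) - circular_mean f (fst p) (snd p)) \<longlongrightarrow> 0) (at p)"
      by (rule Lim_null_comparison[rotated])
    then show "((\<lambda>q. circular_mean f (fst q) (snd q)) \<longlongrightarrow> circular_mean f (fst p) (snd p)) (at p within UNIV)"
      by (simp add: Lim_null[symmetric])
  qed
qed

lemma circular_mean_bound:
  assumes f: "schwartz f" and B: "\<And>t. norm (f (x + r * cos t, r * sin t)) \<le> B"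
  shows "norm (circular_mean f x r) \<le> B"
proof -
  note cont = schwartz_continuous[OF f]
  have "norm (LINT t|circle. f (x + r * cos t, r * sin t)) \<le> 2 * pi * B"
    by (rule integrable_circle_bounded(2)[OF borel_measurable_Pair_continuous[OF cont] B]) measurable
  then show ?thesis
    unfolding circular_mean_eq[OF cont] by (simp add: norm_mult norm_divide divide_le_eq mult.commute)
qed

text \<open>The circle of radius \<open>\<bar>r\<bar>\<close> about \<open>(x, 0)\<close> has distance at least \<open>\<bar>\<bar>x\<bar> - \<bar>r\<bar>\<bar>\<close> from the
  origin.\<close>

lemma circular_mean_decay:
  assumes f: "schwartz f"
  obtains C where "C \<ge> 0"
    "\<And>x r. norm (circular_mean f x r) \<le> C * (1 + r\<^sup>2) ^ 2 / (1 + x\<^sup>2) ^ 2"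
    "\<And>x r. norm (circular_mean f x r) \<le> C * (1 + x\<^sup>2) ^ 2 / (1 + r\<^sup>2) ^ 2"
proof -
  obtain C where C: "C \<ge> 0" "\<And>z. norm (f z) * (1 + (norm z)\<^sup>2) ^ 2 \<le> C" using schwartz_decay[OF f, of 2] by blast
  have key: "norm (f z) \<le> 4 * C * (1 + b\<^sup>2) ^ 2 / (1 + a\<^sup>2) ^ 2" if "\<bar>a\<bar> \<le> norm z + \<bar>b\<bar>" for a b z
  proof -
    have "a\<^sup>2 \<le> (norm z + \<bar>b\<bar>)\<^sup>2" using that by (simp add: abs_le_square_iff[symmetric])
    also have "\<dots> \<le> 2 * (norm z)\<^sup>2 + 2 * b\<^sup>2"
      using zero_le_power2[of "norm z - \<bar>b\<bar>"] by (simp add: power2_sum power2_diff)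
    finally have "a\<^sup>2 \<le> 2 * (norm z)\<^sup>2 + 2 * b\<^sup>2" .
    moreover have "2 * (1 + (norm z)\<^sup>2) * (1 + b\<^sup>2) = 2 + 2 * (norm z)\<^sup>2 + 2 * b\<^sup>2 + 2 * ((norm z)\<^sup>2 * b\<^sup>2)"
      by (simp add: algebra_simps)
    moreover have "0 \<le> (norm z)\<^sup>2 * b\<^sup>2" by simp
    ultimately have "1 + a\<^sup>2 \<le> 2 * (1 + (norm z)\<^sup>2) * (1 + b\<^sup>2)" by linarith
    then have "(1 + a\<^sup>2) ^ 2 \<le> (2 * (1 + (norm z)\<^sup>2) * (1 + b\<^sup>2)) ^ 2"
      by (intro power_mono) (auto intro: add_nonneg_nonneg)
    then have "norm (f z) * (1 + a\<^sup>2) ^ 2 \<le> norm (f z) * (2 * (1 + (norm z)\<^sup>2) * (1 + b\<^sup>2)) ^ 2"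
      by (intro mult_left_mono) auto
    also have "\<dots> = 4 * (norm (f z) * (1 + (norm z)\<^sup>2) ^ 2) * (1 + b\<^sup>2) ^ 2"
    proof -
      have "w * (2 * p * q) ^ 2 = 4 * (w * p ^ 2) * q ^ 2" for w p q :: real by (simp add: power2_eq_square)
      then show ?thesis .
    qed
    also have "\<dots> \<le> 4 * C * (1 + b\<^sup>2) ^ 2" using C by (intro mult_right_mono mult_left_mono) auto
    finally have "norm (f z) * (1 + a\<^sup>2) ^ 2 \<le> 4 * C * (1 + b\<^sup>2) ^ 2" .
    moreover have "0 < (1 + a\<^sup>2) ^ 2" by (intro zero_less_power add_pos_nonneg) auto
    ultimately show ?thesis by (simp only: pos_le_divide_eq)
  qed
  have tri: "\<bar>x\<bar> \<le> norm (x + r * cos t, r * sin t) + \<bar>r\<bar>" "\<bar>r\<bar> \<le> norm (x + r * cos t, r * sin t) + \<bar>x\<bar>" for x r t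
  proof -
    define z p q where "z = (x + r * cos t, r * sin t)" and "p = x *\<^sub>R (1::real, 0::real)" and "q = r *\<^sub>R (cos t, sin t)"
    have z: "z = p + q" by (simp add: z_def p_def q_def)
    have "norm p = \<bar>x\<bar>" "norm q = \<bar>r\<bar>"
      unfolding p_def q_def by (simp_all only: norm_scaleR norm_cos_sin) (simp add: norm_prod_def)
    moreover have "norm p \<le> norm z + norm q" "norm q \<le> norm z + norm p"
      using norm_triangle_ineq4[of z q] norm_triangle_ineq4[of z p] by (simp_all only: z add_diff_cancel_right' add_diff_cancel_left')
    ultimately have "\<bar>x\<bar> \<le> norm z + \<bar>r\<bar> \<and> \<bar>r\<bar> \<le> norm z + \<bar>x\<bar>" by simp
    then show "\<bar>x\<bar> \<le> norm (x + r * cos t, r * sin t) + \<bar>r\<bar>" "\<bar>r\<bar> \<le> norm (x + r * cos t, r * sin t) + \<bar>x\<bar>"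
      by (simp_all only: z_def)
  qed
  show ?thesis
    by (rule that[of "4 * C"]) (use C in \<open>auto intro!: circular_mean_bound[OF f] key tri\<close>)
qed

text \<open>By Fubini's theorem the transform of the average is the average of the transforms, so that a
  bound which is uniform on the circle persists.\<close>

lemma circle_average_transform_bound:
  fixes F :: "real \<Rightarrow> real \<Rightarrow> complex" and k :: "real \<Rightarrow> real"
  assumes F: "(\<lambda>p. F (fst p) (snd p)) \<in> borel_measurable borel"
    and le: "\<And>t v. v \<ge> 0 \<Longrightarrow> norm (F t v) \<le> D / (1 + v\<^sup>2)"
    and k: "k \<in> borel_measurable borel" "\<And>v. v \<ge> 0 \<Longrightarrow> \<bar>k v\<bar> \<le> 1"
    and B: "\<And>t. norm (LINT v|leb_on {0..}. F t v * of_real (k v)) \<le> B"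
  shows "norm (LINT v|leb_on {0..}. (LINT t|circle. F t v) * of_real (k v)) \<le> 2 * pi * B"
proof -
  interpret C: finite_measure circle by (rule finite_measure_circle)
  interpret H: sigma_finite_measure "leb_on {0::real..}" by (rule sigma_finite_leb_on) simp
  interpret pair_sigma_finite circle "leb_on {0::real..}" ..
  have k' [measurable]: "k \<in> borel_measurable (leb_on {0..})" by (rule borel_measurable_leb_onI[OF k(1)])
  have m: "(\<lambda>p. F (fst p) (snd p) * of_real (k (snd p))) \<in> borel_measurable (circle \<Otimes>\<^sub>M leb_on {0..})"
    using borel_measurable_pair_leb_on[OF F, of "{0..<2 * pi}" "{0..}"] by measurable
  have D: "0 \<le> D" using order_trans[OF norm_ge_zero le[of 0 0]] by simp
  have le': "norm (F t v * of_real (k v)) \<le> D / (1 + v\<^sup>2)" if "v \<ge> 0" for t v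
  proof -
    have "norm (F t v * of_real (k v)) \<le> norm (F t v)" using k(2)[OF that] by (simp add: norm_mult mult_right_le_one_le)
    with le[OF that] show ?thesis by (rule order_trans[rotated])
  qed
  have slice: "(\<lambda>v. F t v * of_real (k v)) \<in> borel_measurable (leb_on {0..})" if "t \<in> {0..<2 * pi}" for t
    using measurable_compose[OF measurable_Pair1'[of t circle "leb_on {0..}"] m] that by simp
  have norm_le: "(LINT v|leb_on {0..}. norm (F t v * of_real (k v))) \<le> D * (LINT v|leb_on {0..}. 1 / (1 + v\<^sup>2))"
    if "t \<in> {0..<2 * pi}" for t
  proof -
    have "integrable (leb_on {0::real..}) (\<lambda>v. 1 / (1 + v\<^sup>2))"
      by (rule integrable_leb_on_bound[of _ _ 1]) (auto intro!: borel_measurable_leb_onI)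
    from integrable_mult_right[OF this, of D]
    have "(LINT v|leb_on {0..}. norm (F t v * of_real (k v))) \<le> (LINT v|leb_on {0..}. D * (1 / (1 + v\<^sup>2)))"
      using integral_inverse_one_plus_square(1)[OF slice[OF that] le'] le' by (intro integral_mono) auto
    then show ?thesis by (simp only: integral_mult_right_zero)
  qed
  have int: "integrable (circle \<Otimes>\<^sub>M leb_on {0..}) (\<lambda>p. F (fst p) (snd p) * of_real (k (snd p)))"
  proof (rule Fubini_integrable[OF m])
    show "AE t in circle. integrable (leb_on {0..}) (\<lambda>v. F (fst (t, v)) (snd (t, v)) * of_real (k (snd (t, v))))"
      using integral_inverse_one_plus_square(1)[OF slice le'] by (intro AE_I2) simp
    show "integrable circle (\<lambda>t. LINT v|leb_on {0..}. norm (F (fst (t, v)) (snd (t, v)) * of_real (k (snd (t, v)))))"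
    proof (rule C.integrable_const_bound[of _ "D * (LINT v|leb_on {0..}. 1 / (1 + v\<^sup>2))"])
      show "AE t in circle. norm (LINT v|leb_on {0..}. norm (F (fst (t, v)) (snd (t, v)) * of_real (k (snd (t, v)))))
         \<le> D * (LINT v|leb_on {0..}. 1 / (1 + v\<^sup>2))"
        using norm_le by (intro AE_I2) (simp add: integral_nonneg_AE)
      show "(\<lambda>t. LINT v|leb_on {0..}. norm (F (fst (t, v)) (snd (t, v)) * of_real (k (snd (t, v))))) \<in> borel_measurable circle"
        using measurable_compose[OF m borel_measurable_norm] by (intro H.borel_measurable_lebesgue_integral) (simp add: case_prod_unfold)
    qed
  qed
  then have int': "integrable (circle \<Otimes>\<^sub>M leb_on {0..}) (case_prod (\<lambda>t v. F t v * of_real (k v)))"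
    by (simp add: case_prod_unfold)
  have "(LINT v|leb_on {0..}. (LINT t|circle. F t v) * of_real (k v)) =
      (LINT v|leb_on {0..}. LINT t|circle. F t v * of_real (k v))" by simp
  also have "\<dots> = (LINT t|circle. LINT v|leb_on {0..}. F t v * of_real (k v))"
    by (rule Fubini_integral[OF int'])
  also have "norm \<dots> \<le> (LINT t|circle. norm (LINT v|leb_on {0..}. F t v * of_real (k v)))"
    by (rule integral_norm_bound)
  also have "\<dots> \<le> (LINT t|circle. B)"
  proof (rule integral_mono)
    show "integrable circle (\<lambda>t. norm (LINT v|leb_on {0..}. F t v * of_real (k v)))"
      using integrable_fst[OF int'] by (rule integrable_norm)
  qed (use B in auto)
  also have "\<dots> = 2 * pi * B" using measure_circle by simp
  finally show ?thesis .
qed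

text \<open>For varying \<open>x = sqrt (v + L\<^sup>2)\<close> and fixed \<open>r\<close>, each point of the circle moves on a
  horizontal line through \<open>r *\<^sub>R (cos t, sin t)\<close>.\<close>

lemma circular_mean_bessel_decay:
  assumes f: "schwartz f" and L: "L > 0" and \<alpha>: "\<alpha> \<ge> 0"
  obtains C where "C \<ge> 0"
    "\<And>r c. r \<in> {0..R} \<Longrightarrow> c \<ge> 0 \<Longrightarrow>
      norm (LINT v|leb_on {0..}. of_real ((v + L\<^sup>2) powr - \<alpha>) * circular_mean f (sqrt (v + L\<^sup>2)) r * of_real (bessel_sqrt (c * v)))
        \<le> C / (1 + c\<^sup>2)"
proof -
  define I where "I = {0..R} \<times> (UNIV :: real set)"
  define p where "p = (\<lambda>(r, t). r *\<^sub>R (cos t, sin t) :: real \<times> real)"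
  define \<phi> where "\<phi> = (\<lambda>i v. of_real ((v + L\<^sup>2) powr - \<alpha>) * f (p i + sqrt (v + L\<^sup>2) *\<^sub>R (1, 0)))"
  note cont = schwartz_continuous[OF f]
  have rapid: "rapid n I \<phi>" for n
    unfolding \<phi>_def
  proof (rule rapid_along_lines[OF L _ _ f \<alpha>])
    show "norm (p i) \<le> R" if "i \<in> I" for i
      using that by (auto simp: I_def p_def simp del: scaleR_Pair)
    show "norm (1::real, 0::real) = 1" by (simp add: norm_prod_def)
  qed
  obtain C where C: "C \<ge> 0" "\<And>i c. i \<in> I \<Longrightarrow> c \<ge> 0 \<Longrightarrow>
      norm (LINT v|leb_on {0..}. \<phi> i v * of_real (bessel_sqrt (c * v))) \<le> C / (1 + c\<^sup>2)"
    using bessel_transform_decay[OF rapid] by blast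
  obtain D where D: "D \<ge> 0" "\<And>i v. i \<in> I \<Longrightarrow> v \<ge> 0 \<Longrightarrow> norm (\<phi> i v) \<le> D / (1 + v) ^ 2"
    using rapid_bound[OF rapid[of 0], of 2] by blast
  show ?thesis
  proof (rule that[OF C(1)])
    fix r c :: real assume r: "r \<in> {0..R}" and c: "c \<ge> 0"
    define F where "F = (\<lambda>t v. of_real (1 / (2 * pi)) * \<phi> (r, t) v)"
    have "of_real ((v + L\<^sup>2) powr - \<alpha>) * circular_mean f (sqrt (v + L\<^sup>2)) r = (LINT t|circle. F t v)" for v
    proof -
      have "(LINT t|circle. F t v) = of_real (1 / (2 * pi)) * (LINT t|circle. of_real ((v + L\<^sup>2) powr - \<alpha>) * f (sqrt (v + L\<^sup>2) + r * cos t, r * sin t))"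
        by (simp add: F_def \<phi>_def p_def add.commute)
      then show ?thesis unfolding circular_mean_eq[OF cont] by simp
    qed
    then have "norm (LINT v|leb_on {0..}. of_real ((v + L\<^sup>2) powr - \<alpha>) * circular_mean f (sqrt (v + L\<^sup>2)) r * of_real (bessel_sqrt (c * v)))
       = norm (LINT v|leb_on {0..}. (LINT t|circle. F t v) * of_real (bessel_sqrt (c * v)))"
      by (simp only:)
    also have "\<dots> \<le> 2 * pi * (1 / (2 * pi) * (C / (1 + c\<^sup>2)))"
    proof (rule circle_average_transform_bound[where D = "1 / (2 * pi) * D"])
      have eq: "(\<lambda>p. F (fst p) (snd p)) = (\<lambda>p. of_real (1 / (2 * pi)) *
          (of_real ((snd p + L\<^sup>2) powr - \<alpha>) * f (r * cos (fst p) + sqrt (snd p + L\<^sup>2), r * sin (fst p))))"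
        by (simp add: F_def \<phi>_def p_def fun_eq_iff)
      show "(\<lambda>p. F (fst p) (snd p)) \<in> borel_measurable borel"
        unfolding eq borel_prod[symmetric]
        by (intro borel_measurable_times borel_measurable_const borel_measurable_Pair_continuous[OF cont] borel_measurable_of_real;
            measurable)
      show "norm (F t v) \<le> 1 / (2 * pi) * D / (1 + v\<^sup>2)" if v: "v \<ge> 0" for t v
      proof -
        have "norm (\<phi> (r, t) v) \<le> D / (1 + v) ^ 2" using r v by (intro D) (auto simp: I_def)
        also have "\<dots> \<le> D / (1 + v\<^sup>2)"
          using D one_plus_square_le[OF v] by (intro frac_le) (auto intro: add_pos_nonneg)
        finally have "1 / (2 * pi) * norm (\<phi> (r, t) v) \<le> 1 / (2 * pi) * (D / (1 + v\<^sup>2))"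
          by (intro mult_left_mono) auto
        then show ?thesis by (simp add: F_def norm_mult norm_divide)
      qed
      show "norm (LINT v|leb_on {0..}. F t v * of_real (bessel_sqrt (c * v))) \<le> 1 / (2 * pi) * (C / (1 + c\<^sup>2))" for t
      proof -
        have "(LINT v|leb_on {0..}. F t v * of_real (bessel_sqrt (c * v))) =
           of_real (1 / (2 * pi)) * (LINT v|leb_on {0..}. \<phi> (r, t) v * of_real (bessel_sqrt (c * v)))"
          unfolding F_def mult.assoc by (rule integral_mult_right_zero)
        moreover have "norm (LINT v|leb_on {0..}. \<phi> (r, t) v * of_real (bessel_sqrt (c * v))) \<le> C / (1 + c\<^sup>2)"
          using r c by (intro C) (auto simp: I_def)
        then have "1 / (2 * pi) * norm (LINT v|leb_on {0..}. \<phi> (r, t) v * of_real (bessel_sqrt (c * v))) \<le> 1 / (2 * pi) * (C / (1 + c\<^sup>2))"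
          by (intro mult_left_mono) auto
        ultimately show ?thesis by (simp only: norm_mult norm_of_real) simp
      qed
      show "\<bar>bessel_sqrt (c * v)\<bar> \<le> 1" if "v \<ge> 0" for v
        using c that by (intro abs_bessel_sqrt_le_1) auto
      show "(\<lambda>v. bessel_sqrt (c * v)) \<in> borel_measurable borel" by measurable
    qed
    finally show "norm (LINT v|leb_on {0..}. of_real ((v + L\<^sup>2) powr - \<alpha>) * circular_mean f (sqrt (v + L\<^sup>2)) r * of_real (bessel_sqrt (c * v)))
        \<le> C / (1 + c\<^sup>2)" by simp
  qed
qed

text \<open>For varying radius \<open>sqrt (s\<^sup>2 + R\<^sup>2)\<close> and fixed \<open>x\<close>, each point of the circle moves on a ray
  from \<open>(x, 0)\<close>.\<close>

lemma circular_mean_cosine_decay: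
  assumes f: "schwartz f" and R: "R > 0"
  obtains C where "C \<ge> 0"
    "\<And>b. b \<ge> 0 \<Longrightarrow>
      norm (LINT s|leb_on {0..}. of_real s * circular_mean f x (sqrt (s\<^sup>2 + R\<^sup>2)) * of_real (cos (b * s))) \<le> C / (1 + b\<^sup>2)"
proof -
  \<comment> \<open>The power with exponent \<open>0\<close> brings the family into the shape of \<open>rapid_along_lines\<close>.\<close>
  define \<gamma> where "\<gamma> = (\<lambda>t v. of_real ((v + R\<^sup>2) powr - 0) * f ((x, 0) + sqrt (v + R\<^sup>2) *\<^sub>R (cos t, sin t)))"
  note cont = schwartz_continuous[OF f]
  have rapid: "rapid n UNIV \<gamma>" for n
    unfolding \<gamma>_def
    by (rule rapid_along_lines[where p = "\<lambda>_. (x, 0)" and e = "\<lambda>t. (cos t, sin t)" and P = "norm (x, 0 :: real)",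
          OF R _ _ f order_refl]) (rule order_refl norm_cos_sin)+
  obtain C where C: "C \<ge> 0" "\<And>t b. t \<in> UNIV \<Longrightarrow> b \<ge> 0 \<Longrightarrow>
      norm (LINT s|leb_on {0..}. of_real s * \<gamma> t (s\<^sup>2) * of_real (cos (b * s))) \<le> C / (1 + b\<^sup>2)"
  proof (rule cosine_transform_decay[OF rapid])
    fix C assume "C \<ge> 0" and "\<And>t b. t \<in> UNIV \<Longrightarrow> b \<ge> 0 \<Longrightarrow>
      norm (LINT s|leb_on {0..}. of_real s * \<gamma> t (s\<^sup>2) * of_real (cos (b * s))) \<le> C / (1 + b\<^sup>2)"
    then show thesis by (rule that)
  qed
  obtain D where D: "D \<ge> 0" "\<And>t v. t \<in> UNIV \<Longrightarrow> v \<ge> 0 \<Longrightarrow> norm (\<gamma> t v) \<le> D / (1 + v) ^ 2"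
  proof (rule rapid_bound[OF rapid[of 0], where N = 2])
    fix D assume "D \<ge> 0" and "\<And>t v. t \<in> UNIV \<Longrightarrow> v \<ge> 0 \<Longrightarrow> norm (\<gamma> t v) \<le> D / (1 + v) ^ 2"
    then show thesis by (rule that)
  qed
  show ?thesis
  proof (rule that[OF C(1)])
    fix b :: real assume b: "b \<ge> 0"
    define F where "F = (\<lambda>t s. of_real (1 / (2 * pi)) * (of_real s * \<gamma> t (s\<^sup>2)))"
    have "of_real s * circular_mean f x (sqrt (s\<^sup>2 + R\<^sup>2)) = (LINT t|circle. F t s)" for s
    proof -
      have "s\<^sup>2 + R\<^sup>2 > 0" using R by (simp add: add_nonneg_pos)
      then have "(LINT t|circle. F t s) = of_real (1 / (2 * pi)) * (LINT t|circle. of_real s * f (x + sqrt (s\<^sup>2 + R\<^sup>2) * cos t, sqrt (s\<^sup>2 + R\<^sup>2) * sin t))"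
        by (simp add: F_def \<gamma>_def)
      then show ?thesis unfolding circular_mean_eq[OF cont] by simp
    qed
    then have "norm (LINT s|leb_on {0..}. of_real s * circular_mean f x (sqrt (s\<^sup>2 + R\<^sup>2)) * of_real (cos (b * s)))
       = norm (LINT s|leb_on {0..}. (LINT t|circle. F t s) * of_real (cos (b * s)))"
      by (simp only:)
    also have "\<dots> \<le> 2 * pi * (1 / (2 * pi) * (C / (1 + b\<^sup>2)))"
    proof (rule circle_average_transform_bound[where D = "1 / (2 * pi) * D"])
      have eq: "(\<lambda>p. F (fst p) (snd p)) = (\<lambda>p. of_real (1 / (2 * pi)) * (of_real (snd p) * (of_real (((snd p)\<^sup>2 + R\<^sup>2) powr - 0) *
          f (x + sqrt ((snd p)\<^sup>2 + R\<^sup>2) * cos (fst p), sqrt ((snd p)\<^sup>2 + R\<^sup>2) * sin (fst p)))))"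
        by (simp add: F_def \<gamma>_def fun_eq_iff)
      show "(\<lambda>p. F (fst p) (snd p)) \<in> borel_measurable borel"
        unfolding eq borel_prod[symmetric]
        by (intro borel_measurable_times borel_measurable_const borel_measurable_Pair_continuous[OF cont] borel_measurable_of_real;
            measurable)
      show "norm (F t s) \<le> 1 / (2 * pi) * D / (1 + s\<^sup>2)" if s: "s \<ge> 0" for t s
      proof -
        have "s * norm (\<gamma> t (s\<^sup>2)) \<le> (1 + s\<^sup>2) * (D / (1 + s\<^sup>2) ^ 2)"
          using s D(2)[of t "s\<^sup>2"] zero_le_power2[of "s - 1"]
          by (intro mult_mono) (auto simp: power2_diff)
        also have "\<dots> = D / (1 + s\<^sup>2)" using add_pos_nonneg[of 1 "s\<^sup>2"] by (simp add: power2_eq_square)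
        finally have "1 / (2 * pi) * (s * norm (\<gamma> t (s\<^sup>2))) \<le> 1 / (2 * pi) * (D / (1 + s\<^sup>2))"
          by (intro mult_left_mono) auto
        then show ?thesis using s by (simp add: F_def norm_mult norm_divide)
      qed
      show "norm (LINT s|leb_on {0..}. F t s * of_real (cos (b * s))) \<le> 1 / (2 * pi) * (C / (1 + b\<^sup>2))" for t
      proof -
        have "(LINT s|leb_on {0..}. F t s * of_real (cos (b * s))) =
           of_real (1 / (2 * pi)) * (LINT s|leb_on {0..}. of_real s * \<gamma> t (s\<^sup>2) * of_real (cos (b * s)))"
          unfolding F_def mult.assoc by (rule integral_mult_right_zero)
        moreover have "1 / (2 * pi) * norm (LINT s|leb_on {0..}. of_real s * \<gamma> t (s\<^sup>2) * of_real (cos (b * s))) \<le> 1 / (2 * pi) * (C / (1 + b\<^sup>2))"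
          by (intro mult_left_mono C(2) b) auto
        ultimately show ?thesis by (simp only: norm_mult norm_of_real) simp
      qed
      show "(\<lambda>s. cos (b * s)) \<in> borel_measurable borel" by measurable
    qed simp
    finally show "norm (LINT s|leb_on {0..}. of_real s * circular_mean f x (sqrt (s\<^sup>2 + R\<^sup>2)) * of_real (cos (b * s))) \<le> C / (1 + b\<^sup>2)"
      by simp
  qed
qed


section \<open>The range expansion\<close>

lemma integrable_dirac: "integrable (dirac a) (\<phi> :: real \<Rightarrow> complex)"
  unfolding dirac_def
  by (rule integrableI_bounded) (simp_all add: nn_integral_return)

lemma circular_mean_slices:
  assumes f: "schwartz f"
  shows "continuous_on A (circular_mean f x)" "continuous_on A (\<lambda>x. circular_mean f x r)"
    and "circular_mean f x \<in> borel_measurable borel"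
proof -
  note cont = continuous_on_circular_mean[OF f]
  have "continuous_on UNIV (\<lambda>r. (x, r))" by (intro continuous_on_Pair continuous_on_const continuous_on_id)
  from continuous_on_compose[OF this continuous_on_subset[OF cont subset_UNIV]]
  have c: "continuous_on UNIV (circular_mean f x)" by (simp add: o_def)
  then show "continuous_on A (circular_mean f x)" by (rule continuous_on_subset) simp
  show "circular_mean f x \<in> borel_measurable borel" using c by (rule borel_measurable_continuous_onI)
  have "continuous_on UNIV (\<lambda>x. (x, r))" by (intro continuous_on_Pair continuous_on_const continuous_on_id)
  from continuous_on_compose[OF this continuous_on_subset[OF cont subset_UNIV]]
  have "continuous_on UNIV (\<lambda>x. circular_mean f x r)" by (simp add: o_def)
  then show "continuous_on A (\<lambda>x. circular_mean f x r)" by (rule continuous_on_subset) simp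
qed

lemma weight_le: "t \<ge> 0 \<Longrightarrow> t / (1 + t\<^sup>2) ^ 2 \<le> 1 / (1 + t\<^sup>2)" for t :: real
proof -
  assume "t \<ge> 0"
  have pos: "0 < 1 + t\<^sup>2" by (intro add_pos_nonneg) auto
  have "t \<le> 1 + t\<^sup>2" using zero_le_power2[of "t - 1"] \<open>t \<ge> 0\<close> by (simp add: power2_diff)
  then have "t / (1 + t\<^sup>2) ^ 2 \<le> (1 + t\<^sup>2) / (1 + t\<^sup>2) ^ 2"
    by (intro divide_right_mono) auto
  also have "\<dots> = 1 / (1 + t\<^sup>2)" using pos by (simp add: power2_eq_square)
  finally show ?thesis .
qed

lemma range_integrand_integrable:
  assumes f: "schwartz f" and R: "R > 0"
  shows "integrable (leb_on {R<..}) (\<lambda>r. of_real (r * cos (b * sqrt (r\<^sup>2 - R\<^sup>2))) * circular_mean f x r)"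
proof -
  obtain C where C: "C \<ge> 0" "\<And>x r. norm (circular_mean f x r) \<le> C * (1 + x\<^sup>2) ^ 2 / (1 + r\<^sup>2) ^ 2"
    by (rule circular_mean_decay[OF f], rule that)
  have [measurable]: "circular_mean f x \<in> borel_measurable borel" by (rule circular_mean_slices[OF f])
  show ?thesis
  proof (rule integrable_leb_on_bound)
    show "(\<lambda>r. of_real (r * cos (b * sqrt (r\<^sup>2 - R\<^sup>2))) * circular_mean f x r) \<in> borel_measurable (leb_on {R<..})"
      by (rule borel_measurable_leb_onI) measurable
    fix r assume "r \<in> {R<..}"
    then have r: "r \<ge> 0" using R by simp
    have "norm (of_real (r * cos (b * sqrt (r\<^sup>2 - R\<^sup>2))) * circular_mean f x r)
        = r * \<bar>cos (b * sqrt (r\<^sup>2 - R\<^sup>2))\<bar> * norm (circular_mean f x r)"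
      using r by (simp add: norm_mult abs_mult)
    also have "\<dots> \<le> r * 1 * (C * (1 + x\<^sup>2) ^ 2 / (1 + r\<^sup>2) ^ 2)"
      using r C by (intro mult_mono) auto
    also have "\<dots> = C * (1 + x\<^sup>2) ^ 2 * (r / (1 + r\<^sup>2) ^ 2)" by simp
    also have "\<dots> \<le> C * (1 + x\<^sup>2) ^ 2 * (1 / (1 + r\<^sup>2))"
      using C r by (intro mult_left_mono weight_le) auto
    finally show "norm (of_real (r * cos (b * sqrt (r\<^sup>2 - R\<^sup>2))) * circular_mean f x r) \<le> C * (1 + x\<^sup>2) ^ 2 / (1 + r\<^sup>2)"
      by simp
  qed simp
qed

lemma range_factor_weight:
  assumes "R > 0" "r > R"
  shows "o_range_factor R b r * z * of_real (r * sqrt (r\<^sup>2 - R\<^sup>2)) = of_real (r * cos (b * sqrt (r\<^sup>2 - R\<^sup>2))) * z"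
proof -
  have "R\<^sup>2 < r\<^sup>2" using assms by (intro power_strict_mono) auto
  moreover define s where "s = sqrt (r\<^sup>2 - R\<^sup>2)"
  ultimately have "s \<noteq> 0" by simp
  then show ?thesis
    using assms(2) unfolding o_range_factor_def s_def [symmetric] by simp
qed

lemma G_range_well_defined_circular_mean:
  assumes f: "schwartz f" and R: "R > 0"
  shows "G_range_well_defined R (circular_mean f) a b"
  unfolding G_range_well_defined_def pairing_range_finite_def iint_finite_def integral_dirac
proof
  show "\<forall>s\<in>space (leb_on {R<..}). integrable (dirac a) (integrand_range R (\<lambda>x. o_range_factor R b) (circular_mean f) s)"
    by (simp add: integrable_dirac)
  show "integrable (leb_on {R<..}) (\<lambda>s. integrand_range R (\<lambda>x. o_range_factor R b) (circular_mean f) s a)"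
    using range_integrand_integrable[OF f R, of b a]
    by (rule Bochner_Integration.integrable_cong[THEN iffD1, OF refl, rotated])
       (simp only: integrand_range_def space_leb_on greaterThan_iff range_factor_weight[OF R])
qed

lemma half_range_profile:
  fixes x :: real
  assumes f: "schwartz f" and R: "R > 0"
  defines "\<phi> \<equiv> \<lambda>s. of_real s * circular_mean f x (sqrt (s\<^sup>2 + R\<^sup>2))"
  shows "continuous_on {0..} \<phi>" "\<exists>D. \<forall>s\<ge>0. norm (\<phi> s) \<le> D / (1 + s\<^sup>2)" "integrable (leb_on {0..}) \<phi>"
proof -
  show cont: "continuous_on {0..} \<phi>"
    unfolding \<phi>_def
    by (intro continuous_on_mult continuous_on_of_real continuous_on_id
        continuous_on_compose2[OF circular_mean_slices(1)[OF f, of UNIV]] continuous_intros) auto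
  obtain C where C: "C \<ge> 0" "\<And>x r. norm (circular_mean f x r) \<le> C * (1 + x\<^sup>2) ^ 2 / (1 + r\<^sup>2) ^ 2"
    by (rule circular_mean_decay[OF f], rule that)
  define D where "D = C * (1 + x\<^sup>2) ^ 2"
  have D: "D \<ge> 0" using C by (simp add: D_def)
  have le: "norm (\<phi> s) \<le> D / (1 + s\<^sup>2)" if s: "s \<ge> 0" for s
  proof -
    have "norm (circular_mean f x (sqrt (s\<^sup>2 + R\<^sup>2))) \<le> D / (1 + (s\<^sup>2 + R\<^sup>2)) ^ 2"
      using C(2)[of x "sqrt (s\<^sup>2 + R\<^sup>2)"] by (simp add: D_def)
    also have "\<dots> \<le> D / (1 + s\<^sup>2) ^ 2"
      using D by (intro frac_le power_mono zero_less_power) (auto intro: add_pos_nonneg)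
    finally have "s * norm (circular_mean f x (sqrt (s\<^sup>2 + R\<^sup>2))) \<le> s * (D / (1 + s\<^sup>2) ^ 2)"
      using s by (rule mult_left_mono)
    then have "norm (\<phi> s) \<le> s * (D / (1 + s\<^sup>2) ^ 2)"
      using s by (simp only: \<phi>_def norm_mult norm_of_real abs_of_nonneg)
    also have "\<dots> = D * (s / (1 + s\<^sup>2) ^ 2)" by simp
    also have "\<dots> \<le> D * (1 / (1 + s\<^sup>2))" using D s by (intro mult_left_mono weight_le)
    finally show ?thesis by simp
  qed
  then show "\<exists>D. \<forall>s\<ge>0. norm (\<phi> s) \<le> D / (1 + s\<^sup>2)" by blast
  show "integrable (leb_on {0..}) \<phi>"
    by (rule integral_inverse_one_plus_square(1)[OF borel_measurable_leb_on_continuous[OF cont] le])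
qed

text \<open>The substitution \<open>r = sqrt (s\<^sup>2 + R\<^sup>2)\<close>.\<close>

lemma G_range_eq_cosine_transform:
  assumes f: "schwartz f" and R: "R > 0"
  shows "G_range R (circular_mean f) x b =
    of_real (2 / pi) * (LINT s|leb_on {0..}. of_real s * circular_mean f x (sqrt (s\<^sup>2 + R\<^sup>2)) * of_real (cos (b * s)))"
proof -
  define F where "F = (\<lambda>r. of_real (r * cos (b * sqrt (r\<^sup>2 - R\<^sup>2))) * circular_mean f x r)"
  define q where "q = (\<lambda>s::real. sqrt (s\<^sup>2 + R\<^sup>2))"
  define k where "k = (\<lambda>s. of_real s * circular_mean f x (sqrt (s\<^sup>2 + R\<^sup>2)) * complex_of_real (cos (b * s)))"
  have pos: "s\<^sup>2 + R\<^sup>2 > 0" for s using R by (simp add: add_nonneg_pos)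
  have q: "q 0 = R" using R by (simp add: q_def)
  have qF: "of_real (s / q s) * F (q s) = k s" if "s > 0" for s
  proof -
    have q0: "q s \<noteq> 0" and qs: "sqrt ((q s)\<^sup>2 - R\<^sup>2) = s" using pos[of s] that by (auto simp: q_def)
    have "of_real (s / q s) * (of_real (q s * y) * z) = of_real s * z * of_real y" for y and z :: complex
      using q0 by (simp add: field_simps)
    moreover have "k s = of_real s * circular_mean f x (q s) * of_real (cos (b * s))" by (simp add: k_def q_def)
    ultimately show ?thesis unfolding F_def qs by (simp only:)
  qed
  note \<phi> = half_range_profile[OF f R, of x]
  have k_int: "integrable (leb_on {0..}) k"
  proof (rule Bochner_Integration.integrable_bound[OF \<phi>(3)])
    show "k \<in> borel_measurable (leb_on {0..})"
      unfolding k_def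
      by (intro borel_measurable_leb_on_continuous continuous_on_mult \<phi>(1) continuous_intros)
    show "AE s in leb_on {0..}. norm (k s) \<le> norm (of_real s * circular_mean f x (sqrt (s\<^sup>2 + R\<^sup>2)))"
      by (intro AE_I2) (simp add: k_def norm_mult mult_right_le_one_le)
  qed
  have "(LINT r|leb_on {q 0<..}. F r) = (LINT s|leb_on {0<..}. of_real (s / q s) * F (q s))"
  proof (rule integral_halfline_substitution)
    show "(q has_real_derivative s / q s) (at s)" for s
    proof -
      have "(q has_real_derivative inverse (sqrt (s\<^sup>2 + R\<^sup>2)) / 2 * (2 * s)) (at s)"
        unfolding q_def using DERIV_real_sqrt[OF pos[of s]]
        by (rule DERIV_chain2) (auto intro!: derivative_eq_intros)
      moreover have "inverse (sqrt (s\<^sup>2 + R\<^sup>2)) / 2 * (2 * s) = s / q s" by (simp add: q_def field_simps)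
      ultimately show ?thesis by (simp only:)
    qed
    show "isCont (\<lambda>s. s / q s) s" for s
      unfolding q_def using pos[of s] by (intro continuous_intros) auto
    show "0 \<le> s / q s" if "0 \<le> s" for s using that by (simp add: q_def)
    have "isCont q 0" unfolding q_def by (intro continuous_intros)
    then show "(q \<longlongrightarrow> q 0) (at_right 0)"
      by (simp add: isCont_def filterlim_at_split)
    show "filterlim q at_top at_top"
    proof (rule filterlim_at_top_mono[OF filterlim_ident])
      show "eventually (\<lambda>s. s \<le> q s) at_top"
        unfolding q_def by (intro always_eventually allI real_le_rsqrt) simp
    qed
    show "isCont F (q s)" for s
    proof -
      have "continuous_on UNIV F"
        unfolding F_def by (intro continuous_on_mult circular_mean_slices[OF f] continuous_intros)
      then show ?thesis by (simp add: continuous_on_eq_continuous_at)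
    qed
    have "integrable (leb_on {0<..}) k" using k_int leb_on_atLeast_eq_greaterThan(1)[of k 0] by auto
    then show "integrable (leb_on {0<..}) (\<lambda>s. of_real (s / q s) * F (q s))"
      by (rule Bochner_Integration.integrable_cong[THEN iffD2, OF refl, rotated]) (simp only: qF space_leb_on greaterThan_iff)
    show "integrable (leb_on {q 0<..}) F"
      unfolding q F_def by (rule range_integrand_integrable[OF f R])
  qed
  also have "\<dots> = (LINT s|leb_on {0<..}. k s)"
    by (intro Bochner_Integration.integral_cong refl) (simp only: qF space_leb_on greaterThan_iff)
  also have "\<dots> = (LINT s|leb_on {0..}. k s)"
    using k_int by (intro leb_on_atLeast_eq_greaterThan(2)[symmetric]) auto
  finally show ?thesis
    unfolding G_range_explicit[OF R] q
    by (simp add: F_def k_def set_lebesgue_integral_def integral_restrict_space)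
qed

lemma integrable_cosine_transform_product:
  fixes \<Phi> :: "real \<Rightarrow> complex"
  assumes "integrable (leb_on {0..}) \<Phi>" "k \<in> borel_measurable borel" "\<And>c. c \<ge> 0 \<Longrightarrow> \<bar>k c\<bar> \<le> 1"
  shows "integrable (leb_on {0..}) (\<lambda>c. \<Phi> c * complex_of_real (k c))"
proof (rule Bochner_Integration.integrable_bound[OF assms(1)])
  have [measurable]: "k \<in> borel_measurable (leb_on {0..})" "\<Phi> \<in> borel_measurable (leb_on {0..})"
    using assms by (auto intro: borel_measurable_leb_onI)
  show "(\<lambda>c. \<Phi> c * complex_of_real (k c)) \<in> borel_measurable (leb_on {0..})" by measurable
  show "AE c in leb_on {0..}. norm (\<Phi> c * complex_of_real (k c)) \<le> norm (\<Phi> c)"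
    using assms(3) by (intro AE_I2) (simp add: norm_mult mult_right_le_one_le)
qed

text \<open>The inversion recovers \<open>s * g x r\<close> at \<open>s = sqrt (r\<^sup>2 - R\<^sup>2)\<close>, and the denominator of the
  factor removes \<open>s\<close>, which is positive because \<open>r > R\<close>.\<close>

lemma range_expansion:
  fixes x :: real
  assumes f: "schwartz f" and R: "R > 0" and r: "r > R"
  defines "h \<equiv> \<lambda>b a. o_range_factor R b r * G_range R (circular_mean f) a b"
  shows "iint_finite (leb_on {0..}) (dirac x) h" and "circular_mean f x r = iint (leb_on {0..}) (dirac x) h"
proof -
  define s0 where "s0 = sqrt (r\<^sup>2 - R\<^sup>2)"
  have Rr: "R\<^sup>2 < r\<^sup>2" using r R by (intro power_strict_mono) auto
  then have "s0\<^sup>2 = r\<^sup>2 - R\<^sup>2" unfolding s0_def by (intro real_sqrt_pow2) simp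
  then have "sqrt (s0\<^sup>2 + R\<^sup>2) = r" using r R by simp
  moreover have "s0 > 0" unfolding s0_def using Rr by simp
  ultimately have s0: "s0 > 0" "sqrt (s0\<^sup>2 + R\<^sup>2) = r" by blast+
  define \<phi> where "\<phi> = (\<lambda>s. of_real s * circular_mean f x (sqrt (s\<^sup>2 + R\<^sup>2)))"
  define \<Phi> where "\<Phi> = (\<lambda>b. LINT s|leb_on {0..}. \<phi> s * complex_of_real (cos (b * s)))"
  have \<phi>: "continuous_on {0..} \<phi>" "\<exists>D. \<forall>s\<ge>0. norm (\<phi> s) \<le> D / (1 + s\<^sup>2)" "integrable (leb_on {0..}) \<phi>"
    unfolding \<phi>_def by (rule half_range_profile[OF f R])+
  from \<phi>(2) obtain D where "\<forall>s\<ge>0. norm (\<phi> s) \<le> D / (1 + s\<^sup>2)" ..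
  then have D: "\<And>s. s \<ge> 0 \<Longrightarrow> norm (\<phi> s) \<le> D / (1 + s\<^sup>2)" by blast
  have D0: "D \<ge> 0" using order_trans[OF norm_ge_zero D[of 0]] by simp
  have bd: "norm (\<phi> s) \<le> D" if "s \<ge> 0" for s
  proof -
    have "D / (1 + s\<^sup>2) \<le> D / 1" using D0 by (intro frac_le) auto
    with D[OF that] show ?thesis by simp
  qed
  have "continuous_on UNIV (\<lambda>p. cos (fst p * snd p :: real))" by (intro continuous_intros)
  then have "continuous_on {0..} \<Phi>"
    unfolding \<Phi>_def using continuous_on_kernel_transform[of "{0..}" "\<lambda>b s. cos (b * s)" \<phi>] \<phi>(3) by simp
  then have \<Phi>_meas: "\<Phi> \<in> borel_measurable (leb_on {0..})" by (rule borel_measurable_leb_on_continuous)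
  obtain C where C: "\<And>b. b \<ge> 0 \<Longrightarrow> norm (\<Phi> b) \<le> C / (1 + b\<^sup>2)"
  proof (rule circular_mean_cosine_decay[OF f R, where x = x])
    fix C assume "\<And>b. b \<ge> 0 \<Longrightarrow>
      norm (LINT s|leb_on {0..}. of_real s * circular_mean f x (sqrt (s\<^sup>2 + R\<^sup>2)) * of_real (cos (b * s))) \<le> C / (1 + b\<^sup>2)"
    then show thesis by (intro that[of C]) (simp only: \<Phi>_def \<phi>_def)
  qed
  have \<Phi>_int: "integrable (leb_on {0..}) \<Phi>"
    by (rule integral_inverse_one_plus_square(1)[OF \<Phi>_meas C])
  have h_eq: "h b x = of_real (2 / (pi * s0)) * (\<Phi> b * of_real (cos (s0 * b)))" for b
    using r s0 unfolding h_def G_range_eq_cosine_transform[OF f R] o_range_factor_def s0_def[symmetric] \<Phi>_def \<phi>_def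
    by (simp add: mult_ac)
  have int: "integrable (leb_on {0..}) (\<lambda>b. h b x)"
    unfolding h_eq by (intro integrable_mult_right integrable_cosine_transform_product[OF \<Phi>_int]) auto
  show "iint_finite (leb_on {0..}) (dirac x) h"
    unfolding iint_finite_def integral_dirac using int by (simp add: integrable_dirac)
  have inv: "(LINT b|leb_on {0..}. \<Phi> b * cos (s0 * b)) = pi / 2 * \<phi> s0"
  proof (rule cosine_inversion[OF \<phi>(1) bd \<phi>(3) _ \<Phi>_int])
    show "\<Phi> c = (LINT w|leb_on {0..}. \<phi> w * cos (c * w))" for c by (simp only: \<Phi>_def)
  qed (use s0 in simp_all)
  have "iint (leb_on {0..}) (dirac x) h = of_real (2 / (pi * s0)) * (LINT b|leb_on {0..}. \<Phi> b * cos (s0 * b))"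
    unfolding iint_def integral_dirac h_eq by (rule integral_mult_right_zero)
  also have "\<dots> = circular_mean f x r"
    unfolding inv using s0 by (simp add: \<phi>_def)
  finally show "circular_mean f x r = iint (leb_on {0..}) (dirac x) h" by simp
qed


section \<open>Bessel transform and cosine coefficients of the mean\<close>

text \<open>The circular mean in the variable \<open>v = x\<^sup>2 - L\<^sup>2\<close>, divided by \<open>x powr (2 * \<alpha>)\<close>: the mean
  itself for \<open>\<alpha> = 0\<close>, and the quotient \<open>g x r / x\<close> for \<open>\<alpha> = 1 / 2\<close>.\<close>

definition profile :: "(real \<times> real \<Rightarrow> complex) \<Rightarrow> real \<Rightarrow> real \<Rightarrow> real \<Rightarrow> real \<Rightarrow> complex" where
  "profile f L \<alpha> v r = of_real ((v + L\<^sup>2) powr - \<alpha>) * circular_mean f (sqrt (v + L\<^sup>2)) r"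

text \<open>Twice the Hankel transform of order zero of \<open>y \<mapsto> profile f L \<alpha> (y\<^sup>2) r\<close> at the frequency
  \<open>sqrt c\<close>.\<close>

definition bessel_profile :: "(real \<times> real \<Rightarrow> complex) \<Rightarrow> real \<Rightarrow> real \<Rightarrow> real \<Rightarrow> real \<Rightarrow> complex" where
  "bessel_profile f L \<alpha> r c = (LINT v|leb_on {0..}. profile f L \<alpha> v r * of_real (bessel_sqrt (c * v)))"

text \<open>A cosine coefficient on \<open>{0..R}\<close>, expressed in the variable \<open>r = sqrt (R\<^sup>2 - s\<^sup>2)\<close>, for
  which \<open>r dr = - s ds\<close>.\<close>

definition radial_coeff :: "(real \<times> real \<Rightarrow> complex) \<Rightarrow> real \<Rightarrow> real \<Rightarrow> real \<Rightarrow> nat \<Rightarrow> real \<Rightarrow> complex" where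
  "radial_coeff f R L \<alpha> l c =
     (LINT r|leb_on {0<..<R}. of_real (r * cos (real l * (pi / R) * sqrt (R\<^sup>2 - r\<^sup>2))) * bessel_profile f L \<alpha> r c)"

lemma borel_measurable_of_realI:
  "h \<in> borel_measurable N \<Longrightarrow> (\<lambda>x. complex_of_real (h x)) \<in> borel_measurable N"
  by (rule measurable_compose[OF _ borel_measurable_of_real])

lemma profile_measurable:
  assumes f: "schwartz f"
  shows "(\<lambda>p. profile f L \<alpha> (fst p) (snd p)) \<in> borel_measurable borel"
proof -
  have g: "(\<lambda>p. circular_mean f (sqrt (fst p + L\<^sup>2)) (snd p)) \<in> borel_measurable (borel \<Otimes>\<^sub>M borel)"
    by (rule borel_measurable_continuous_Pair[OF _ _ continuous_on_circular_mean[OF f]]) measurable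
  show ?thesis
    unfolding profile_def borel_prod[symmetric]
    by (rule borel_measurable_times[OF borel_measurable_of_realI g]) measurable
qed

lemma profile_continuous:
  assumes f: "schwartz f" and L: "L > 0"
  shows "continuous_on {0..} (\<lambda>v. profile f L \<alpha> v r)" "continuous_on A (profile f L \<alpha> v)"
proof -
  have pos: "v + L\<^sup>2 > 0" if "v \<ge> 0" for v using L that by (simp add: add_nonneg_pos)
  have "continuous_on {0..} (\<lambda>v. sqrt (v + L\<^sup>2))" by (intro continuous_intros)
  then have 1: "continuous_on {0..} (\<lambda>v. circular_mean f (sqrt (v + L\<^sup>2)) r)"
    by (rule continuous_on_compose2[OF circular_mean_slices(2)[OF f, of UNIV]]) simp
  have "continuous_on {0..} (\<lambda>v. (v + L\<^sup>2) powr - \<alpha>)"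
    using pos by (intro continuous_on_powr continuous_intros) force
  then show "continuous_on {0..} (\<lambda>v. profile f L \<alpha> v r)"
    unfolding profile_def by (intro continuous_on_mult continuous_on_of_real 1)
  show "continuous_on A (profile f L \<alpha> v)"
    unfolding profile_def by (intro continuous_on_mult continuous_on_const circular_mean_slices(1)[OF f])
qed

lemma profile_bound:
  assumes f: "schwartz f" and L: "L > 0" and \<alpha>: "\<alpha> \<ge> 0"
  obtains D where "D \<ge> 0" "\<And>v r. v \<ge> 0 \<Longrightarrow> r \<in> {0..R} \<Longrightarrow> norm (profile f L \<alpha> v r) \<le> D / (1 + v\<^sup>2)"
proof -
  obtain C where C: "C \<ge> 0" "\<And>x r. norm (circular_mean f x r) \<le> C * (1 + r\<^sup>2) ^ 2 / (1 + x\<^sup>2) ^ 2"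
    by (rule circular_mean_decay[OF f], rule that)
  define D where "D = (L\<^sup>2) powr - \<alpha> * (C * (1 + R\<^sup>2) ^ 2)"
  show ?thesis
  proof (rule that)
    show "D \<ge> 0" using C by (simp add: D_def)
    fix v r assume v: "v \<ge> (0::real)" and r: "r \<in> {0..R}"
    have "norm (circular_mean f (sqrt (v + L\<^sup>2)) r) \<le> C * (1 + r\<^sup>2) ^ 2 / (1 + (v + L\<^sup>2)) ^ 2"
      using C(2)[of "sqrt (v + L\<^sup>2)" r] v by simp
    also have "\<dots> \<le> C * (1 + R\<^sup>2) ^ 2 / (1 + v\<^sup>2)"
    proof (rule frac_le)
      show "0 < 1 + v\<^sup>2" by (intro add_pos_nonneg) auto
      have "1 + v\<^sup>2 \<le> (1 + v) ^ 2" by (rule one_plus_square_le[OF v])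
      also have "\<dots> \<le> (1 + (v + L\<^sup>2)) ^ 2" using v by (intro power_mono) auto
      finally show "1 + v\<^sup>2 \<le> (1 + (v + L\<^sup>2)) ^ 2" .
      show "C * (1 + r\<^sup>2) ^ 2 \<le> C * (1 + R\<^sup>2) ^ 2"
        using C r by (intro mult_left_mono power_mono add_left_mono) auto
    qed (use C in auto)
    finally have le: "norm (circular_mean f (sqrt (v + L\<^sup>2)) r) \<le> C * (1 + R\<^sup>2) ^ 2 / (1 + v\<^sup>2)" .
    have pw: "(v + L\<^sup>2) powr - \<alpha> \<le> (L\<^sup>2) powr - \<alpha>"
      using v L \<alpha> by (intro powr_mono2') auto
    have "(v + L\<^sup>2) powr - \<alpha> * norm (circular_mean f (sqrt (v + L\<^sup>2)) r) \<le> (L\<^sup>2) powr - \<alpha> * (C * (1 + R\<^sup>2) ^ 2 / (1 + v\<^sup>2))"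
      by (rule mult_mono[OF pw le]) auto
    then show "norm (profile f L \<alpha> v r) \<le> D / (1 + v\<^sup>2)"
      by (simp add: profile_def norm_mult D_def mult.assoc)
  qed
qed

lemma profile_integrable:
  assumes f: "schwartz f" and L: "L > 0" and \<alpha>: "\<alpha> \<ge> 0" and r: "r \<ge> 0"
  shows "integrable (leb_on {0..}) (\<lambda>v. profile f L \<alpha> v r)"
proof -
  obtain D where "D \<ge> 0" and D: "\<And>v r'. v \<ge> 0 \<Longrightarrow> r' \<in> {0..r} \<Longrightarrow> norm (profile f L \<alpha> v r') \<le> D / (1 + v\<^sup>2)"
    by (rule profile_bound[OF f L \<alpha>, of r], rule that)
  have "norm (profile f L \<alpha> v r) \<le> D / (1 + v\<^sup>2)" if "v \<ge> 0" for v
    using D[OF that, of r] r by simp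
  then show ?thesis
    by (rule integral_inverse_one_plus_square(1)[OF borel_measurable_leb_on_continuous[OF profile_continuous(1)[OF f L]]])
qed

lemma bessel_profile_continuous:
  assumes f: "schwartz f" and L: "L > 0" and \<alpha>: "\<alpha> \<ge> 0" and r: "r \<ge> 0"
  shows "continuous_on {0..} (bessel_profile f L \<alpha> r)"
proof -
  have "continuous_on UNIV (\<lambda>p. bessel_sqrt (fst p * snd p))" by (intro continuous_intros)
  then show ?thesis
    unfolding bessel_profile_def[abs_def]
    using continuous_on_kernel_transform[of "{0..}" "\<lambda>c v. bessel_sqrt (c * v)" "\<lambda>v. profile f L \<alpha> v r"]
      profile_integrable[OF f L \<alpha> r] abs_bessel_sqrt_le_1 by simp
qed

lemma bessel_profile_decay:
  assumes f: "schwartz f" and L: "L > 0" and \<alpha>: "\<alpha> \<ge> 0"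
  obtains C where "C \<ge> 0" "\<And>r c. r \<in> {0..R} \<Longrightarrow> c \<ge> 0 \<Longrightarrow> norm (bessel_profile f L \<alpha> r c) \<le> C / (1 + c\<^sup>2)"
proof (rule circular_mean_bessel_decay[OF f L \<alpha>, where R = R])
  fix C assume "C \<ge> 0" and "\<And>r c. r \<in> {0..R} \<Longrightarrow> c \<ge> 0 \<Longrightarrow>
      norm (LINT v|leb_on {0..}. of_real ((v + L\<^sup>2) powr - \<alpha>) * circular_mean f (sqrt (v + L\<^sup>2)) r * of_real (bessel_sqrt (c * v)))
        \<le> C / (1 + c\<^sup>2)"
  then show thesis by (intro that[of C]) (simp_all only: bessel_profile_def profile_def)
qed

lemma bessel_profile_integrable:
  assumes f: "schwartz f" and L: "L > 0" and \<alpha>: "\<alpha> \<ge> 0" and r: "r \<ge> 0"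
  shows "integrable (leb_on {0..}) (bessel_profile f L \<alpha> r)"
proof -
  obtain C where "C \<ge> 0" and C: "\<And>r' c. r' \<in> {0..r} \<Longrightarrow> c \<ge> 0 \<Longrightarrow> norm (bessel_profile f L \<alpha> r' c) \<le> C / (1 + c\<^sup>2)"
    by (rule bessel_profile_decay[OF f L \<alpha>, of r], rule that)
  have "norm (bessel_profile f L \<alpha> r c) \<le> C / (1 + c\<^sup>2)" if "c \<ge> 0" for c
    using C[OF _ that, of r] r by simp
  then show ?thesis
    by (rule integral_inverse_one_plus_square(1)[OF borel_measurable_leb_on_continuous[OF bessel_profile_continuous[OF f L \<alpha> r]]])
qed

lemma bessel_profile_inversion:
  assumes f: "schwartz f" and L: "L > 0" and \<alpha>: "\<alpha> \<ge> 0" and r: "r \<ge> 0" and y: "y \<ge> 0"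
  shows "(LINT c|leb_on {0..}. bessel_profile f L \<alpha> r c * of_real (bessel_sqrt (y * c))) = 4 * profile f L \<alpha> y r"
proof -
  obtain D where D: "D \<ge> 0" "\<And>v r'. v \<ge> 0 \<Longrightarrow> r' \<in> {0..r} \<Longrightarrow> norm (profile f L \<alpha> v r') \<le> D / (1 + v\<^sup>2)"
    by (rule profile_bound[OF f L \<alpha>, of r], rule that)
  have bd: "norm (profile f L \<alpha> v r) \<le> D" if "v \<ge> 0" for v
  proof -
    have "D / (1 + v\<^sup>2) \<le> D / 1" using D(1) by (intro frac_le) auto
    with D(2)[OF that, of r] r show ?thesis by simp
  qed
  show ?thesis
  proof (rule bessel_inversion[OF profile_continuous(1)[OF f L] bd profile_integrable[OF f L \<alpha> r] _ bessel_profile_integrable[OF f L \<alpha> r] y])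
    show "bessel_profile f L \<alpha> r c = (LINT w|leb_on {0..}. profile f L \<alpha> w r * of_real (bessel_sqrt (c * w)))" for c
      by (rule bessel_profile_def)
  qed
qed

lemma bessel_profile_measurable:
  assumes f: "schwartz f"
  shows "(\<lambda>p. bessel_profile f L \<alpha> (fst p) (snd p)) \<in> borel_measurable borel"
proof -
  let ?N = "(borel :: real measure) \<Otimes>\<^sub>M (borel :: real measure)"
  interpret H: sigma_finite_measure "leb_on {0::real..}" by (rule sigma_finite_leb_on) simp
  have id: "(\<lambda>v. v) \<in> measurable (leb_on {0::real..}) borel" by (rule borel_measurable_leb_onI) simp
  have v: "(\<lambda>q. snd q) \<in> borel_measurable (?N \<Otimes>\<^sub>M leb_on {0::real..})"
    by (rule measurable_compose[OF measurable_snd id])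
  have r: "(\<lambda>q. fst (fst q)) \<in> borel_measurable (?N \<Otimes>\<^sub>M leb_on {0::real..})"
    "(\<lambda>q. snd (fst q)) \<in> borel_measurable (?N \<Otimes>\<^sub>M leb_on {0::real..})"
    by measurable
  have "(\<lambda>q. (snd q, fst (fst q))) \<in> measurable (?N \<Otimes>\<^sub>M leb_on {0::real..}) (borel :: (real \<times> real) measure)"
    unfolding borel_prod[symmetric] by (intro measurable_Pair v r)
  from measurable_compose[OF this profile_measurable[OF f, of L \<alpha>]]
  have p: "(\<lambda>q. profile f L \<alpha> (snd q) (fst (fst q))) \<in> borel_measurable (?N \<Otimes>\<^sub>M leb_on {0..})"
    by simp
  have b: "(\<lambda>q. bessel_sqrt (snd (fst q) * snd q)) \<in> borel_measurable (?N \<Otimes>\<^sub>M leb_on {0::real..})"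
    by (rule measurable_compose[OF borel_measurable_times[OF r(2) v] borel_measurable_bessel_sqrt])
  have "(\<lambda>q. profile f L \<alpha> (snd q) (fst (fst q)) * of_real (bessel_sqrt (snd (fst q) * snd q)))
     \<in> borel_measurable (?N \<Otimes>\<^sub>M leb_on {0..})"
    by (intro borel_measurable_times p borel_measurable_of_realI b)
  then show ?thesis
    unfolding bessel_profile_def borel_prod[symmetric]
    by (intro H.borel_measurable_lebesgue_integral) (simp only: case_prod_unfold)
qed

lemma finite_measure_leb_on_Ioo: "finite_measure (leb_on {a<..<b::real})"
  by (cases "a \<le> b") (auto intro!: finite_measureI simp: emeasure_restrict_space)

lemma radial_coeff_bound:
  assumes f: "schwartz f" and R: "R > 0" and L: "L > 0" and \<alpha>: "\<alpha> \<ge> 0"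
  obtains K where "K \<ge> 0" "\<And>l c. c \<ge> 0 \<Longrightarrow> norm (radial_coeff f R L \<alpha> l c) \<le> K / (1 + c\<^sup>2)"
    "\<And>l r c. r \<in> {0<..<R} \<Longrightarrow> c \<ge> 0 \<Longrightarrow>
       norm (of_real (r * cos (real l * (pi / R) * sqrt (R\<^sup>2 - r\<^sup>2))) * bessel_profile f L \<alpha> r c) \<le> K / R / (1 + c\<^sup>2)"
proof -
  interpret finite_measure "leb_on {0<..<R}" by (rule finite_measure_leb_on_Ioo)
  obtain C where C: "C \<ge> 0" "\<And>r c. r \<in> {0..R} \<Longrightarrow> c \<ge> 0 \<Longrightarrow> norm (bessel_profile f L \<alpha> r c) \<le> C / (1 + c\<^sup>2)"
    by (rule bessel_profile_decay[OF f L \<alpha>, of R], rule that)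
  have le: "norm (of_real (r * cos (real l * (pi / R) * sqrt (R\<^sup>2 - r\<^sup>2))) * bessel_profile f L \<alpha> r c) \<le> R * C / (1 + c\<^sup>2)"
    if "r \<in> {0<..<R}" "c \<ge> 0" for l r c
  proof -
    have "norm (complex_of_real (r * cos (real l * (pi / R) * sqrt (R\<^sup>2 - r\<^sup>2)))) \<le> R"
      using that mult_mono[of "\<bar>r\<bar>" R "\<bar>cos (real l * (pi / R) * sqrt (R\<^sup>2 - r\<^sup>2))\<bar>" 1]
      by (simp only: norm_of_real abs_mult) auto
    then have "norm (complex_of_real (r * cos (real l * (pi / R) * sqrt (R\<^sup>2 - r\<^sup>2)))) * norm (bessel_profile f L \<alpha> r c) \<le> R * (C / (1 + c\<^sup>2))"
      using that R by (intro mult_mono C(2)) auto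
    then show ?thesis by (simp only: norm_mult) simp
  qed
  show ?thesis
  proof (rule that[of "R * (R * C)"])
    show "0 \<le> R * (R * C)" using R C by simp
    show "norm (of_real (r * cos (real l * (pi / R) * sqrt (R\<^sup>2 - r\<^sup>2))) * bessel_profile f L \<alpha> r c) \<le> R * (R * C) / R / (1 + c\<^sup>2)"
      if "r \<in> {0<..<R}" "c \<ge> 0" for l r c
      using le[OF that, of l] R by simp
    fix l c assume c: "(c::real) \<ge> 0"
    let ?h = "\<lambda>r. of_real (r * cos (real l * (pi / R) * sqrt (R\<^sup>2 - r\<^sup>2))) * bessel_profile f L \<alpha> r c"
    have "norm (radial_coeff f R L \<alpha> l c) \<le> (LINT r|leb_on {0<..<R}. norm (?h r))"
      unfolding radial_coeff_def by (rule integral_norm_bound)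
    also have "\<dots> \<le> (LINT r|leb_on {0<..<R}. R * C / (1 + c\<^sup>2))"
    proof (rule integral_mono')
      show "norm (?h r) \<le> R * C / (1 + c\<^sup>2)" if "r \<in> space (leb_on {0<..<R})" for r
        using le[of r c l] that c by simp
    qed (use R C in auto)
    also have "\<dots> = R * (R * C) / (1 + c\<^sup>2)" using R by (simp add: measure_restrict_space)
    finally show "norm (radial_coeff f R L \<alpha> l c) \<le> R * (R * C) / (1 + c\<^sup>2)" .
  qed
qed

lemma borel_measurable_snd_slice:
  fixes h :: "real \<Rightarrow> real \<Rightarrow> complex"
  assumes "(\<lambda>p. h (fst p) (snd p)) \<in> borel_measurable borel"
  shows "(\<lambda>r. h r c) \<in> borel_measurable borel"
proof -
  have "(\<lambda>r. (r, c)) \<in> measurable borel (borel :: (real \<times> real) measure)"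
    unfolding borel_prod[symmetric] by (intro measurable_Pair) auto
  from measurable_compose[OF this assms] show ?thesis by simp
qed

lemma radial_integrand_measurable:
  assumes f: "schwartz f"
  shows "(\<lambda>p. of_real (fst p * cos (real l * (pi / R) * sqrt (R\<^sup>2 - (fst p)\<^sup>2))) * bessel_profile f L \<alpha> (fst p) (snd p)) \<in> borel_measurable borel"
proof -
  have "(\<lambda>p. fst p * cos (real l * (pi / R) * sqrt (R\<^sup>2 - (fst p)\<^sup>2))) \<in> borel_measurable (borel :: (real \<times> real) measure)"
    unfolding borel_prod[symmetric] by measurable
  then show ?thesis by (rule borel_measurable_times[OF borel_measurable_of_realI bessel_profile_measurable[OF f]])
qed

lemma radial_coeff_continuous:
  assumes f: "schwartz f" and R: "R > 0" and L: "L > 0" and \<alpha>: "\<alpha> \<ge> 0"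
  shows "continuous_on {0..} (radial_coeff f R L \<alpha> l)"
  unfolding continuous_on_sequentially comp_def
proof (intro allI ballI impI)
  fix u a assume a: "a \<in> {0::real..}" and u: "(\<forall>n. u n \<in> {0..}) \<and> u \<longlonglongrightarrow> a"
  interpret finite_measure "leb_on {0<..<R}" by (rule finite_measure_leb_on_Ioo)
  obtain K where "K \<ge> 0" and "\<And>l c. c \<ge> 0 \<Longrightarrow> norm (radial_coeff f R L \<alpha> l c) \<le> K / (1 + c\<^sup>2)"
    and K: "\<And>l r c. r \<in> {0<..<R} \<Longrightarrow> c \<ge> 0 \<Longrightarrow>
       norm (of_real (r * cos (real l * (pi / R) * sqrt (R\<^sup>2 - r\<^sup>2))) * bessel_profile f L \<alpha> r c) \<le> K / R / (1 + c\<^sup>2)"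
    by (rule radial_coeff_bound[OF f R L \<alpha>], rule that)
  let ?h = "\<lambda>c r. of_real (r * cos (real l * (pi / R) * sqrt (R\<^sup>2 - r\<^sup>2))) * bessel_profile f L \<alpha> r c"
  have meas: "?h c \<in> borel_measurable (leb_on {0<..<R})" for c
    by (rule borel_measurable_leb_onI[OF borel_measurable_snd_slice[OF radial_integrand_measurable[OF f]]])
  show "(\<lambda>n. radial_coeff f R L \<alpha> l (u n)) \<longlonglongrightarrow> radial_coeff f R L \<alpha> l a"
    unfolding radial_coeff_def
  proof (rule integral_dominated_convergence[where w = "\<lambda>_. K / R"])
    show "integrable (leb_on {0<..<R}) (\<lambda>_. K / R)" by simp
    show "AE r in leb_on {0<..<R}. (\<lambda>n. ?h (u n) r) \<longlonglongrightarrow> ?h a r"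
    proof (rule AE_I2)
      fix r assume "r \<in> space (leb_on {0<..<R})"
      then have "continuous_on {0..} (bessel_profile f L \<alpha> r)" by (intro bessel_profile_continuous[OF f L \<alpha>]) simp
      then have "(\<lambda>n. bessel_profile f L \<alpha> r (u n)) \<longlonglongrightarrow> bessel_profile f L \<alpha> r a"
        using a u by (simp add: continuous_on_sequentially comp_def)
      then show "(\<lambda>n. ?h (u n) r) \<longlonglongrightarrow> ?h a r" by (rule tendsto_mult[OF tendsto_const])
    qed
    show "AE r in leb_on {0<..<R}. norm (?h (u n) r) \<le> K / R" for n
    proof (rule AE_I2)
      fix r assume "r \<in> space (leb_on {0<..<R})"
      then have "norm (?h (u n) r) \<le> K / R / (1 + (u n)\<^sup>2)" using u by (intro K) auto
      also have "\<dots> \<le> K / R / 1" using \<open>K \<ge> 0\<close> R by (intro frac_le) auto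
      finally show "norm (?h (u n) r) \<le> K / R" by simp
    qed
  qed (rule meas)+
qed

text \<open>Fubini's theorem moves the integral over \<open>c\<close> inside, where it inverts the Bessel transform
  for each radius; the decay of the transform, uniform in \<open>r\<close>, makes the double integral absolutely
  convergent.\<close>

lemma radial_coeff_inversion:
  assumes f: "schwartz f" and R: "R > 0" and L: "L > 0" and \<alpha>: "\<alpha> \<ge> 0" and y: "y \<ge> 0"
  shows "(LINT c|leb_on {0..}. radial_coeff f R L \<alpha> l c * of_real (bessel_sqrt (y * c))) =
    4 * (LINT r|leb_on {0<..<R}. of_real (r * cos (real l * (pi / R) * sqrt (R\<^sup>2 - r\<^sup>2))) * profile f L \<alpha> y r)"
proof -
  let ?w = "\<lambda>r. complex_of_real (r * cos (real l * (pi / R) * sqrt (R\<^sup>2 - r\<^sup>2)))"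
  let ?h = "\<lambda>r c. ?w r * bessel_profile f L \<alpha> r c * of_real (bessel_sqrt (y * c))"
  interpret F: finite_measure "leb_on {0<..<R}" by (rule finite_measure_leb_on_Ioo)
  interpret H: sigma_finite_measure "leb_on {0::real..}" by (rule sigma_finite_leb_on) simp
  interpret pair_sigma_finite "leb_on {0<..<R}" "leb_on {0::real..}" ..
  obtain K where K0: "K \<ge> 0" and "\<And>l c. c \<ge> 0 \<Longrightarrow> norm (radial_coeff f R L \<alpha> l c) \<le> K / (1 + c\<^sup>2)"
    and K: "\<And>l r c. r \<in> {0<..<R} \<Longrightarrow> c \<ge> 0 \<Longrightarrow>
       norm (of_real (r * cos (real l * (pi / R) * sqrt (R\<^sup>2 - r\<^sup>2))) * bessel_profile f L \<alpha> r c) \<le> K / R / (1 + c\<^sup>2)"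
    by (rule radial_coeff_bound[OF f R L \<alpha>], rule that)
  have le: "norm (?h r c) \<le> K / R / (1 + c\<^sup>2)" if "r \<in> {0<..<R}" "c \<ge> 0" for r c
  proof -
    have "norm (?h r c) \<le> norm (?w r * bessel_profile f L \<alpha> r c)"
      using abs_bessel_sqrt_le_1[of "y * c"] y that unfolding norm_mult[of _ "of_real (bessel_sqrt (y * c))"] norm_of_real
      by (intro mult_right_le_one_le) auto
    also have "\<dots> \<le> K / R / (1 + c\<^sup>2)" by (rule K[OF that])
    finally show ?thesis .
  qed
  have "(\<lambda>p. bessel_sqrt (y * snd p)) \<in> borel_measurable (borel :: (real \<times> real) measure)"
    unfolding borel_prod[symmetric] by measurable
  then have "(\<lambda>p. ?h (fst p) (snd p)) \<in> borel_measurable borel"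
    by (intro borel_measurable_times[OF radial_integrand_measurable[OF f]] borel_measurable_of_realI)
  from borel_measurable_pair_leb_on[OF this]
  have m: "(\<lambda>p. ?h (fst p) (snd p)) \<in> borel_measurable (leb_on {0<..<R} \<Otimes>\<^sub>M leb_on {0..})" .
  have slice: "?h r \<in> borel_measurable (leb_on {0..})" if "r \<in> {0<..<R}" for r
    using measurable_compose[OF measurable_Pair1'[of r "leb_on {0<..<R}" "leb_on {0..}"] m] that by simp
  have int_le: "(LINT c|leb_on {0..}. norm (?h r c)) \<le> K / R * (LINT c|leb_on {0..}. 1 / (1 + c\<^sup>2))" if "r \<in> {0<..<R}" for r
  proof -
    have "integrable (leb_on {0::real..}) (\<lambda>v. 1 / (1 + v\<^sup>2))"
      by (rule integrable_leb_on_bound[of _ _ 1]) (auto intro!: borel_measurable_leb_onI)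
    from integrable_mult_right[OF this, of "K / R"]
    have i: "integrable (leb_on {0..}) (\<lambda>c. K / R * (1 / (1 + c\<^sup>2)))" .
    have i2: "integrable (leb_on {0..}) (\<lambda>c. norm (?h r c))"
      by (rule integrable_norm[OF integral_inverse_one_plus_square(1)[OF slice[OF that] le[OF that]]])
    have "(LINT c|leb_on {0..}. norm (?h r c)) \<le> (LINT c|leb_on {0..}. K / R * (1 / (1 + c\<^sup>2)))"
    proof (rule integral_mono[OF i2 i])
      show "norm (?h r c) \<le> K / R * (1 / (1 + c\<^sup>2))" if "c \<in> space (leb_on {0..})" for c
        using le[OF \<open>r \<in> {0<..<R}\<close>, of c] that by simp
    qed
    then show ?thesis by (simp only: integral_mult_right_zero)
  qed
  have "integrable (leb_on {0<..<R} \<Otimes>\<^sub>M leb_on {0..}) (\<lambda>p. ?h (fst p) (snd p))"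
  proof (rule Fubini_integrable[OF m])
    show "AE r in leb_on {0<..<R}. integrable (leb_on {0..}) (\<lambda>c. ?h (fst (r, c)) (snd (r, c)))"
      unfolding fst_conv snd_conv space_leb_on
      by (rule AE_I2, rule integral_inverse_one_plus_square(1)[OF slice le]) simp_all
    show "integrable (leb_on {0<..<R}) (\<lambda>r. LINT c|leb_on {0..}. norm (?h (fst (r, c)) (snd (r, c))))"
      unfolding fst_conv snd_conv
    proof (rule F.integrable_const_bound[of _ "K / R * (LINT c|leb_on {0..}. 1 / (1 + c\<^sup>2))"])
      show "AE r in leb_on {0<..<R}. norm (LINT c|leb_on {0..}. norm (?h r c)) \<le> K / R * (LINT c|leb_on {0..}. 1 / (1 + c\<^sup>2))"
      proof (rule AE_I2)
        fix r assume "r \<in> space (leb_on {0<..<R})"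
        moreover have "0 \<le> (LINT c|leb_on {0..}. norm (?h r c))" by (intro integral_nonneg_AE AE_I2) simp
        ultimately show "norm (LINT c|leb_on {0..}. norm (?h r c)) \<le> K / R * (LINT c|leb_on {0..}. 1 / (1 + c\<^sup>2))"
          using int_le[of r] by (simp only: space_leb_on real_norm_def abs_of_nonneg)
      qed
      show "(\<lambda>r. LINT c|leb_on {0..}. norm (?h r c)) \<in> borel_measurable (leb_on {0<..<R})"
        using measurable_compose[OF m borel_measurable_norm]
        by (intro H.borel_measurable_lebesgue_integral) (simp only: case_prod_unfold)
    qed
  qed
  then have "integrable (leb_on {0<..<R} \<Otimes>\<^sub>M leb_on {0..}) (case_prod ?h)"
    by (simp only: case_prod_unfold)
  note Fub = Fubini_integral[OF this]
  have "(LINT c|leb_on {0..}. radial_coeff f R L \<alpha> l c * of_real (bessel_sqrt (y * c))) = (LINT c|leb_on {0..}. LINT r|leb_on {0<..<R}. ?h r c)"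
    unfolding radial_coeff_def by (simp only: integral_mult_left_zero)
  also have "\<dots> = (LINT r|leb_on {0<..<R}. LINT c|leb_on {0..}. ?h r c)" by (rule Fub)
  also have "\<dots> = (LINT r|leb_on {0<..<R}. ?w r * (4 * profile f L \<alpha> y r))"
  proof (rule Bochner_Integration.integral_cong[OF refl])
    fix r assume "r \<in> space (leb_on {0<..<R})"
    then have "(LINT c|leb_on {0..}. bessel_profile f L \<alpha> r c * of_real (bessel_sqrt (y * c))) = 4 * profile f L \<alpha> y r"
      using y by (intro bessel_profile_inversion[OF f L \<alpha>]) auto
    then show "(LINT c|leb_on {0..}. ?h r c) = ?w r * (4 * profile f L \<alpha> y r)"
      unfolding mult.assoc by (simp only: integral_mult_right_zero)
  qed
  also have "\<dots> = (LINT r|leb_on {0<..<R}. 4 * (?w r * profile f L \<alpha> y r))" by (simp only: mult_ac)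
  also have "\<dots> = 4 * (LINT r|leb_on {0<..<R}. ?w r * profile f L \<alpha> y r)" by (rule integral_mult_right_zero)
  finally show ?thesis .
qed


section \<open>Changes of variables\<close>

lemma bessel_sqrt_mult_continuous: "continuous_on A (\<lambda>c. bessel_sqrt (y * c))"
  by (intro continuous_intros)

lemma quartic_weight_le: "a \<ge> 0 \<Longrightarrow> 2 * a / (1 + (a\<^sup>2)\<^sup>2) \<le> 2 / (1 + a\<^sup>2)" for a :: real
proof -
  assume a: "a \<ge> 0"
  have pos: "0 < 1 + a\<^sup>2" "0 < 1 + (a\<^sup>2)\<^sup>2" by (auto intro: add_pos_nonneg)
  have "2 * a \<le> 1 + a\<^sup>2" using zero_le_power2[of "a - 1"] by (simp add: power2_diff)
  then have "2 * a * (1 + a\<^sup>2) \<le> (1 + a\<^sup>2) * (1 + a\<^sup>2)" using pos by (intro mult_right_mono) auto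
  also have "\<dots> \<le> 2 * (1 + (a\<^sup>2)\<^sup>2)"
    using zero_le_power2[of "a\<^sup>2 - 1"] by (simp add: power2_eq_square algebra_simps)
  finally have "2 * a * (1 + a\<^sup>2) \<le> 2 * (1 + (a\<^sup>2)\<^sup>2)" .
  then show ?thesis using pos by (simp add: divide_le_eq le_divide_eq mult.commute)
qed

lemma squared_frequency_substitution:
  fixes F :: "real \<Rightarrow> complex"
  assumes cont: "continuous_on {0..} F" and le: "\<And>c. c \<ge> 0 \<Longrightarrow> norm (F c) \<le> K / (1 + c\<^sup>2)"
  shows "integrable (leb_on {0..}) (\<lambda>a. of_real a * F (a\<^sup>2))"
    and "(LINT a|leb_on {0..}. of_real a * F (a\<^sup>2)) = (LINT c|leb_on {0..}. F c) / 2"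
proof -
  have K: "K \<ge> 0" using order_trans[OF norm_ge_zero le[of 0]] by simp
  have F_int: "integrable (leb_on {0..}) F"
    by (rule integral_inverse_one_plus_square(1)[OF borel_measurable_leb_on_continuous[OF cont] le])
  have cont2: "continuous_on {0..} (\<lambda>a. of_real a * F (a\<^sup>2))"
    by (intro continuous_on_mult continuous_on_of_real continuous_on_id continuous_on_compose2[OF cont] continuous_intros) auto
  have le2: "norm (of_real a * F (a\<^sup>2)) \<le> K / (1 + a\<^sup>2)" if a: "a \<ge> 0" for a
  proof -
    have "norm (of_real a * F (a\<^sup>2)) \<le> a * (K / (1 + (a\<^sup>2)\<^sup>2))"
      using a le[of "a\<^sup>2"] mult_left_mono[OF le[of "a\<^sup>2"] a] by (simp add: norm_mult)
    also have "\<dots> = K / 2 * (2 * a / (1 + (a\<^sup>2)\<^sup>2))" by simp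
    also have "\<dots> \<le> K / 2 * (2 / (1 + a\<^sup>2))" using K by (intro mult_left_mono quartic_weight_le a) auto
    finally show ?thesis by simp
  qed
  show int: "integrable (leb_on {0..}) (\<lambda>a. of_real a * F (a\<^sup>2))"
    by (rule integral_inverse_one_plus_square(1)[OF borel_measurable_leb_on_continuous[OF cont2] le2])
  have meas: "F \<in> borel_measurable (leb_on {0..})" "(\<lambda>a. of_real a * F (a\<^sup>2)) \<in> borel_measurable (leb_on {0..})"
    using F_int int by auto
  have sub: "(LINT c|leb_on {0\<^sup>2<..}. F c) = (LINT a|leb_on {0<..}. of_real (2 * a) * F (a\<^sup>2))"
  proof (rule integral_halfline_substitution[where g = "\<lambda>a. a\<^sup>2"])
    show "((\<lambda>a. a\<^sup>2) has_real_derivative 2 * a) (at a)" for a :: real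
      by (auto intro!: derivative_eq_intros)
    show "isCont (\<lambda>a. 2 * a) a" for a :: real by (intro continuous_intros)
    show "((\<lambda>a::real. a\<^sup>2) \<longlongrightarrow> 0\<^sup>2) (at_right 0)" by (intro tendsto_intros)
    show "filterlim (\<lambda>a::real. a\<^sup>2) at_top at_top" by (rule filterlim_pow_at_top) (auto intro: filterlim_ident)
    show "isCont F (a\<^sup>2)" if "0 < a" for a
    proof -
      have "continuous_on {0<..} F" by (rule continuous_on_subset[OF cont]) auto
      then show ?thesis using that by (auto simp: continuous_on_eq_continuous_at)
    qed
    have "integrable (leb_on {0<..}) (\<lambda>a. of_real a * F (a\<^sup>2))"
      using int leb_on_atLeast_eq_greaterThan(1)[OF meas(2)] by simp
    from integrable_mult_right[OF this, of 2]
    show "integrable (leb_on {0<..}) (\<lambda>a. of_real (2 * a) * F (a\<^sup>2))" by (simp add: mult.assoc)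
    show "integrable (leb_on {0\<^sup>2<..}) F"
      using F_int leb_on_atLeast_eq_greaterThan(1)[OF meas(1)] by simp
  qed auto
  have "(LINT c|leb_on {0..}. F c) = (LINT c|leb_on {0<..}. F c)"
    by (rule leb_on_atLeast_eq_greaterThan(2)[OF meas(1)])
  also have "\<dots> = (LINT a|leb_on {0<..}. 2 * (of_real a * F (a\<^sup>2)))"
    using sub by (simp add: mult.assoc)
  also have "\<dots> = 2 * (LINT a|leb_on {0<..}. of_real a * F (a\<^sup>2))" by (rule integral_mult_right_zero)
  also have "(LINT a|leb_on {0<..}. of_real a * F (a\<^sup>2)) = (LINT a|leb_on {0..}. of_real a * F (a\<^sup>2))"
    by (rule leb_on_atLeast_eq_greaterThan(2)[OF meas(2), symmetric])
  finally show "(LINT a|leb_on {0..}. of_real a * F (a\<^sup>2)) = (LINT c|leb_on {0..}. F c) / 2" by simp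
qed

lemma radial_coeff_frequency_integral:
  assumes f: "schwartz f" and R: "R > 0" and L: "L > 0" and \<alpha>: "\<alpha> \<ge> 0" and y: "y \<ge> 0"
  shows "integrable (leb_on {0..}) (\<lambda>a. of_real a * (radial_coeff f R L \<alpha> l (a\<^sup>2) * of_real (bessel_sqrt (y * a\<^sup>2))))"
    and "(LINT a|leb_on {0..}. of_real a * (radial_coeff f R L \<alpha> l (a\<^sup>2) * of_real (bessel_sqrt (y * a\<^sup>2)))) =
      2 * (LINT r|leb_on {0<..<R}. of_real (r * cos (real l * (pi / R) * sqrt (R\<^sup>2 - r\<^sup>2))) * profile f L \<alpha> y r)"
proof -
  let ?F = "\<lambda>c. radial_coeff f R L \<alpha> l c * of_real (bessel_sqrt (y * c))"
  have cont: "continuous_on {0..} ?F"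
    by (intro continuous_on_mult continuous_on_of_real radial_coeff_continuous[OF f R L \<alpha>] bessel_sqrt_mult_continuous)
  obtain K where "K \<ge> 0" and K: "\<And>l c. c \<ge> 0 \<Longrightarrow> norm (radial_coeff f R L \<alpha> l c) \<le> K / (1 + c\<^sup>2)"
    by (rule radial_coeff_bound[OF f R L \<alpha>], rule that)
  have le: "norm (?F c) \<le> K / (1 + c\<^sup>2)" if c: "c \<ge> 0" for c
  proof -
    have "norm (?F c) \<le> norm (radial_coeff f R L \<alpha> l c)"
      using abs_bessel_sqrt_le_1[of "y * c"] y c unfolding norm_mult norm_of_real
      by (intro mult_right_le_one_le) auto
    also have "\<dots> \<le> K / (1 + c\<^sup>2)" by (rule K[OF c])
    finally show ?thesis .
  qed
  note sub = squared_frequency_substitution[OF cont le]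
  show "integrable (leb_on {0..}) (\<lambda>a. of_real a * ?F (a\<^sup>2))" by (rule sub(1))
  show "(LINT a|leb_on {0..}. of_real a * ?F (a\<^sup>2)) =
      2 * (LINT r|leb_on {0<..<R}. of_real (r * cos (real l * (pi / R) * sqrt (R\<^sup>2 - r\<^sup>2))) * profile f L \<alpha> y r)"
  proof -
    have "(LINT a|leb_on {0..}. of_real a * ?F (a\<^sup>2)) = (LINT c|leb_on {0..}. ?F c) / 2" by (rule sub(2))
    also have "\<dots> = 4 * (LINT r|leb_on {0<..<R}. of_real (r * cos (real l * (pi / R) * sqrt (R\<^sup>2 - r\<^sup>2))) * profile f L \<alpha> y r) / 2"
      by (simp only: radial_coeff_inversion[OF f R L \<alpha> y])
    finally show ?thesis by (simp only: times_divide_eq_left [symmetric]) simp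
  qed
qed

text \<open>The substitution \<open>v = x\<^sup>2 - L\<^sup>2\<close>, for which \<open>x dx = dv / 2\<close>.\<close>

lemma axial_substitution:
  assumes f: "schwartz f" and L: "L > 0" and \<alpha>: "\<alpha> \<ge> 0" and r: "r \<ge> 0"
  shows "(LINT x|leb_on {L<..}. of_real (bessel_J0 (a * sqrt (x\<^sup>2 - L\<^sup>2)) * x) * (of_real ((x\<^sup>2) powr - \<alpha>) * circular_mean f x r)) =
    bessel_profile f L \<alpha> r (a\<^sup>2) / 2"
proof -
  define F where "F = (\<lambda>x. of_real (bessel_sqrt (a\<^sup>2 * (x\<^sup>2 - L\<^sup>2)) * x) * (of_real ((x\<^sup>2) powr - \<alpha>) * circular_mean f x r))"
  define k where "k = (\<lambda>v. profile f L \<alpha> v r * of_real (bessel_sqrt (a\<^sup>2 * v)))"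
  define q where "q = (\<lambda>v. sqrt (v + L\<^sup>2))"
  have pos: "v + L\<^sup>2 > 0" if "v \<ge> 0" for v using L that by (simp add: add_nonneg_pos)
  have q0: "q 0 = L" using L by (simp add: q_def)
  have qF: "of_real (1 / (2 * q v)) * F (q v) = k v / 2" if "v \<ge> 0" for v
  proof -
    have q2: "(q v)\<^sup>2 = v + L\<^sup>2" using pos[OF that] by (simp add: q_def)
    have q_nz: "q v \<noteq> 0" using pos[OF that] by (simp add: q_def)
    have eq: "profile f L \<alpha> v r = of_real ((v + L\<^sup>2) powr - \<alpha>) * circular_mean f (q v) r"
      by (simp only: profile_def q_def)
    have "of_real (1 / (2 * q v)) * (of_real (B * q v) * z) = z * of_real B / 2" for B and z :: complex
      using q_nz by (simp add: field_simps)
    then show ?thesis unfolding F_def k_def q2 eq by (simp only: add_diff_cancel_right')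
  qed
  have F_int: "integrable (leb_on {L<..}) F"
  proof -
    obtain C where C: "C \<ge> 0" "\<And>x r. norm (circular_mean f x r) \<le> C * (1 + r\<^sup>2) ^ 2 / (1 + x\<^sup>2) ^ 2"
      by (rule circular_mean_decay[OF f], rule that)
    have [measurable]: "(\<lambda>x. circular_mean f x r) \<in> borel_measurable borel"
      by (rule borel_measurable_continuous_onI[OF circular_mean_slices(2)[OF f]])
    show ?thesis
    proof (rule integrable_leb_on_bound)
      show "F \<in> borel_measurable (leb_on {L<..})"
        unfolding F_def by (rule borel_measurable_leb_onI) measurable
      fix x assume "x \<in> {L<..}"
      then have x: "x > L" "x \<ge> 0" using L by auto
      have "L\<^sup>2 \<le> x\<^sup>2" using x L by (intro power_mono) auto
      then have b: "\<bar>bessel_sqrt (a\<^sup>2 * (x\<^sup>2 - L\<^sup>2))\<bar> \<le> 1" by (intro abs_bessel_sqrt_le_1) simp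
      have pw: "(x\<^sup>2) powr - \<alpha> \<le> (L\<^sup>2) powr - \<alpha>"
        using \<open>L\<^sup>2 \<le> x\<^sup>2\<close> L \<alpha> by (intro powr_mono2') auto
      have "norm (F x) = \<bar>bessel_sqrt (a\<^sup>2 * (x\<^sup>2 - L\<^sup>2))\<bar> * x * ((x\<^sup>2) powr - \<alpha> * norm (circular_mean f x r))"
        using x by (simp add: F_def norm_mult abs_mult)
      also have "\<dots> \<le> 1 * x * ((L\<^sup>2) powr - \<alpha> * (C * (1 + r\<^sup>2) ^ 2 / (1 + x\<^sup>2) ^ 2))"
        using x b pw C by (intro mult_mono) auto
      also have "\<dots> = (L\<^sup>2) powr - \<alpha> * (C * (1 + r\<^sup>2) ^ 2) * (x / (1 + x\<^sup>2) ^ 2)" by simp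
      also have "\<dots> \<le> (L\<^sup>2) powr - \<alpha> * (C * (1 + r\<^sup>2) ^ 2) * (1 / (1 + x\<^sup>2))"
        using C x by (intro mult_left_mono weight_le) auto
      finally show "norm (F x) \<le> (L\<^sup>2) powr - \<alpha> * (C * (1 + r\<^sup>2) ^ 2) / (1 + x\<^sup>2)" by simp
    qed simp
  qed
  have k_int: "integrable (leb_on {0..}) k"
    unfolding k_def
    by (rule integrable_cosine_transform_product[OF profile_integrable[OF f L \<alpha> r]]) (auto intro: abs_bessel_sqrt_le_1)
  have k_int': "integrable (leb_on {0<..}) k"
    using k_int leb_on_atLeast_eq_greaterThan(1)[OF borel_measurable_integrable[OF k_int]] by simp
  have "(LINT x|leb_on {q 0<..}. F x) = (LINT v|leb_on {0<..}. of_real (1 / (2 * q v)) * F (q v))"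
  proof (rule integral_halfline_substitution)
    show "(q has_real_derivative 1 / (2 * q v)) (at v)" if "0 < v" for v
    proof -
      have p: "v + L\<^sup>2 > 0" using pos that by simp
      have "(q has_real_derivative inverse (sqrt (v + L\<^sup>2)) / 2 * 1) (at v)"
        unfolding q_def using DERIV_real_sqrt[OF p]
        by (rule DERIV_chain2) (auto intro!: derivative_eq_intros)
      moreover have "inverse (sqrt (v + L\<^sup>2)) / 2 * 1 = 1 / (2 * q v)" by (simp add: q_def field_simps)
      ultimately show ?thesis by (simp only:)
    qed
    show "isCont (\<lambda>v. 1 / (2 * q v)) v" if "0 < v" for v
      unfolding q_def using pos[of v] that by (intro continuous_intros) auto
    show "0 \<le> 1 / (2 * q v)" if "0 \<le> v" for v using pos[OF that] by (simp add: q_def)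
    have "isCont q 0" unfolding q_def by (intro continuous_intros)
    then show "(q \<longlongrightarrow> q 0) (at_right 0)" by (simp add: isCont_def filterlim_at_split)
    have "filterlim (\<lambda>v. v + L\<^sup>2) at_top at_top"
      by (rule filterlim_at_top_mono[OF filterlim_ident]) (intro always_eventually; simp)
    then show "filterlim q at_top at_top"
      unfolding q_def by (rule filterlim_compose[OF sqrt_at_top])
    show "isCont F (q v)" if "0 < v" for v
    proof -
      have "continuous_on {0<..} F"
        unfolding F_def
        by (intro continuous_on_mult continuous_on_of_real continuous_on_bessel_sqrt continuous_on_powr
            circular_mean_slices(2)[OF f] continuous_intros) auto
      moreover have "q v > 0" using pos[of v] that by (simp add: q_def)
      ultimately show ?thesis by (simp add: continuous_on_eq_continuous_at)
    qed
    have "integrable (leb_on {0<..}) (\<lambda>v. k v / 2)" using k_int' by simp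
    then show "integrable (leb_on {0<..}) (\<lambda>v. of_real (1 / (2 * q v)) * F (q v))"
      by (rule Bochner_Integration.integrable_cong[THEN iffD2, OF refl, rotated])
        (simp only: qF space_leb_on greaterThan_iff less_imp_le)
    show "integrable (leb_on {q 0<..}) F" unfolding q0 by (rule F_int)
  qed
  also have "\<dots> = (LINT v|leb_on {0<..}. k v / 2)"
    by (intro Bochner_Integration.integral_cong refl) (simp only: qF space_leb_on greaterThan_iff less_imp_le)
  also have "\<dots> = (LINT v|leb_on {0<..}. k v) / 2" by simp
  also have "(LINT v|leb_on {0<..}. k v) = (LINT v|leb_on {0..}. k v)"
    by (rule leb_on_atLeast_eq_greaterThan(2)[OF borel_measurable_integrable[OF k_int], symmetric])
  also have "(LINT v|leb_on {0..}. k v) = bessel_profile f L \<alpha> r (a\<^sup>2)" by (simp only: k_def bessel_profile_def)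
  finally have main: "(LINT x|leb_on {L<..}. F x) = bessel_profile f L \<alpha> r (a\<^sup>2) / 2" unfolding q0 .
  have "(LINT x|leb_on {L<..}. of_real (bessel_J0 (a * sqrt (x\<^sup>2 - L\<^sup>2)) * x) * (of_real ((x\<^sup>2) powr - \<alpha>) * circular_mean f x r)) = (LINT x|leb_on {L<..}. F x)"
  proof (rule Bochner_Integration.integral_cong[OF refl])
    fix x assume "x \<in> space (leb_on {L<..})"
    then have "L\<^sup>2 \<le> x\<^sup>2" using L by (intro power_mono) auto
    then have "(a * sqrt (x\<^sup>2 - L\<^sup>2))\<^sup>2 = a\<^sup>2 * (x\<^sup>2 - L\<^sup>2)" by (simp add: power_mult_distrib)
    then show "of_real (bessel_J0 (a * sqrt (x\<^sup>2 - L\<^sup>2)) * x) * (of_real ((x\<^sup>2) powr - \<alpha>) * circular_mean f x r) = F x"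
      by (simp only: bessel_J0_eq F_def)
  qed
  then show ?thesis unfolding main .
qed

text \<open>The substitution \<open>s = sqrt (R\<^sup>2 - r\<^sup>2)\<close> reverses the orientation, and its derivative is
  unbounded at the exceptional point \<open>r = R\<close>.\<close>

lemma radius_substitution:
  fixes q :: "real \<Rightarrow> complex"
  assumes R: "R > 0" and q: "continuous_on UNIV q"
  shows "(LINT r|leb_on {0<..<R}. of_real (r * cos (m * sqrt (R\<^sup>2 - r\<^sup>2))) * q r) =
    (LINT s|leb_on {0<..<R}. of_real (cos (m * s)) * (of_real s * q (sqrt (R\<^sup>2 - s\<^sup>2))))"
proof -
  define F where "F = (\<lambda>s. of_real (cos (m * s)) * (of_real s * q (sqrt (R\<^sup>2 - s\<^sup>2))))"
  define g where "g = (\<lambda>r::real. sqrt (R\<^sup>2 - r\<^sup>2))"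
  have F_cont: "continuous_on UNIV F"
    unfolding F_def
    by (intro continuous_on_mult continuous_on_of_real continuous_on_compose2[OF q] continuous_intros) auto
  have g_cont: "continuous_on {0..R} g" unfolding g_def by (intro continuous_intros)
  have h_cont: "continuous_on UNIV (\<lambda>r. of_real (r * cos (m * sqrt (R\<^sup>2 - r\<^sup>2))) * q r)"
    by (intro continuous_on_mult q continuous_intros)
  have g_range: "g ` {0..R} \<subseteq> {0..R}"
  proof safe
    fix r assume r: "r \<in> {0..R}"
    have "R\<^sup>2 - r\<^sup>2 \<le> R\<^sup>2" "r\<^sup>2 \<le> R\<^sup>2" using r by (auto intro: power_mono)
    then show "g r \<in> {0..R}" using R by (auto simp: g_def intro!: real_le_lsqrt)
  qed
  have "((\<lambda>r. (- r / g r) *\<^sub>R F (g r)) has_integral (integral {g 0..g R} F - integral {g R..g 0} F)) {0..R}"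
  proof (rule has_integral_substitution_general[of "{R}"])
    show "continuous_on {0..R} F" by (rule continuous_on_subset[OF F_cont]) simp
    show "(g has_real_derivative - r / g r) (at r within {0..R})" if "r \<in> {0..R} - {R}" for r
    proof -
      have "r\<^sup>2 < R\<^sup>2" using that R by (intro power_strict_mono) auto
      then have p: "R\<^sup>2 - r\<^sup>2 > 0" by simp
      have "(g has_real_derivative inverse (sqrt (R\<^sup>2 - r\<^sup>2)) / 2 * (- (2 * r))) (at r)"
        unfolding g_def using DERIV_real_sqrt[OF p]
        by (rule DERIV_chain2) (auto intro!: derivative_eq_intros)
      moreover have "inverse (sqrt (R\<^sup>2 - r\<^sup>2)) / 2 * (- (2 * r)) = - r / g r" by (simp add: g_def field_simps)
      ultimately have "(g has_real_derivative - r / g r) (at r)" by (simp only:)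
      then show ?thesis by (rule has_field_derivative_at_within)
    qed
  qed (use R g_cont g_range in auto)
  moreover have "g 0 = R" "g R = 0" using R by (simp_all add: g_def)
  ultimately have "((\<lambda>r. (- r / g r) *\<^sub>R F (g r)) has_integral (- integral {0..R} F)) {0..R}"
    using R by simp
  from has_integral_neg[OF this]
  have 1: "((\<lambda>r. - ((- r / g r) *\<^sub>R F (g r))) has_integral integral {0..R} F) {0..R}" by simp
  have "((\<lambda>r. of_real (r * cos (m * sqrt (R\<^sup>2 - r\<^sup>2))) * q r) has_integral integral {0..R} F) {0..R}"
  proof (rule has_integral_spike_finite[OF _ _ 1])
    show "finite {R}" by simp
    fix r assume r: "r \<in> {0..R} - {R}"
    then have "r\<^sup>2 < R\<^sup>2" using R by (intro power_strict_mono) auto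
    then have "g r \<noteq> 0" by (simp add: g_def)
    moreover have "sqrt (R\<^sup>2 - (g r)\<^sup>2) = r" using \<open>r\<^sup>2 < R\<^sup>2\<close> r by (simp add: g_def)
    moreover have "sqrt (R\<^sup>2 - r\<^sup>2) = g r" by (simp add: g_def)
    ultimately show "of_real (r * cos (m * sqrt (R\<^sup>2 - r\<^sup>2))) * q r = - ((- r / g r) *\<^sub>R F (g r))"
      by (simp add: F_def scaleR_conv_of_real)
  qed
  then have eq: "integral {0..R} (\<lambda>r. of_real (r * cos (m * sqrt (R\<^sup>2 - r\<^sup>2))) * q r) = integral {0..R} F"
    by (rule integral_unique)
  have conv: "(LINT r|leb_on {0<..<R}. h r) = integral {0..R} h" if h: "continuous_on UNIV h" for h :: "real \<Rightarrow> complex"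
  proof -
    have "set_integrable lborel {0..R} h"
      by (rule borel_integrable_atLeastAtMost') (rule continuous_on_subset[OF h], simp)
    then have "(LINT r:{0..R}|lborel. h r) = integral {0..R} h" by (rule set_borel_integral_eq_integral)
    moreover have "(LINT r|leb_on {0<..<R}. h r) = (LINT r:{0..R}|lborel. h r)"
      unfolding set_lebesgue_integral_def
    proof (subst integral_restrict_space)
      have [measurable]: "h \<in> borel_measurable borel" by (rule borel_measurable_continuous_onI[OF h])
      show "(LINT x|lborel. indicator {0<..<R} x *\<^sub>R h x) = (LINT x|lborel. indicator {0..R} x *\<^sub>R h x)"
      proof (rule integral_cong_AE)
        show "AE x in lborel. indicator {0<..<R} x *\<^sub>R h x = indicator {0..R} x *\<^sub>R h x"
          using AE_lborel_singleton[of 0] AE_lborel_singleton[of R]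
          by eventually_elim (auto simp: indicator_def)
      qed measurable
    qed simp
    ultimately show ?thesis by simp
  qed
  show ?thesis
    using eq unfolding conv[OF h_cont] conv[OF F_cont, symmetric] by (simp only: F_def)
qed


section \<open>The even and odd expansions\<close>

lemma iint_cong:
  assumes "\<And>s t. s \<in> A \<Longrightarrow> t \<in> B \<Longrightarrow> h s t = h' s t"
  shows "iint (leb_on A) (leb_on B) h = iint (leb_on A) (leb_on B) h'"
  unfolding iint_def by (intro Bochner_Integration.integral_cong refl) (simp add: assms)

lemma iint_finite_cong:
  assumes "\<And>s t. s \<in> A \<Longrightarrow> t \<in> B \<Longrightarrow> h s t = h' s t"
  shows "iint_finite (leb_on A) (leb_on B) h \<longleftrightarrow> iint_finite (leb_on A) (leb_on B) h'"
proof -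
  have 1: "integrable (leb_on B) (h s) \<longleftrightarrow> integrable (leb_on B) (h' s)" if "s \<in> A" for s
    by (rule Bochner_Integration.integrable_cong[OF refl]) (simp add: assms that)
  have 2: "(LINT t|leb_on B. h s t) = (LINT t|leb_on B. h' s t)" if "s \<in> A" for s
    by (rule Bochner_Integration.integral_cong[OF refl]) (simp add: assms that)
  have 3: "integrable (leb_on A) (\<lambda>s. LINT t|leb_on B. h s t) \<longleftrightarrow> integrable (leb_on A) (\<lambda>s. LINT t|leb_on B. h' s t)"
    by (rule Bochner_Integration.integrable_cong[OF refl]) (simp add: 2)
  show ?thesis unfolding iint_finite_def space_leb_on using 1 3 by blast
qed

text \<open>In both pairings the weight cancels the singular factor \<open>1 / sqrt (R\<^sup>2 - r\<^sup>2)\<close>. What remains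
  is bounded in \<open>r\<close> and of order \<open>x / (1 + x\<^sup>2)\<^sup>2\<close> in \<open>x\<close>.\<close>

lemma pairing_integrand_finite:
  fixes J :: "real \<Rightarrow> real" and v :: "real \<Rightarrow> real \<Rightarrow> complex"
  assumes R: "R > 0" and L: "L > 0"
    and J: "J \<in> borel_measurable borel" "\<And>x. x > L \<Longrightarrow> \<bar>J x\<bar> \<le> M * x" and M: "M \<ge> 0"
    and v: "(\<lambda>p. v (fst p) (snd p)) \<in> borel_measurable borel"
      "\<And>x r. r \<in> {0<..<R} \<Longrightarrow> norm (v x r) \<le> C / (1 + x\<^sup>2) ^ 2"
  shows "iint_finite (leb_on {0<..<R}) (leb_on {L<..})
    (\<lambda>r x. of_real (J x * (r * cos (m * sqrt (R\<^sup>2 - r\<^sup>2)))) * v x r)"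
proof -
  let ?h = "\<lambda>r x. of_real (J x * (r * cos (m * sqrt (R\<^sup>2 - r\<^sup>2)))) * v x r"
  interpret F: finite_measure "leb_on {0<..<R}" by (rule finite_measure_leb_on_Ioo)
  interpret H: sigma_finite_measure "leb_on {L<..}" by (rule sigma_finite_leb_on) simp
  have C: "C \<ge> 0" using order_trans[OF norm_ge_zero v(2)[of "R / 2" 0]] R by simp
  have swap: "(\<lambda>p. (snd p, fst p)) \<in> measurable (borel :: (real \<times> real) measure) (borel :: (real \<times> real) measure)"
    unfolding borel_prod[symmetric] by measurable
  have v': "(\<lambda>p. v (snd p) (fst p)) \<in> borel_measurable (borel :: (real \<times> real) measure)"
    using measurable_compose[OF swap v(1)] by (simp only: fst_conv snd_conv)
  have "(\<lambda>p. J (snd p) * (fst p * cos (m * sqrt (R\<^sup>2 - (fst p)\<^sup>2)))) \<in> borel_measurable (borel :: (real \<times> real) measure)"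
    using J(1) unfolding borel_prod[symmetric] by measurable
  then have h_meas: "(\<lambda>p. ?h (fst p) (snd p)) \<in> borel_measurable borel"
    by (rule borel_measurable_times[OF borel_measurable_of_realI v'])
  note m = borel_measurable_pair_leb_on[OF h_meas, of "{0<..<R}" "{L<..}"]
  have slice: "?h r \<in> borel_measurable (leb_on {L<..})" if "r \<in> {0<..<R}" for r
    using measurable_compose[OF measurable_Pair1'[of r "leb_on {0<..<R}" "leb_on {L<..}"] m] that by simp
  have le: "norm (?h r x) \<le> M * R * C / (1 + x\<^sup>2)" if r: "r \<in> {0<..<R}" and x: "x \<in> {L<..}" for r x
  proof -
    have x0: "x \<ge> 0" using x L by simp
    have "\<bar>r * cos (m * sqrt (R\<^sup>2 - r\<^sup>2))\<bar> \<le> R * 1"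
      unfolding abs_mult using r by (intro mult_mono) auto
    then have "\<bar>J x\<bar> * \<bar>r * cos (m * sqrt (R\<^sup>2 - r\<^sup>2))\<bar> \<le> (M * x) * (R * 1)"
      using J(2)[of x] x x0 M by (intro mult_mono) auto
    then have "\<bar>J x * (r * cos (m * sqrt (R\<^sup>2 - r\<^sup>2)))\<bar> \<le> (M * x) * R" by (simp only: abs_mult mult_1_right)
    then have "norm (?h r x) \<le> (M * x) * R * (C / (1 + x\<^sup>2) ^ 2)"
      unfolding norm_mult[of "of_real _"] norm_of_real using v(2)[OF r] M x0 R by (intro mult_mono) auto
    also have "\<dots> = M * R * C * (x / (1 + x\<^sup>2) ^ 2)" by simp
    also have "\<dots> \<le> M * R * C * (1 / (1 + x\<^sup>2))"
      using M R C x0 by (intro mult_left_mono weight_le) auto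
    finally show ?thesis by simp
  qed
  have int: "integrable (leb_on {L<..}) (?h r)" if "r \<in> {0<..<R}" for r
    by (rule integrable_leb_on_bound[OF _ slice[OF that] le[OF that]]) simp_all
  define B where "B = (LINT x|leb_on {L<..}. M * R * C / (1 + x\<^sup>2))"
  have B_int: "integrable (leb_on {L<..}) (\<lambda>x. M * R * C / (1 + x\<^sup>2))"
  proof (rule integrable_leb_on_bound[where C = "M * R * C"])
    show "(\<lambda>x. M * R * C / (1 + x\<^sup>2)) \<in> borel_measurable (leb_on {L<..})"
      by (rule borel_measurable_leb_onI) measurable
  qed (use M R C in simp_all)
  have "integrable (leb_on {0<..<R}) (\<lambda>r. LINT x|leb_on {L<..}. ?h r x)"
  proof (rule F.integrable_const_bound[of _ B])
    show "AE r in leb_on {0<..<R}. norm (LINT x|leb_on {L<..}. ?h r x) \<le> B"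
    proof (rule AE_I2)
      fix r assume "r \<in> space (leb_on {0<..<R})"
      then have r: "r \<in> {0<..<R}" by simp
      have "norm (LINT x|leb_on {L<..}. ?h r x) \<le> (LINT x|leb_on {L<..}. norm (?h r x))"
        by (rule integral_norm_bound)
      also have "\<dots> \<le> B"
        unfolding B_def
        by (rule integral_mono[OF integrable_norm[OF int[OF r]] B_int]) (use le[OF r] in simp)
      finally show "norm (LINT x|leb_on {L<..}. ?h r x) \<le> B" .
    qed
    show "(\<lambda>r. LINT x|leb_on {L<..}. ?h r x) \<in> borel_measurable (leb_on {0<..<R})"
      using m by (intro H.borel_measurable_lebesgue_integral) (simp only: case_prod_unfold)
  qed
  then show ?thesis
    unfolding iint_finite_def space_leb_on using int by blast
qed

lemma integrand_even_o_even:
  assumes "r \<in> {0<..<R}" "x \<in> {L<..}" "L > 0"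
  shows "integrand_even R (o_even R L a l) v r x =
    of_real ((bessel_J0 (a * sqrt (x\<^sup>2 - L\<^sup>2)) * x) * (r * cos (real l * (pi / R) * sqrt (R\<^sup>2 - r\<^sup>2)))) * v x r"
proof -
  define s where "s = sqrt (R\<^sup>2 - r\<^sup>2)"
  have "r\<^sup>2 < R\<^sup>2" using assms by (intro power_strict_mono) auto
  then have "s \<noteq> 0" by (simp add: s_def)
  then show ?thesis
    using assms unfolding integrand_even_def o_even_def s_def[symmetric] by (simp add: field_simps)
qed

lemma integrand_odd_o_odd:
  assumes "r \<in> {0<..<R}" "x \<in> {L<..}" "L > 0"
  shows "integrand_odd R (o_odd R L a l) v r x =
    of_real (bessel_J0 (a * sqrt (x\<^sup>2 - L\<^sup>2)) * (r * cos (real l * (pi / R) * sqrt (R\<^sup>2 - r\<^sup>2)))) * v x r"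
proof -
  define s where "s = sqrt (R\<^sup>2 - r\<^sup>2)"
  have "r\<^sup>2 < R\<^sup>2" using assms by (intro power_strict_mono) auto
  then have "s \<noteq> 0" "x \<noteq> 0" using assms by (auto simp: s_def)
  then show ?thesis
    using assms unfolding integrand_odd_def o_odd_def o_even_def s_def[symmetric] by (simp add: field_simps)
qed

lemma abs_bessel_J0_le_1: "\<bar>bessel_J0 z\<bar> \<le> 1"
  unfolding bessel_J0_eq by (rule abs_bessel_sqrt_le_1) simp

lemma bessel_J0_measurable: "(\<lambda>x. bessel_J0 (a * sqrt (x\<^sup>2 - L\<^sup>2))) \<in> borel_measurable borel"
  unfolding bessel_J0_eq by measurable

lemma reflected_mean_bounds:
  assumes f: "schwartz f"
  obtains C where "C \<ge> 0"
    "\<And>x r. r \<in> {0<..<R} \<Longrightarrow> norm (circular_mean f x r + circular_mean f (- x) r) \<le> C / (1 + x\<^sup>2) ^ 2"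
    "\<And>x r. r \<in> {0<..<R} \<Longrightarrow> norm (circular_mean f x r - circular_mean f (- x) r) \<le> C / (1 + x\<^sup>2) ^ 2"
proof -
  obtain C where C: "C \<ge> 0" "\<And>x r. norm (circular_mean f x r) \<le> C * (1 + r\<^sup>2) ^ 2 / (1 + x\<^sup>2) ^ 2"
    by (rule circular_mean_decay[OF f], rule that)
  define D where "D = C * (1 + R\<^sup>2) ^ 2"
  have le: "norm (circular_mean f x r) \<le> D / (1 + x\<^sup>2) ^ 2" if "r \<in> {0<..<R}" for x r
  proof -
    have "C * (1 + r\<^sup>2) ^ 2 \<le> D"
      unfolding D_def using C(1) that by (intro mult_left_mono power_mono add_left_mono) auto
    then have "C * (1 + r\<^sup>2) ^ 2 / (1 + x\<^sup>2) ^ 2 \<le> D / (1 + x\<^sup>2) ^ 2" by (intro divide_right_mono) auto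
    with C(2)[of x r] show ?thesis by linarith
  qed
  show ?thesis
  proof (rule that[of "2 * D"])
    show "2 * D \<ge> 0" using C by (simp add: D_def)
    fix x r assume r: "r \<in> {0<..<R}"
    have eq: "2 * D / (1 + x\<^sup>2) ^ 2 = D / (1 + x\<^sup>2) ^ 2 + D / (1 + x\<^sup>2) ^ 2" by simp
    have "norm (circular_mean f (- x) r) \<le> D / (1 + x\<^sup>2) ^ 2" using le[OF r, of "- x"] by simp
    then have sum: "norm (circular_mean f x r) + norm (circular_mean f (- x) r) \<le> 2 * D / (1 + x\<^sup>2) ^ 2"
      unfolding eq using le[OF r, of x] by linarith
    show "norm (circular_mean f x r + circular_mean f (- x) r) \<le> 2 * D / (1 + x\<^sup>2) ^ 2"
      by (rule order_trans[OF norm_triangle_ineq sum])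
    show "norm (circular_mean f x r - circular_mean f (- x) r) \<le> 2 * D / (1 + x\<^sup>2) ^ 2"
      by (rule order_trans[OF norm_triangle_ineq4 sum])
  qed
qed

lemma reflected_mean_measurable:
  assumes f: "schwartz f"
  shows "(\<lambda>p. circular_mean f (fst p) (snd p) + circular_mean f (- fst p) (snd p)) \<in> borel_measurable borel"
    and "(\<lambda>p. circular_mean f (fst p) (snd p) - circular_mean f (- fst p) (snd p)) \<in> borel_measurable borel"
proof -
  note cont = continuous_on_circular_mean[OF f]
  have 1: "(\<lambda>p. circular_mean f (fst p) (snd p)) \<in> borel_measurable borel"
    by (rule borel_measurable_continuous_onI[OF cont])
  have "(\<lambda>p. circular_mean f (- fst p) (snd p)) \<in> borel_measurable ((borel :: real measure) \<Otimes>\<^sub>M (borel :: real measure))"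
    by (rule borel_measurable_continuous_Pair[OF _ _ cont]) measurable
  then have 2: "(\<lambda>p. circular_mean f (- fst p) (snd p)) \<in> borel_measurable borel" by (simp only: borel_prod)
  show "(\<lambda>p. circular_mean f (fst p) (snd p) + circular_mean f (- fst p) (snd p)) \<in> borel_measurable borel"
    by (rule borel_measurable_add[OF 1 2])
  show "(\<lambda>p. circular_mean f (fst p) (snd p) - circular_mean f (- fst p) (snd p)) \<in> borel_measurable borel"
    by (rule borel_measurable_diff[OF 1 2])
qed

lemma G_even_well_defined_circular_mean:
  assumes f: "schwartz f" and R: "R > 0" and L: "L > 0"
  shows "G_even_well_defined R L (circular_mean f) l a"
proof -
  obtain C where C: "C \<ge> 0"
    "\<And>x r. r \<in> {0<..<R} \<Longrightarrow> norm (circular_mean f x r + circular_mean f (- x) r) \<le> C / (1 + x\<^sup>2) ^ 2"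
    by (rule reflected_mean_bounds[OF f, of R], rule that)
  let ?J = "\<lambda>x. bessel_J0 (a * sqrt (x\<^sup>2 - L\<^sup>2)) * x"
  have J: "?J \<in> borel_measurable borel" by (intro borel_measurable_times bessel_J0_measurable) simp
  have J_le: "\<bar>?J x\<bar> \<le> 1 * x" if "x > L" for x
    unfolding abs_mult using that L by (intro mult_mono abs_bessel_J0_le_1) auto
  show ?thesis
    unfolding G_even_well_defined_def pairing_even_finite_def
  proof (rule iffD2[OF iint_finite_cong])
    show "integrand_even R (o_even R L a l) (\<lambda>x r. circular_mean f x r + circular_mean f (- x) r) r x =
       of_real (?J x * (r * cos (real l * (pi / R) * sqrt (R\<^sup>2 - r\<^sup>2)))) * (circular_mean f x r + circular_mean f (- x) r)"
      if "r \<in> {0<..<R}" "x \<in> {L<..}" for r x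
      by (rule integrand_even_o_even[OF that L])
    show "iint_finite (leb_on {0<..<R}) (leb_on {L<..}) (\<lambda>r x.
       of_real (?J x * (r * cos (real l * (pi / R) * sqrt (R\<^sup>2 - r\<^sup>2)))) * (circular_mean f x r + circular_mean f (- x) r))"
      by (rule pairing_integrand_finite[OF R L J J_le zero_le_one reflected_mean_measurable(1)[OF f] C(2)])
  qed
qed

lemma G_odd_well_defined_circular_mean:
  assumes f: "schwartz f" and R: "R > 0" and L: "L > 0"
  shows "G_odd_well_defined R L (circular_mean f) l a"
proof -
  obtain C where C: "C \<ge> 0"
    "\<And>x r. r \<in> {0<..<R} \<Longrightarrow> norm (circular_mean f x r - circular_mean f (- x) r) \<le> C / (1 + x\<^sup>2) ^ 2"
    by (rule reflected_mean_bounds[OF f, of R], rule that)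
  let ?J = "\<lambda>x. bessel_J0 (a * sqrt (x\<^sup>2 - L\<^sup>2))"
  have J_le: "\<bar>?J x\<bar> \<le> 1 / L * x" if "x > L" for x
  proof -
    have "1 \<le> 1 / L * x" using that L by simp
    with abs_bessel_J0_le_1 show ?thesis by (rule order_trans)
  qed
  have "0 \<le> 1 / L" using L by simp
  note M = this
  show ?thesis
    unfolding G_odd_well_defined_def pairing_odd_finite_def
  proof (rule iffD2[OF iint_finite_cong])
    show "integrand_odd R (o_odd R L a l) (\<lambda>x r. circular_mean f x r - circular_mean f (- x) r) r x =
       of_real (?J x * (r * cos (real l * (pi / R) * sqrt (R\<^sup>2 - r\<^sup>2)))) * (circular_mean f x r - circular_mean f (- x) r)"
      if "r \<in> {0<..<R}" "x \<in> {L<..}" for r x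
      by (rule integrand_odd_o_odd[OF that L])
    show "iint_finite (leb_on {0<..<R}) (leb_on {L<..}) (\<lambda>r x.
       of_real (?J x * (r * cos (real l * (pi / R) * sqrt (R\<^sup>2 - r\<^sup>2)))) * (circular_mean f x r - circular_mean f (- x) r))"
      by (rule pairing_integrand_finite[OF R L bessel_J0_measurable J_le M reflected_mean_measurable(2)[OF f] C(2)])
  qed
qed

text \<open>By parity \<open>g x r \<plusminus> g (- x) r = 2 * g x r\<close>; this factor \<open>2\<close> cancels the \<open>1 / 2\<close> from \<open>x dx =
  dv / 2\<close>.\<close>

lemma pairing_eq_radial_coeff:
  assumes f: "schwartz f" and L: "L > 0" and \<alpha>: "\<alpha> \<ge> 0"
    and h: "\<And>r x. r \<in> {0<..<R} \<Longrightarrow> x \<in> {L<..} \<Longrightarrow> h r x =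
      2 * of_real (r * cos (real l * (pi / R) * sqrt (R\<^sup>2 - r\<^sup>2))) *
      (of_real (bessel_J0 (a * sqrt (x\<^sup>2 - L\<^sup>2)) * x) * (of_real ((x\<^sup>2) powr - \<alpha>) * circular_mean f x r))"
  shows "iint (leb_on {0<..<R}) (leb_on {L<..}) h = radial_coeff f R L \<alpha> l (a\<^sup>2)"
proof -
  have "iint (leb_on {0<..<R}) (leb_on {L<..}) h = iint (leb_on {0<..<R}) (leb_on {L<..})
     (\<lambda>r x. 2 * of_real (r * cos (real l * (pi / R) * sqrt (R\<^sup>2 - r\<^sup>2))) *
      (of_real (bessel_J0 (a * sqrt (x\<^sup>2 - L\<^sup>2)) * x) * (of_real ((x\<^sup>2) powr - \<alpha>) * circular_mean f x r)))"
    by (rule iint_cong[OF h])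
  also have "\<dots> = radial_coeff f R L \<alpha> l (a\<^sup>2)"
    unfolding iint_def radial_coeff_def
  proof (rule Bochner_Integration.integral_cong[OF refl])
    fix r assume "r \<in> space (leb_on {0<..<R})"
    then have r: "r \<ge> 0" by simp
    show "(LINT x|leb_on {L<..}. 2 * of_real (r * cos (real l * (pi / R) * sqrt (R\<^sup>2 - r\<^sup>2))) *
      (of_real (bessel_J0 (a * sqrt (x\<^sup>2 - L\<^sup>2)) * x) * (of_real ((x\<^sup>2) powr - \<alpha>) * circular_mean f x r))) =
      of_real (r * cos (real l * (pi / R) * sqrt (R\<^sup>2 - r\<^sup>2))) * bessel_profile f L \<alpha> r (a\<^sup>2)"
      unfolding integral_mult_right_zero axial_substitution[OF f L \<alpha> r] by simp
  qed
  finally show ?thesis .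
qed

lemma G_even_eq_radial_coeff:
  assumes f: "schwartz f" and L: "L > 0"
    and even: "\<And>x r. r \<ge> 0 \<Longrightarrow> circular_mean f (- x) r = circular_mean f x r"
  shows "G_even R L (circular_mean f) l a = of_real (neumann l / (2 * R) * a) * radial_coeff f R L 0 l (a\<^sup>2)"
proof -
  have "pairing_even R L (o_even R L a l) (\<lambda>x r. circular_mean f x r + circular_mean f (- x) r) = radial_coeff f R L 0 l (a\<^sup>2)"
    unfolding pairing_even_def
  proof (rule pairing_eq_radial_coeff[OF f L order_refl])
    fix r x assume r: "r \<in> {0<..<R}" and x: "x \<in> {L<..}"
    have e: "circular_mean f (- x) r = circular_mean f x r" using r by (intro even) simp
    have "x\<^sup>2 \<noteq> 0" using x L by simp
    then have p: "(x\<^sup>2) powr - 0 = 1" by simp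
    show "integrand_even R (o_even R L a l) (\<lambda>x r. circular_mean f x r + circular_mean f (- x) r) r x =
      2 * of_real (r * cos (real l * (pi / R) * sqrt (R\<^sup>2 - r\<^sup>2))) *
      (of_real (bessel_J0 (a * sqrt (x\<^sup>2 - L\<^sup>2)) * x) * (of_real ((x\<^sup>2) powr - 0) * circular_mean f x r))"
      unfolding integrand_even_o_even[OF r x L] e p by (simp add: algebra_simps)
  qed
  then show ?thesis by (simp only: G_even_def)
qed

lemma G_odd_eq_radial_coeff:
  assumes f: "schwartz f" and L: "L > 0"
    and odd: "\<And>x r. r \<ge> 0 \<Longrightarrow> circular_mean f (- x) r = - circular_mean f x r"
  shows "G_odd R L (circular_mean f) l a = of_real (neumann l / (2 * R) * a) * radial_coeff f R L (1 / 2) l (a\<^sup>2)"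
proof -
  have "pairing_odd R L (o_odd R L a l) (\<lambda>x r. circular_mean f x r - circular_mean f (- x) r) = radial_coeff f R L (1 / 2) l (a\<^sup>2)"
    unfolding pairing_odd_def
  proof (rule pairing_eq_radial_coeff[OF f L])
    fix r x assume r: "r \<in> {0<..<R}" and x: "x \<in> {L<..}"
    have e: "circular_mean f (- x) r = - circular_mean f x r" using r by (intro odd) simp
    have x0: "x > 0" using x L by simp
    then have p: "(x\<^sup>2) powr - (1 / 2) = 1 / x" by (simp add: powr_minus powr_half_sqrt inverse_eq_divide)
    show "integrand_odd R (o_odd R L a l) (\<lambda>x r. circular_mean f x r - circular_mean f (- x) r) r x =
      2 * of_real (r * cos (real l * (pi / R) * sqrt (R\<^sup>2 - r\<^sup>2))) *
      (of_real (bessel_J0 (a * sqrt (x\<^sup>2 - L\<^sup>2)) * x) * (of_real ((x\<^sup>2) powr - (1 / 2)) * circular_mean f x r))"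
      unfolding integrand_odd_o_odd[OF r x L] e p using x0 by simp
  qed simp
  then show ?thesis by (simp only: G_odd_def)
qed

text \<open>In the variable \<open>s = sqrt (R\<^sup>2 - r\<^sup>2)\<close> this is the cosine series at \<open>s0\<close> of \<open>s * profile f L
  \<alpha> y (sqrt (R\<^sup>2 - s\<^sup>2))\<close>, which is Lipschitz at the interior point \<open>s0\<close> because the mean is
  Lipschitz.\<close>

lemma profile_fourier_series:
  assumes f: "schwartz f" and R: "R > 0" and L: "L > 0" and \<alpha>: "\<alpha> \<ge> 0" and y: "y \<ge> 0" and r0: "0 < r0" "r0 < R"
  defines "s0 \<equiv> sqrt (R\<^sup>2 - r0\<^sup>2)"
  shows "(\<lambda>l. of_real (neumann l / R * cos (real l * (pi / R) * s0)) *
      (LINT r|leb_on {0<..<R}. of_real (r * cos (real l * (pi / R) * sqrt (R\<^sup>2 - r\<^sup>2))) * profile f L \<alpha> y r))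
    sums (of_real s0 * profile f L \<alpha> y r0)"
proof -
  define q where "q = profile f L \<alpha> y"
  define h where "h = (\<lambda>s. of_real s * q (sqrt (R\<^sup>2 - s\<^sup>2)))"
  have q_cont: "continuous_on UNIV q" unfolding q_def by (rule profile_continuous(2)[OF f L])
  have h_cont: "continuous_on {0..R} h"
    unfolding h_def by (intro continuous_on_mult continuous_on_of_real continuous_on_id continuous_on_compose2[OF q_cont] continuous_intros) auto
  have "r0\<^sup>2 < R\<^sup>2" using r0 by (intro power_strict_mono) auto
  then have s0: "0 < s0" "s0\<^sup>2 = R\<^sup>2 - r0\<^sup>2" by (simp_all add: s0_def)
  have s0_lt: "s0 < R"
  proof (rule power2_less_imp_less)
    show "s0\<^sup>2 < R\<^sup>2" using s0 r0 by simp
  qed (use R in simp)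
  have r0_eq: "sqrt (R\<^sup>2 - s0\<^sup>2) = r0" using s0 r0 by simp
  obtain D where D: "D \<ge> 0" "\<And>v r. v \<ge> 0 \<Longrightarrow> r \<in> {0..R} \<Longrightarrow> norm (profile f L \<alpha> v r) \<le> D / (1 + v\<^sup>2)"
    by (rule profile_bound[OF f L \<alpha>, of R], rule that)
  have q_le: "norm (q r) \<le> D" if "r \<in> {0..R}" for r
  proof -
    have "D / (1 + y\<^sup>2) \<le> D / 1" using D(1) by (intro frac_le) auto
    with D(2)[OF y that] show ?thesis by (simp add: q_def)
  qed
  obtain K where K: "K \<ge> 0"
    "\<And>x r x' r'. norm (circular_mean f x r - circular_mean f x' r') \<le> K * (\<bar>x - x'\<bar> + \<bar>r - r'\<bar>)"
    by (rule circular_mean_lipschitz[OF f], rule that)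
  define A where "A = (y + L\<^sup>2) powr - \<alpha> * K"
  have A: "A \<ge> 0" using K by (simp add: A_def)
  have q_lip: "norm (q r - q r') \<le> A * \<bar>r - r'\<bar>" for r r'
  proof -
    have "q r - q r' = of_real ((y + L\<^sup>2) powr - \<alpha>) * (circular_mean f (sqrt (y + L\<^sup>2)) r - circular_mean f (sqrt (y + L\<^sup>2)) r')"
      by (simp add: q_def profile_def right_diff_distrib)
    then have "norm (q r - q r') = (y + L\<^sup>2) powr - \<alpha> * norm (circular_mean f (sqrt (y + L\<^sup>2)) r - circular_mean f (sqrt (y + L\<^sup>2)) r')"
      by (simp only: norm_mult norm_of_real) simp
    also have "\<dots> \<le> (y + L\<^sup>2) powr - \<alpha> * (K * (\<bar>sqrt (y + L\<^sup>2) - sqrt (y + L\<^sup>2)\<bar> + \<bar>r - r'\<bar>))"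
      by (intro mult_left_mono K) simp
    finally show ?thesis by (simp add: A_def mult.assoc)
  qed
  have "(\<lambda>l. of_real (neumann l / R * cos (real l * (pi / R) * s0)) *
      (LINT s|leb_on {0<..<R}. of_real (cos (real l * (pi / R) * s)) * h s)) sums h s0"
  proof (rule fourier_cosine_series[OF R s0(1) s0_lt h_cont])
    fix s assume s: "s \<in> {0..R}"
    define r where "r = sqrt (R\<^sup>2 - s\<^sup>2)"
    have "s\<^sup>2 \<le> R\<^sup>2" using s by (intro power_mono) auto
    then have r: "r \<ge> 0" "r\<^sup>2 = R\<^sup>2 - s\<^sup>2" by (simp_all add: r_def)
    have "r \<le> R" unfolding r_def using R by (intro real_le_lsqrt) auto
    have "\<bar>r - r0\<bar> * r0 \<le> \<bar>r - r0\<bar> * (r + r0)" using r r0 by (intro mult_left_mono) auto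
    also have "\<dots> = \<bar>(r - r0) * (r + r0)\<bar>" using r r0 by (simp add: abs_mult)
    also have "(r - r0) * (r + r0) = (s0 - s) * (s0 + s)"
      using r s0 by (simp add: power2_eq_square algebra_simps)
    also have "\<bar>(s0 - s) * (s0 + s)\<bar> = \<bar>s - s0\<bar> * (s0 + s)" using s s0 by (simp add: abs_mult)
    also have "\<dots> \<le> \<bar>s - s0\<bar> * (2 * R)" using s s0_lt by (intro mult_left_mono) auto
    finally have dr: "\<bar>r - r0\<bar> \<le> 2 * R / r0 * \<bar>s - s0\<bar>" using r0 by (simp add: pos_le_divide_eq mult.commute)
    have "h s - h s0 = of_real (s - s0) * q r + of_real s0 * (q r - q r0)"
      by (simp add: h_def r_def[symmetric] r0_eq algebra_simps)
    then have "norm (h s - h s0) \<le> \<bar>s - s0\<bar> * norm (q r) + s0 * norm (q r - q r0)"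
      using s0 norm_triangle_ineq[of "of_real (s - s0) * q r" "of_real s0 * (q r - q r0)"]
      by (simp only: norm_mult norm_of_real abs_of_pos)
    also have "\<dots> \<le> \<bar>s - s0\<bar> * D + s0 * (A * (2 * R / r0 * \<bar>s - s0\<bar>))"
    proof (intro add_mono mult_left_mono)
      show "norm (q r) \<le> D" using r \<open>r \<le> R\<close> by (intro q_le) auto
      show "norm (q r - q r0) \<le> A * (2 * R / r0 * \<bar>s - s0\<bar>)"
        by (rule order_trans[OF q_lip mult_left_mono[OF dr A]])
    qed (use s0 in auto)
    also have "\<dots> = (D + s0 * A * (2 * R / r0)) * \<bar>s - s0\<bar>" by (simp add: algebra_simps)
    finally show "norm (h s - h s0) \<le> (D + s0 * A * (2 * R / r0)) * \<bar>s - s0\<bar>" .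
  qed
  moreover have "h s0 = of_real s0 * profile f L \<alpha> y r0" by (simp add: h_def r0_eq q_def)
  moreover have "(LINT r|leb_on {0<..<R}. of_real (r * cos (real l * (pi / R) * sqrt (R\<^sup>2 - r\<^sup>2))) * profile f L \<alpha> y r) =
     (LINT s|leb_on {0<..<R}. of_real (cos (real l * (pi / R) * s)) * h s)" for l
    unfolding h_def q_def[symmetric] by (rule radius_substitution[OF R q_cont])
  ultimately show ?thesis by (simp only:)
qed

text \<open>For each \<open>l\<close> the integral over \<open>a\<close> inverts the Bessel transform, with the factor \<open>4 / 2 = 2\<close>
  from \<open>bessel_inversion\<close> and from \<open>a da = dc / 2\<close>; with \<open>neumann l / (2 * R)\<close> this is the
  normalization of the cosine series. The series yields \<open>s0\<close> times the profile, and the denominator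
  of \<open>o_even\<close> removes \<open>s0\<close>.\<close>

lemma bessel_fourier_expansion:
  assumes f: "schwartz f" and R: "R > 0" and L: "L > 0" and \<alpha>: "\<alpha> \<ge> 0"
    and r0: "0 < r0" "r0 < R" and x0: "x0 > L"
  defines "T \<equiv> \<lambda>l a. o_even R L a l x0 r0 * (of_real (neumann l / (2 * R) * a) * radial_coeff f R L \<alpha> l (a\<^sup>2))"
  shows "integrable (leb_on {0..}) (T l)"
    and "(\<lambda>l. LINT a|leb_on {0..}. T l a) sums profile f L \<alpha> (x0\<^sup>2 - L\<^sup>2) r0"
proof -
  define y where "y = x0\<^sup>2 - L\<^sup>2"
  define s0 where "s0 = sqrt (R\<^sup>2 - r0\<^sup>2)"
  define c where "c = (\<lambda>l. LINT r|leb_on {0<..<R}. of_real (r * cos (real l * (pi / R) * sqrt (R\<^sup>2 - r\<^sup>2))) * profile f L \<alpha> y r)"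
  have "L\<^sup>2 < x0\<^sup>2" using x0 L by (intro power_strict_mono) auto
  then have y: "y \<ge> 0" by (simp add: y_def)
  have "r0\<^sup>2 < R\<^sup>2" using r0 by (intro power_strict_mono) auto
  then have s0: "s0 > 0" by (simp add: s0_def)
  define W where "W = (\<lambda>l a. of_real a * (radial_coeff f R L \<alpha> l (a\<^sup>2) * of_real (bessel_sqrt (y * a\<^sup>2))))"
  have W_int: "integrable (leb_on {0..}) (W l)" for l
    unfolding W_def by (rule radial_coeff_frequency_integral(1)[OF f R L \<alpha> y])
  have W_eq: "(LINT a|leb_on {0..}. W l a) = 2 * c l" for l
    unfolding W_def c_def by (rule radial_coeff_frequency_integral(2)[OF f R L \<alpha> y])
  have T_eq: "T l a = of_real (cos (real l * (pi / R) * s0) / s0 * (neumann l / (2 * R))) * W l a" for l a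
  proof -
    have "(a * sqrt (x0\<^sup>2 - L\<^sup>2))\<^sup>2 = y * a\<^sup>2" using y by (simp add: y_def power_mult_distrib mult.commute)
    then have "bessel_J0 (a * sqrt (x0\<^sup>2 - L\<^sup>2)) = bessel_sqrt (y * a\<^sup>2)" by (simp only: bessel_J0_eq)
    then show ?thesis
      using r0 x0 L unfolding T_def o_even_def W_def s0_def[symmetric] by simp
  qed
  show "integrable (leb_on {0..}) (T l)"
    unfolding T_eq[abs_def] by (rule integrable_mult_right[OF W_int])
  have "(LINT a|leb_on {0..}. T l a) = of_real (1 / s0) * (of_real (neumann l / R * cos (real l * (pi / R) * s0)) * c l)" for l
  proof -
    have "(LINT a|leb_on {0..}. T l a) = of_real (cos (real l * (pi / R) * s0) / s0 * (neumann l / (2 * R))) * (2 * c l)"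
      unfolding T_eq W_eq[symmetric] by (rule integral_mult_right_zero)
    also have "\<dots> = of_real (1 / s0) * (of_real (neumann l / R * cos (real l * (pi / R) * s0)) * c l)"
      using s0 R by (simp add: field_simps)
    finally show ?thesis .
  qed
  moreover have "(\<lambda>l. of_real (1 / s0) * (of_real (neumann l / R * cos (real l * (pi / R) * s0)) * c l)) sums
     (of_real (1 / s0) * (of_real s0 * profile f L \<alpha> y r0))"
    unfolding c_def s0_def by (rule sums_mult[OF profile_fourier_series[OF f R L \<alpha> y r0]])
  moreover have "of_real (1 / s0) * (of_real s0 * profile f L \<alpha> y r0) = profile f L \<alpha> y r0" using s0 by simp
  ultimately show "(\<lambda>l. LINT a|leb_on {0..}. T l a) sums profile f L \<alpha> (x0\<^sup>2 - L\<^sup>2) r0"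
    by (simp only: y_def)
qed

lemma even_expansion:
  assumes f: "schwartz f" and R: "R > 0" and L: "L > 0"
    and even: "\<And>x r. r \<ge> 0 \<Longrightarrow> circular_mean f (- x) r = circular_mean f x r"
    and r: "0 < r" "r < R" and x: "x > L"
  shows "integrable (leb_on {0..}) (\<lambda>a. o_even R L a l x r * G_even R L (circular_mean f) l a)"
    and "(\<lambda>l. LINT a|leb_on {0..}. o_even R L a l x r * G_even R L (circular_mean f) l a) sums circular_mean f x r"
proof -
  have G: "G_even R L (circular_mean f) l a = of_real (neumann l / (2 * R) * a) * radial_coeff f R L 0 l (a\<^sup>2)" for l a
    by (rule G_even_eq_radial_coeff[OF f L even])
  have "profile f L 0 (x\<^sup>2 - L\<^sup>2) r = circular_mean f x r"
    using x L by (simp add: profile_def)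
  then show "(\<lambda>l. LINT a|leb_on {0..}. o_even R L a l x r * G_even R L (circular_mean f) l a) sums circular_mean f x r"
    unfolding G using bessel_fourier_expansion(2)[OF f R L order_refl r x] by (simp only:)
  show "integrable (leb_on {0..}) (\<lambda>a. o_even R L a l x r * G_even R L (circular_mean f) l a)"
    unfolding G by (rule bessel_fourier_expansion(1)[OF f R L order_refl r x])
qed

text \<open>With \<open>\<alpha> = 1 / 2\<close> the expansion represents \<open>g x r / x\<close>, and the factor \<open>x\<close> in \<open>o_odd\<close>
  restores \<open>g x r\<close>.\<close>

lemma odd_expansion:
  assumes f: "schwartz f" and R: "R > 0" and L: "L > 0"
    and odd: "\<And>x r. r \<ge> 0 \<Longrightarrow> circular_mean f (- x) r = - circular_mean f x r"
    and r: "0 < r" "r < R" and x: "x > L"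
  shows "integrable (leb_on {0..}) (\<lambda>a. o_odd R L a l x r * G_odd R L (circular_mean f) l a)"
    and "(\<lambda>l. LINT a|leb_on {0..}. o_odd R L a l x r * G_odd R L (circular_mean f) l a) sums circular_mean f x r"
proof -
  have G: "G_odd R L (circular_mean f) l a = of_real (neumann l / (2 * R) * a) * radial_coeff f R L (1 / 2) l (a\<^sup>2)" for l a
    by (rule G_odd_eq_radial_coeff[OF f L odd])
  have half: "(0::real) \<le> 1 / 2" by simp
  have x0: "x > 0" using x L by simp
  then have "(x\<^sup>2) powr - (1 / 2) = 1 / x" by (simp add: powr_minus powr_half_sqrt inverse_eq_divide)
  then have p: "of_real x * profile f L (1 / 2) (x\<^sup>2 - L\<^sup>2) r = circular_mean f x r"
    using x0 unfolding profile_def diff_add_cancel by simp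
  have "(\<lambda>l. of_real x * (LINT a|leb_on {0..}. o_even R L a l x r * G_odd R L (circular_mean f) l a)) sums circular_mean f x r"
    unfolding G p[symmetric] by (rule sums_mult[OF bessel_fourier_expansion(2)[OF f R L half r x]])
  then show "(\<lambda>l. LINT a|leb_on {0..}. o_odd R L a l x r * G_odd R L (circular_mean f) l a) sums circular_mean f x r"
    unfolding o_odd_def mult.assoc integral_mult_right_zero .
  show "integrable (leb_on {0..}) (\<lambda>a. o_odd R L a l x r * G_odd R L (circular_mean f) l a)"
    unfolding o_odd_def mult.assoc G
    by (rule integrable_mult_right[OF bessel_fourier_expansion(1)[OF f R L half r x]])
qed

theorem theorem3p3p4:
  fixes R L :: real
    and f :: "real \<times> real \<Rightarrow> complex"
    and g :: "real \<Rightarrow> real \<Rightarrow> complex"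
  assumes "R > 0" and "L > 0"
    and "schwartz f"
    and "g = circular_mean f"
  shows
    "((\<forall>a b. b \<ge> 0 \<longrightarrow> G_range_well_defined R g a b) \<and>
      (\<forall>x r. r > R \<longrightarrow>
         iint_finite (leb_on {0..}) (dirac x) (\<lambda>b a. o_range_factor R b r * G_range R g a b) \<and>
         g x r = iint (leb_on {0..}) (dirac x) (\<lambda>b a. o_range_factor R b r * G_range R g a b)))
     \<and>
     ((\<forall>a l. a \<ge> 0 \<longrightarrow> G_even_well_defined R L g l a) \<and>
      ((\<forall>x r. r \<ge> 0 \<longrightarrow> g (- x) r = g x r) \<longrightarrow>
        (\<forall>x r. 0 < r \<and> r < R \<and> x > L \<longrightarrow>
           (\<forall>l. integrable (leb_on {0..}) (\<lambda>a. o_even R L a l x r * G_even R L g l a)) \<and>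
           (\<lambda>l. LINT a|leb_on {0..}. o_even R L a l x r * G_even R L g l a) sums g x r)))
     \<and>
     ((\<forall>a l. a \<ge> 0 \<longrightarrow> G_odd_well_defined R L g l a) \<and>
      ((\<forall>x r. r \<ge> 0 \<longrightarrow> g (- x) r = - g x r) \<longrightarrow>
        (\<forall>x r. 0 < r \<and> r < R \<and> x > L \<longrightarrow>
           (\<forall>l. integrable (leb_on {0..}) (\<lambda>a. o_odd R L a l x r * G_odd R L g l a)) \<and>
           (\<lambda>l. LINT a|leb_on {0..}. o_odd R L a l x r * G_odd R L g l a) sums g x r)))"
proof -
  note R = \<open>R > 0\<close> and L = \<open>L > 0\<close> and f = \<open>schwartz f\<close>
  show ?thesis
    unfolding \<open>g = circular_mean f\<close>
  proof (intro conjI allI impI)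
    fix x r :: real and l :: nat
    assume even: "\<forall>x r. r \<ge> 0 \<longrightarrow> circular_mean f (- x) r = circular_mean f x r"
      and "0 < r \<and> r < R \<and> x > L"
    then have e: "\<And>x r. r \<ge> 0 \<Longrightarrow> circular_mean f (- x) r = circular_mean f x r"
      and r: "0 < r" "r < R" and x: "x > L" by auto
    show "integrable (leb_on {0..}) (\<lambda>a. o_even R L a l x r * G_even R L (circular_mean f) l a)"
      by (rule even_expansion(1)[OF f R L e r x])
    show "(\<lambda>l. LINT a|leb_on {0..}. o_even R L a l x r * G_even R L (circular_mean f) l a) sums circular_mean f x r"
      by (rule even_expansion(2)[OF f R L e r x])
  next
    fix x r :: real and l :: nat
    assume odd: "\<forall>x r. r \<ge> 0 \<longrightarrow> circular_mean f (- x) r = - circular_mean f x r"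
      and "0 < r \<and> r < R \<and> x > L"
    then have o: "\<And>x r. r \<ge> 0 \<Longrightarrow> circular_mean f (- x) r = - circular_mean f x r"
      and r: "0 < r" "r < R" and x: "x > L" by auto
    show "integrable (leb_on {0..}) (\<lambda>a. o_odd R L a l x r * G_odd R L (circular_mean f) l a)"
      by (rule odd_expansion(1)[OF f R L o r x])
    show "(\<lambda>l. LINT a|leb_on {0..}. o_odd R L a l x r * G_odd R L (circular_mean f) l a) sums circular_mean f x r"
      by (rule odd_expansion(2)[OF f R L o r x])
  qed (rule G_range_well_defined_circular_mean[OF f R] range_expansion[OF f R]
      G_even_well_defined_circular_mean[OF f R L] G_odd_well_defined_circular_mean[OF f R L]; assumption?)+
qed

end
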